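(* Let $1<p\le q<\infty$, $n\in\mathbb{N}\cup\{0\}$, $\omega\in\mathcal{D}$, $0<s<1$, and let $\mu$ be a positive Borel measure on $\mathbb{D}$. If the $n$-th differentiation operator $D^{(n)}:A^p_\omega\to L^q_\mu$, $f\mapsto f^{(n)}$, is bounded, then $$\|D^{(n)}\|^q_{e,A^p_\omega\to L^q_\mu}\approx \limsup_{|z|\to1}\frac{\mu(E_s(z))}{(1-|z|)^{nq}\,\omega(S(z))^{q/p}},$$ where the implicit constants do not depend on $\mu$.
   Context: $\mathbb{D}$ is the open unit disc, $dA$ the normalized area measure. A radial weight is a nonnegative $\omega\in L^1([0,1])$ extended by $\omega(z)=\omega(|z|)$; set $\hat\omega(r)=\int_r^1\omega(t)\,dt$, and assume $\hat\omega(r)>0$ for all $r<1$. $\hat{\mathcal{D}}$ is the class of radial weights with $\hat\omega(r)\le C\hat\omega(\frac{1+r}{2})$ for all $0\le r<1$ and some $C\ge1$; $\mathcal{D}$ is the class of $\omega\in\hat{\mathcal{D}}$ for which additionally there are $K>1$, $C>1$ with $\hat\omega(r)\ge C\hat\omega(1-\frac{1-r}{K})$ for all $0\le r<1$. For $\lambda\in\mathbb{D}$, the Carleson square is $S(\lambda)=\{re^{i\theta}:|\lambda|\le r<1,\ |\arg\lambda-\theta|<\frac{1-|\lambda|}{2}\}$ and $\omega(S(\lambda))=\int_{S(\lambda)}\omega\,dA$. $A^p_\omega$ is the space of analytic $f$ on $\mathbb{D}$ with $\|f\|^p_{A^p_\omega}=\int_{\mathbb{D}}|f|^p\omega\,dA<\infty$.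 $L^q_\mu$ is the Lebesgue space $L^q(\mathbb{D},\mu)$. $E_s(a)=\{z\in\mathbb{D}:|\frac{a-z}{1-\bar a z}|<s\}$ is the pseudohyperbolic disc. The essential norm of a bounded operator $T:X\to Y$ is $\|T\|_{e,X\to Y}=\inf\{\|T-K\|_{X\to Y}: K:X\to Y \text{ compact}\}$. $A\approx B$ means $A\lesssim B$ and $B\lesssim A$ with constants independent of the relevant variables. *)

theory Defs
  imports "HOL-Analysis.Analysis"
begin

text \<open>Radial weights are given as functions on reals; \<omega>(z) = \<omega>(|z|).\<close>

definition omega_hat :: "(real \<Rightarrow> real) \<Rightarrow> real \<Rightarrow> real" where
  "omega_hat \<omega> r = (LINT t:{r..1}|lborel. \<omega> t)"

definition radial_weight :: "(real \<Rightarrow> real) \<Rightarrow> bool" where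
  "radial_weight \<omega> \<longleftrightarrow> (\<forall>t\<in>{0..1}. 0 \<le> \<omega> t) \<and> set_integrable lborel {0..1} \<omega>
     \<and> (\<forall>r\<in>{0..<1}. omega_hat \<omega> r > 0)"

definition D_hat_class :: "(real \<Rightarrow> real) set" where
  "D_hat_class = {\<omega>. radial_weight \<omega> \<and>
     (\<exists>C\<ge>1. \<forall>r\<in>{0..<1}. omega_hat \<omega> r \<le> C * omega_hat \<omega> ((1 + r) / 2))}"

definition D_class :: "(real \<Rightarrow> real) set" where
  "D_class = {\<omega>. \<omega> \<in> D_hat_class \<and>
     (\<exists>K>1. \<exists>C>1. \<forall>r\<in>{0..<1}. omega_hat \<omega> r \<ge> C * omega_hat \<omega> (1 - (1 - r) / K))}"

definition wA :: "(real \<Rightarrow> real) \<Rightarrow> complex measure" where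
  "wA \<omega> = density (restrict_space lborel (ball 0 1)) (\<lambda>z. ennreal (\<omega> (norm z) / pi))"

definition carleson_square :: "complex \<Rightarrow> complex set" where
  "carleson_square a = {w. norm a \<le> norm w \<and> norm w < 1 \<and>
      (\<exists>\<theta>. w = complex_of_real (norm w) * cis \<theta> \<and> \<bar>Arg a - \<theta>\<bar> < (1 - norm a) / 2)}"

definition pseudo_hyp_disc :: "real \<Rightarrow> complex \<Rightarrow> complex set" where
  "pseudo_hyp_disc s a = {z \<in> ball 0 1. norm ((a - z) / (1 - cnj a * z)) < s}"

definition bergman_space :: "real \<Rightarrow> (real \<Rightarrow> real) \<Rightarrow> (complex \<Rightarrow> complex) set" where
  "bergman_space p \<omega> = {f. f holomorphic_on ball 0 1 \<and>
      integrable (wA \<omega>) (\<lambda>z. norm (f z) powr p)}"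

definition bergman_norm :: "real \<Rightarrow> (real \<Rightarrow> real) \<Rightarrow> (complex \<Rightarrow> complex) \<Rightarrow> real" where
  "bergman_norm p \<omega> f = (integral\<^sup>L (wA \<omega>) (\<lambda>z. norm (f z) powr p)) powr (1 / p)"

definition Lq_space :: "complex measure \<Rightarrow> real \<Rightarrow> (complex \<Rightarrow> complex) set" where
  "Lq_space \<mu> q = {g. g \<in> borel_measurable \<mu> \<and> integrable \<mu> (\<lambda>z. norm (g z) powr q)}"

definition Lq_norm :: "complex measure \<Rightarrow> real \<Rightarrow> (complex \<Rightarrow> complex) \<Rightarrow> real" where
  "Lq_norm \<mu> q g = (integral\<^sup>L \<mu> (\<lambda>z. norm (g z) powr q)) powr (1 / q)"

text \<open>Bounded operators from A^p_\<omega> to L^q_\<mu> (as maps on representatives).\<close>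
definition bounded_op ::
  "real \<Rightarrow> (real \<Rightarrow> real) \<Rightarrow> complex measure \<Rightarrow> real
     \<Rightarrow> ((complex \<Rightarrow> complex) \<Rightarrow> (complex \<Rightarrow> complex)) \<Rightarrow> bool" where
  "bounded_op p \<omega> \<mu> q T \<longleftrightarrow>
     (\<forall>f\<in>bergman_space p \<omega>. T f \<in> Lq_space \<mu> q) \<and>
     (\<exists>C. \<forall>f\<in>bergman_space p \<omega>. Lq_norm \<mu> q (T f) \<le> C * bergman_norm p \<omega> f)"

definition compact_op ::
  "real \<Rightarrow> (real \<Rightarrow> real) \<Rightarrow> complex measure \<Rightarrow> real
     \<Rightarrow> ((complex \<Rightarrow> complex) \<Rightarrow> (complex \<Rightarrow> complex)) \<Rightarrow> bool" where
  "compact_op p \<omega> \<mu> q K \<longleftrightarrow>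
     bounded_op p \<omega> \<mu> q K \<and>
     (\<forall>f\<in>bergman_space p \<omega>. \<forall>g\<in>bergman_space p \<omega>. \<forall>a b::complex.
        AE z in \<mu>. K (\<lambda>w. a * f w + b * g w) z = a * K f z + b * K g z) \<and>
     (\<forall>F::nat \<Rightarrow> complex \<Rightarrow> complex.
        (\<forall>k. F k \<in> bergman_space p \<omega> \<and> bergman_norm p \<omega> (F k) \<le> 1) \<longrightarrow>
        (\<exists>r g. strict_mono r \<and> g \<in> Lq_space \<mu> q \<and>
           (\<lambda>k. Lq_norm \<mu> q (\<lambda>z. K (F (r k)) z - g z)) \<longlonglongrightarrow> 0))"

definition op_norm ::
  "real \<Rightarrow> (real \<Rightarrow> real) \<Rightarrow> complex measure \<Rightarrow> real
     \<Rightarrow> ((complex \<Rightarrow> complex) \<Rightarrow> (complex \<Rightarrow> complex)) \<Rightarrow> real" where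
  "op_norm p \<omega> \<mu> q T = Sup {Lq_norm \<mu> q (T f) | f. f \<in> bergman_space p \<omega> \<and> bergman_norm p \<omega> f \<le> 1}"

definition essential_norm ::
  "real \<Rightarrow> (real \<Rightarrow> real) \<Rightarrow> complex measure \<Rightarrow> real
     \<Rightarrow> ((complex \<Rightarrow> complex) \<Rightarrow> (complex \<Rightarrow> complex)) \<Rightarrow> real" where
  "essential_norm p \<omega> \<mu> q T = Inf {op_norm p \<omega> \<mu> q (\<lambda>f z. T f z - K f z) | K. compact_op p \<omega> \<mu> q K}"

definition diff_op :: "nat \<Rightarrow> (complex \<Rightarrow> complex) \<Rightarrow> (complex \<Rightarrow> complex)" where
  "diff_op n f = (deriv ^^ n) f"

definition borel_measure_on_disc :: "complex measure \<Rightarrow> bool" where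
  "borel_measure_on_disc \<mu> \<longleftrightarrow> sets \<mu> = sets (restrict_space borel (ball (0::complex) 1))"

end

theory Submission
  imports Defs "HOL-Complex_Analysis.Complex_Analysis"
begin

text \<open>
  Upper bound: cutting $f^{(n)}$ off outside $|z| \le r$ is a compact perturbation by Montel's theorem, so
  the essential norm is controlled by the norm of $f \mapsto f^{(n)}$ into $L^q$ of \<open>\<mu>\<close> restricted to
  $|z| > r$. Averaging the Poisson formula over the annulus
  $(1-|z|)/(2K) < 1-|w| \le (1-|z|)/2$, whose weighted area is comparable to \<open>\<omega>\<close>-hat of $|z|$ by the two
  doubling conditions, bounds $|f^{(n)}(z)|^p$ by an integral of $|f|^p$ against a Poisson-type kernel.
  Since $q \ge p$, Fubini reduces the embedding to a bound on the \<open>\<mu>\<close>-integral of that kernel, which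
  follows from the bound on the measures of pseudohyperbolic discs.

  Lower bound: the functions $((1-|a|^2)/(1-\bar a z))^m$, normalised, tend to 0 locally
  uniformly as $|a| \to 1$. A compact operator maps such a sequence to a norm null sequence along a
  subsequence: since $p > 1$, a sliding hump argument gives sums of $N$ of its members of norm at most
  $(2N)^{1/p}$, so their arithmetic means tend to 0 in norm while the means of their images tend to the limit
  of the images.

  Integration in polar coordinates is replaced throughout by rotation invariance of area measure,
  integrated over the angle of rotation.
\<close>

section \<open>Lebesgue measure on the disc under rotations\<close>

text \<open>A weight of this class may vanish on whole pseudohyperbolic discs, so |f|^p cannot be
  controlled by its weighted mean over a disc around z. Reverse doubling only guarantees mass
  somewhere in an annulus beyond z. This forces the use of whole circles, hence of a kernel that is
  not local: it decays like 1/|w-z|^2 along the annulus. It is still summable: for fixed w the area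
  integral of 1/|w-\<zeta>|^2 over an annulus whose width and distance from w are both comparable to
  1-|w| is bounded independently of w, and averaging \<mu> over small discs turns the \<mu>-integral
  into this area integral. The operators in \<open>compact_op\<close> are maps on representatives,
  linear only almost everywhere, with a sequential compactness condition. The lower bound therefore
  works with explicit finite sums instead of weak convergence and duality; there p > 1 enters
  through N^(1/p)/N tending to 0. \<open>essential_norm\<close> and \<open>op_norm\<close> are
  infima and suprema of reals, so the sets behind them have to be shown nonempty and bounded before
  use.\<close>

unbundle no fps_syntax

text \<open>Identifies the plane with \<open>real^2\<close>, where orthogonal maps act as linear
  isometries of a Cartesian space; the rotation lemma below is proved there and carried
  back.\<close>

lemma distr_lborel_Complex:
  "distr lborel borel (\<lambda>v::real^2. Complex (v $ 1) (v $ 2)) = lborel"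
proof (rule sym, rule lborel_eqI)
  have cont: "continuous_on UNIV (\<lambda>v::real^2. Complex (v $ 1) (v $ 2))"
    unfolding Complex_eq by (intro continuous_intros)
  then have meas: "(\<lambda>v::real^2. Complex (v $ 1) (v $ 2)) \<in> borel_measurable borel"
    by (rule borel_measurable_continuous_onI)
  fix l u :: complex
  assume le: "\<And>b. b \<in> Basis \<Longrightarrow> l \<bullet> b \<le> u \<bullet> b"
  have le': "Re l \<le> Re u" "Im l \<le> Im u"
    using le[of 1] le[of \<i>] by (auto simp: Basis_complex_def)
  have "(\<lambda>v::real^2. Complex (v $ 1) (v $ 2)) -` box l u = box (vector [Re l, Im l]) (vector [Re u, Im u])"
    by (auto simp: mem_box_cart forall_2 in_box_complex_iff)
  moreover have "emeasure lborel (box (vector [Re l, Im l] :: real^2) (vector [Re u, Im u]))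
      = (\<Prod>b\<in>Basis. ennreal ((vector [Re u, Im u] - vector [Re l, Im l] :: real^2) \<bullet> b))"
    using le' by (subst emeasure_lborel_box_eq)
      (auto simp: Basis_vec_def inner_axis forall_2 inner_diff_left UNION_singleton_eq_range UNIV_2 axis_eq_axis
        ennreal_mult)
  ultimately show "emeasure (distr lborel borel (\<lambda>v::real^2. Complex (v $ 1) (v $ 2))) (box l u)
      = (\<Prod>b\<in>Basis. (u - l) \<bullet> b)"
    using le' meas
    by (simp add: emeasure_distr Basis_complex_def Basis_vec_def UNION_singleton_eq_range UNIV_2
      inner_axis axis_eq_axis ennreal_mult mult.commute)
qed simp

lemma distr_lborel_rotate:
  "distr lborel borel (\<lambda>w. w * cis t) = (lborel :: complex measure)"
proof -
  define \<phi> where "\<phi> = (\<lambda>v::real^2. Complex (v $ 1) (v $ 2))"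
  define R where "R = (\<lambda>v::real^2. vector [v$1 * cos t - v$2 * sin t, v$1 * sin t + v$2 * cos t] :: real^2)"
  have meas\<phi>: "\<phi> \<in> borel_measurable borel"
    unfolding \<phi>_def Complex_eq by (intro borel_measurable_continuous_onI continuous_intros)
  have \<phi>: "distr lborel borel \<phi> = lborel"
    unfolding \<phi>_def by (rule distr_lborel_Complex)
  have R\<phi>: "\<phi> (R v) = \<phi> v * cis t" for v
    by (simp add: \<phi>_def R_def complex_eq_iff)
  have "linear R"
    by (rule linearI) (auto simp: R_def vec_eq_iff forall_2 algebra_simps)
  have orth: "orthogonal_transformation R"
    unfolding orthogonal_transformation_def
  proof (intro conjI allI)
    fix v w
    have "R v \<bullet> R w = (v$1 * w$1 + v$2 * w$2) * ((cos t)\<^sup>2 + (sin t)\<^sup>2)"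
      unfolding R_def inner_vec_def sum_2 by (simp del: sin_cos_squared_add sin_cos_squared_add2) algebra
    then show "R v \<bullet> R w = v \<bullet> w"
      by (simp add: inner_vec_def sum_2)
  qed fact
  have bij: "bij R" and inv: "orthogonal_transformation (inv R)"
    using orth by (auto intro: orthogonal_transformation_bij orthogonal_transformation_inv)
  show ?thesis
  proof (rule sym, rule lborel_eqI)
    fix l u :: complex
    assume le: "\<And>b. b \<in> Basis \<Longrightarrow> l \<bullet> b \<le> u \<bullet> b"
    let ?B = "\<phi> -` box l u"
    have B: "?B \<in> sets lborel"
      using measurable_sets[OF meas\<phi>, of "box l u"] by simp
    have fin: "emeasure lborel ?B = emeasure lborel (box l u)"
      by (subst \<phi>[symmetric]) (simp add: emeasure_distr meas\<phi>)
    have Bm: "?B \<in> lmeasurable"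
      using B fin by (auto simp: fmeasurable_def emeasure_lborel_box_eq)
    have vi: "inv R ` ?B = R -` ?B"
      by (simp add: bij bij_vimage_eq_inv_image)
    have Rm: "R \<in> borel_measurable borel"
      using \<open>linear R\<close> by (simp add: borel_measurable_continuous_onI linear_continuous_on linear_conv_bounded_linear)
    have RB: "R -` ?B \<in> sets lborel"
      using measurable_sets[OF Rm, of ?B] B by simp
    have rm: "(\<lambda>w. w * cis t) \<in> borel_measurable borel"
      by measurable
    have "emeasure (distr lborel borel (\<lambda>w. w * cis t)) (box l u) = emeasure lborel ((\<lambda>w. w * cis t) -` box l u)"
      by (simp add: emeasure_distr)
    also have "\<dots> = emeasure lborel (\<phi> -` ((\<lambda>w. w * cis t) -` box l u))"
      by (subst \<phi>[symmetric], subst emeasure_distr)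
        (use measurable_sets[OF rm, of "box l u"] in \<open>auto simp: meas\<phi>\<close>)
    also have "\<phi> -` ((\<lambda>w. w * cis t) -` box l u) = R -` ?B"
      by (auto simp: R\<phi>)
    also have "emeasure lborel (R -` ?B) = emeasure lebesgue (inv R ` ?B)"
      using RB by (simp add: vi)
    also have "\<dots> = emeasure lebesgue ?B"
      using measure_orthogonal_image[OF inv Bm] measurable_orthogonal_image[OF inv Bm] Bm
      by (simp add: emeasure_eq_measure2)
    also have "\<dots> = emeasure lborel (box l u)"
      using B fin by simp
    finally show "emeasure (distr lborel borel (\<lambda>w. w * cis t)) (box l u) = (\<Prod>b\<in>Basis. (u - l) \<bullet> b)"
      using le by (simp add: emeasure_lborel_box_eq)
  qed simp
qed

lemma emeasure_lborel_ball_complex: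
  "0 \<le> r \<Longrightarrow> emeasure lborel (ball (c::complex) r) = ennreal (pi * r\<^sup>2)"
  by (simp add: emeasure_ball unit_ball_vol_2)


text \<open>Both measures give \<open>{x<..}\<close> the mass pi(1 - x^2), the area of an annulus
  and the integral of 2 pi t respectively. Measures that are finite on such half-lines are
  determined by them.\<close>

lemma distr_norm_disc:
  "distr (restrict_space lborel (ball (0::complex) 1)) borel norm
     = density lborel (\<lambda>t. ennreal (2 * pi * t) * indicator {0..1} t)" (is "?M = ?N")
proof (rule measure_eqI_lessThan)
  have M: "emeasure ?M {x<..} = ennreal (pi * (1 - (max 0 x)\<^sup>2))" if "x < 1" "x \<ge> 0" for x
  proof -
    have "emeasure ?M {x<..} = emeasure (restrict_space lborel (ball (0::complex) 1)) (ball 0 1 - cball 0 x)"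
      by (subst emeasure_distr)
        (auto simp: space_restrict_space measurable_restrict_space1 intro!: arg_cong2[where f=emeasure])
    also have "\<dots> = emeasure lborel (ball (0::complex) 1 - cball 0 x)"
      by (subst emeasure_restrict_space) auto
    also have "\<dots> = emeasure lborel (ball (0::complex) 1) - emeasure lborel (cball (0::complex) x)"
      using that by (intro emeasure_Diff) (auto simp: emeasure_cball)
    also have "\<dots> = ennreal (pi * (1 - (max 0 x)\<^sup>2))"
      using that by (simp add: emeasure_ball emeasure_cball unit_ball_vol_2 ennreal_minus algebra_simps)
    finally show ?thesis .
  qed
  have N: "emeasure ?N {x<..} = ennreal (pi * (1 - (max 0 x)\<^sup>2))" if "x < 1" "x \<ge> 0" for x
  proof -
    have "emeasure ?N {x<..} = (\<integral>\<^sup>+t. ennreal (2 * pi * t) * indicator {x..1} t \<partial>lborel)"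
      using that AE_lborel_singleton[of x]
      by (subst emeasure_density, simp, simp) (intro nn_integral_cong_AE, auto split: split_indicator)
    also have "\<dots> = ennreal (pi * 1\<^sup>2 - pi * x\<^sup>2)"
      using that
      by (intro nn_integral_FTC_Icc[where F="\<lambda>t. pi * t\<^sup>2"]) (auto intro!: derivative_eq_intros)
    finally show ?thesis using that by (simp add: algebra_simps max_def)
  qed
  have eq0: "emeasure ?M {x<..} = emeasure ?N {x<..}" if "x \<ge> 0" for x
  proof (cases "x < 1")
    case True
    then show ?thesis using M[of x] N[of x] that by simp
  next
    case False
    then have "cmod -` {x<..} \<inter> ball 0 1 = {}"
      by auto
    then have "emeasure ?M {x<..} = 0"
      by (subst emeasure_distr) (simp_all add: space_restrict_space measurable_restrict_space1)
    moreover have "emeasure ?N {x<..} = 0"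
      using False by (subst emeasure_density) (auto simp: nn_integral_0_iff_AE split: split_indicator)
    ultimately show ?thesis by simp
  qed
  have neg: "emeasure ?M {x<..} = emeasure ?M {0<..}" "emeasure ?N {x<..} = emeasure ?N {0<..}" if "x < 0" for x
  proof -
    have "emeasure ?M {x<..} = emeasure lborel (ball (0::complex) 1)"
      using that by (subst emeasure_distr)
        (auto simp: space_restrict_space measurable_restrict_space1 emeasure_restrict_space
          intro!: arg_cong2[where f=emeasure] less_le_trans[OF that])
    also have "\<dots> = emeasure ?M {0<..}"
      using M[of 0] by (simp add: emeasure_ball unit_ball_vol_2)
    finally show "emeasure ?M {x<..} = emeasure ?M {0<..}" .
    show "emeasure ?N {x<..} = emeasure ?N {0<..}"
      using that by (simp add: emeasure_density) (auto intro!: nn_integral_cong split: split_indicator)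
  qed
  show "emeasure ?M {x<..} < \<infinity>" for x
  proof -
    have "emeasure ?M {x<..} \<le> emeasure ?M {-1<..}" if "x \<ge> 0"
      using that by (intro emeasure_mono) auto
    moreover have "emeasure ?M {y<..} < \<infinity>" if "y < 0" for y
      using neg(1)[OF that] M[of 0] by simp
    ultimately show ?thesis
      by (meson less_eq_real_def linorder_not_le neg_less_0_iff_less order_le_less_trans zero_less_one)
  qed
  show "emeasure ?M {x<..} = emeasure ?N {x<..}" for x
    using neg[of x] eq0[of x] eq0[of 0] by (cases "x < 0") auto
qed simp_all

section \<open>Radial weights\<close>

locale radial =
  fixes \<omega> :: "real \<Rightarrow> real"
  assumes weight: "radial_weight \<omega>"
begin

lemma weight_nonneg: "0 \<le> t \<Longrightarrow> t \<le> 1 \<Longrightarrow> 0 \<le> \<omega> t"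
  using weight by (auto simp: radial_weight_def)

lemma weight_integrable: "set_integrable lborel {0..1} \<omega>"
  using weight by (auto simp: radial_weight_def)

lemma omega_hat_pos: "0 \<le> r \<Longrightarrow> r < 1 \<Longrightarrow> 0 < omega_hat \<omega> r"
  using weight by (auto simp: radial_weight_def)

text \<open>Nothing is known about \<omega> outside [0,1], not even measurability; the truncation is
  a Borel function on the whole line.\<close>

definition weight01 :: "real \<Rightarrow> real" where
  "weight01 t = indicator {0..1} t * \<omega> t"

lemma weight01_measurable [measurable]: "weight01 \<in> borel_measurable borel"
  using weight_integrable unfolding weight01_def[abs_def]
  by (auto simp: set_integrable_def dest: borel_measurable_integrable)

lemma weight_indicator_measurable:
  "0 \<le> a \<Longrightarrow> b \<le> 1 \<Longrightarrow> (\<lambda>t. ennreal (\<omega> t) * indicator {a..<b} t) \<in> borel_measurable borel"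
proof -
  assume ab: "0 \<le> a" "b \<le> 1"
  have "(\<lambda>t. ennreal (\<omega> t) * indicator {a..<b} t) = (\<lambda>t. ennreal (weight01 t) * indicator {a..<b} t)"
    using ab by (auto simp: weight01_def fun_eq_iff split: split_indicator)
  then show ?thesis by simp
qed

text \<open>The density of \<open>wA \<omega>\<close> with respect to Lebesgue measure on the whole
  plane, so that rotation invariance and Fubini can be applied to \<open>lborel\<close>.\<close>

definition disc_density :: "complex \<Rightarrow> ennreal" where
  "disc_density w = ennreal (weight01 (norm w) / pi) * indicator (ball 0 1) w"

lemma disc_density_measurable [measurable]: "disc_density \<in> borel_measurable borel"
  unfolding disc_density_def[abs_def] by (intro borel_measurable_times_ennreal borel_measurable_indicator) auto

lemma density_measurable_restrict:
  "(\<lambda>z::complex. ennreal (\<omega> (norm z) / pi)) \<in> borel_measurable (restrict_space lborel (ball 0 1))"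
proof -
  have "disc_density \<in> borel_measurable (restrict_space lborel (ball 0 1))"
    by (rule measurable_restrict_space1) simp
  then show ?thesis
    by (rule measurable_cong[THEN iffD1, rotated]) (auto simp: disc_density_def weight01_def space_restrict_space)
qed

lemma space_wA [simp]: "space (wA \<omega>) = ball 0 1"
  by (simp add: wA_def space_restrict_space)

lemma sets_wA [measurable_cong]: "sets (wA \<omega>) = sets (restrict_space borel (ball 0 1))"
  by (simp add: wA_def) (simp add: sets_restrict_space)

lemma borel_measurable_wA: "F \<in> borel_measurable borel \<Longrightarrow> F \<in> borel_measurable (wA \<omega>)"
  by (simp add: measurable_cong_sets[OF sets_wA refl] measurable_restrict_space1)

lemma sets_wAI: "A \<in> sets borel \<Longrightarrow> A \<subseteq> ball 0 1 \<Longrightarrow> A \<in> sets (wA \<omega>)"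
  by (simp add: sets_wA sets_restrict_space_iff)

lemma nn_integral_wA:
  assumes [measurable]: "F \<in> borel_measurable borel"
  shows "(\<integral>\<^sup>+w. F w \<partial>wA \<omega>) = (\<integral>\<^sup>+w. disc_density w * F w \<partial>lborel)"
proof -
  have "(\<integral>\<^sup>+w. F w \<partial>wA \<omega>) = (\<integral>\<^sup>+w. ennreal (\<omega> (norm w) / pi) * F w \<partial>restrict_space lborel (ball 0 1))"
    unfolding wA_def
    by (rule nn_integral_density[OF density_measurable_restrict]) (simp add: measurable_restrict_space1)
  also have "\<dots> = (\<integral>\<^sup>+w. ennreal (\<omega> (norm w) / pi) * F w * indicator (ball 0 1) w \<partial>lborel)"
    by (rule nn_integral_restrict_space) auto
  also have "\<dots> = (\<integral>\<^sup>+w. disc_density w * F w \<partial>lborel)"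
    by (intro nn_integral_cong) (auto simp: disc_density_def weight01_def split: split_indicator)
  finally show ?thesis .
qed

lemma nn_integral_wA_rotate:
  assumes F [measurable]: "F \<in> borel_measurable borel"
  shows "(\<integral>\<^sup>+w. F (w * cis t) \<partial>wA \<omega>) = (\<integral>\<^sup>+w. F w \<partial>wA \<omega>)"
proof -
  have "(\<integral>\<^sup>+w. F w \<partial>wA \<omega>) = (\<integral>\<^sup>+w. disc_density w * F w \<partial>distr lborel borel (\<lambda>w. w * cis t))"
    by (simp add: nn_integral_wA distr_lborel_rotate)
  also have "\<dots> = (\<integral>\<^sup>+w. disc_density (w * cis t) * F (w * cis t) \<partial>lborel)"
    by (subst nn_integral_distr) auto
  also have "\<dots> = (\<integral>\<^sup>+w. disc_density w * F (w * cis t) \<partial>lborel)"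
    by (simp add: disc_density_def weight01_def norm_mult indicator_def)
  finally show ?thesis by (simp add: nn_integral_wA)
qed

text \<open>Stands in for polar coordinates: F may be replaced by its mean over the circle through
  each point. The interval of turns is left free because one period suits the Poisson integrals,
  while for Carleson squares three periods are taken so that a full arc surely fits.\<close>

lemma nn_integral_wA_average:
  assumes F [measurable]: "F \<in> borel_measurable borel" and "a \<le> b"
  shows "(\<integral>\<^sup>+w. (\<integral>\<^sup>+x. F (w * cis (2 * pi * x)) * indicator {a..b} x \<partial>lborel) \<partial>wA \<omega>)
       = ennreal (b - a) * (\<integral>\<^sup>+w. F w \<partial>wA \<omega>)"
proof -
  have [measurable]: "(\<lambda>(w, x). F (w * cis (2 * pi * x)) * indicator {a..b} x) \<in> borel_measurable (borel \<Otimes>\<^sub>M borel)"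
  proof -
    have "(\<lambda>p::complex \<times> real. fst p * cis (2 * pi * snd p)) \<in> borel_measurable borel"
      unfolding cis_conv_exp by (intro borel_measurable_continuous_onI continuous_intros)
    then have [measurable]: "(\<lambda>p::complex \<times> real. fst p * cis (2 * pi * snd p)) \<in> borel_measurable (borel \<Otimes>\<^sub>M borel)"
      by (simp add: borel_prod)
    show ?thesis unfolding case_prod_beta by measurable
  qed
  have "(\<integral>\<^sup>+w. (\<integral>\<^sup>+x. F (w * cis (2 * pi * x)) * indicator {a..b} x \<partial>lborel) \<partial>wA \<omega>)
      = (\<integral>\<^sup>+w. (\<integral>\<^sup>+x. disc_density w * (F (w * cis (2 * pi * x)) * indicator {a..b} x) \<partial>lborel) \<partial>lborel)"
    by (subst nn_integral_wA) (auto intro!: nn_integral_cong nn_integral_cmult[symmetric])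
  also have "\<dots> = (\<integral>\<^sup>+x. (\<integral>\<^sup>+w. disc_density w * (F (w * cis (2 * pi * x)) * indicator {a..b} x) \<partial>lborel) \<partial>lborel)"
    by (rule lborel_pair.Fubini[of "\<lambda>(w, x). disc_density w * (F (w * cis (2 * pi * x)) * indicator {a..b} x)", simplified, symmetric])
  also have "\<dots> = (\<integral>\<^sup>+x. (\<integral>\<^sup>+w. F (w * cis (2 * pi * x)) \<partial>wA \<omega>) * indicator {a..b} x \<partial>lborel)"
    by (intro nn_integral_cong) (auto simp: nn_integral_wA split: split_indicator)
  also have "\<dots> = (\<integral>\<^sup>+x. (\<integral>\<^sup>+w. F w \<partial>wA \<omega>) * indicator {a..b} x \<partial>lborel)"
    by (simp add: nn_integral_wA_rotate)
  also have "\<dots> = ennreal (b - a) * (\<integral>\<^sup>+w. F w \<partial>wA \<omega>)"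
    using \<open>a \<le> b\<close> by (simp add: nn_integral_cmult_indicator mult.commute)
  finally show ?thesis .
qed

lemma nn_integral_weight:
  assumes "0 \<le> a" "a \<le> b" "b \<le> 1"
  shows "(\<integral>\<^sup>+t. ennreal (\<omega> t) * indicator {a..<b} t \<partial>lborel) = ennreal (omega_hat \<omega> a - omega_hat \<omega> b)"
proof -
  have int: "set_integrable lborel A \<omega>" if "A \<subseteq> {0..1}" "A \<in> sets borel" for A
    using set_integrable_subset[OF weight_integrable] that by simp
  have "{a..1} = {a..<b} \<union> {b..1}"
    using assms by auto
  then have "omega_hat \<omega> a = (LINT t:{a..<b}|lborel. \<omega> t) + omega_hat \<omega> b"
    unfolding omega_hat_def using assms by (simp only:) (subst set_integral_Un, auto intro!: int)
  moreover have "(\<integral>\<^sup>+t. ennreal (\<omega> t) * indicator {a..<b} t \<partial>lborel) = ennreal (LINT t:{a..<b}|lborel. \<omega> t)"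
    unfolding set_lebesgue_integral_def
    using int[of "{a..<b}", unfolded set_integrable_def] assms weight_nonneg
    by (subst nn_integral_eq_integral[symmetric])
       (auto simp: subset_iff split: split_indicator intro!: nn_integral_cong)
  ultimately show ?thesis by simp
qed

lemma omega_hat_antimono: "0 \<le> a \<Longrightarrow> a \<le> b \<Longrightarrow> omega_hat \<omega> b \<le> omega_hat \<omega> a"
  unfolding omega_hat_def set_lebesgue_integral_def
  by (intro integral_mono set_integrable_subset[OF weight_integrable, unfolded set_integrable_def])
     (auto simp: weight_nonneg split: split_indicator)

lemma omega_hat_1: "omega_hat \<omega> 1 = 0"
proof -
  have "AE t in lborel. indicator {1..1} t *\<^sub>R \<omega> t = 0"
    using AE_lborel_singleton[of "1::real"] by eventually_elim (auto split: split_indicator)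
  then show ?thesis
    unfolding omega_hat_def set_lebesgue_integral_def by (rule integral_eq_zero_AE)
qed

lemma omega_hat_nonneg: "0 \<le> a \<Longrightarrow> 0 \<le> omega_hat \<omega> a"
  using omega_hat_antimono[of a "max a 1"] omega_hat_1
  by (cases "a \<le> 1") (auto simp: max_def omega_hat_def set_lebesgue_integral_def)

lemma nn_integral_wA_radial:
  assumes [measurable]: "g \<in> borel_measurable borel"
  shows "(\<integral>\<^sup>+w. g (norm (w::complex)) \<partial>wA \<omega>) = (\<integral>\<^sup>+t. ennreal (2 * t * \<omega> t) * indicator {0..<1} t * g t \<partial>lborel)"
proof -
  have "(\<integral>\<^sup>+w. g (norm w) \<partial>wA \<omega>)
      = (\<integral>\<^sup>+w. ennreal (\<omega> (norm (w::complex)) / pi) * g (norm w) \<partial>restrict_space lborel (ball 0 1))"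
    unfolding wA_def
    by (rule nn_integral_density[OF density_measurable_restrict]) (simp add: measurable_restrict_space1)
  also have "\<dots> = (\<integral>\<^sup>+w. (\<lambda>t. ennreal (weight01 t / pi) * g t) (norm w) \<partial>restrict_space lborel (ball (0::complex) 1))"
    by (intro nn_integral_cong) (auto simp: space_restrict_space weight01_def)
  also have "\<dots> = (\<integral>\<^sup>+t. ennreal (weight01 t / pi) * g t \<partial>distr (restrict_space lborel (ball (0::complex) 1)) borel norm)"
    by (subst nn_integral_distr) (auto simp: measurable_restrict_space1)
  also have "\<dots> = (\<integral>\<^sup>+t. ennreal (2 * pi * t) * indicator {0..1} t * (ennreal (weight01 t / pi) * g t) \<partial>lborel)"
    unfolding distr_norm_disc by (subst nn_integral_density) auto
  also have "\<dots> = (\<integral>\<^sup>+t. ennreal (2 * t * \<omega> t) * indicator {0..<1} t * g t \<partial>lborel)"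
    using AE_lborel_singleton[of 1]
    by (intro nn_integral_cong_AE)
      (auto simp: weight01_def ennreal_mult[symmetric] mult.assoc[symmetric] weight_nonneg split: split_indicator)
  finally show ?thesis .
qed

lemma emeasure_annulus_le:
  assumes "0 \<le> a" "a < 1"
  shows "emeasure (wA \<omega>) {w \<in> ball 0 1. a \<le> norm w} \<le> ennreal (2 * omega_hat \<omega> a)"
proof -
  have "emeasure (wA \<omega>) {w \<in> ball 0 1. a \<le> norm w} = (\<integral>\<^sup>+w. indicator {a..} (norm w) \<partial>wA \<omega>)"
    by (subst nn_integral_indicator[symmetric]) (auto intro!: nn_integral_cong sets_wAI split: split_indicator)
  also have "\<dots> = (\<integral>\<^sup>+t. ennreal (2 * t * \<omega> t) * indicator {0..<1} t * indicator {a..} t \<partial>lborel)"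
    by (rule nn_integral_wA_radial) simp
  also have "\<dots> \<le> (\<integral>\<^sup>+t. 2 * (ennreal (\<omega> t) * indicator {a..<1} t) \<partial>lborel)"
  proof (intro nn_integral_mono)
    fix t
    show "ennreal (2 * t * \<omega> t) * indicator {0..<1} t * indicator {a..} t \<le> 2 * (ennreal (\<omega> t) * indicator {a..<1} t)"
      using weight_nonneg[of t] assms mult_right_mono[of t 1 "\<omega> t"]
      by (auto split: split_indicator simp: ennreal_mult'[symmetric] ennreal_numeral[symmetric] simp del: ennreal_numeral intro!: ennreal_leI)
  qed
  also have "\<dots> = 2 * (\<integral>\<^sup>+t. ennreal (\<omega> t) * indicator {a..<1} t \<partial>lborel)"
    using weight_indicator_measurable[of a 1] assms by (intro nn_integral_cmult) auto
  also have "\<dots> = ennreal (2 * omega_hat \<omega> a)"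
    using nn_integral_weight[of a 1] assms omega_hat_pos[of a]
    by (simp add: omega_hat_1 ennreal_mult)
  finally show ?thesis .
qed

text \<open>The radial density is 2t\<omega>(t); the condition \<open>1/2 \<le> a\<close> is what
  makes 2t at least 1 on the annulus.\<close>

lemma emeasure_annulus_ge:
  assumes "1/2 \<le> a" "a \<le> b" "b \<le> 1"
  shows "ennreal (omega_hat \<omega> a - omega_hat \<omega> b) \<le> emeasure (wA \<omega>) {w \<in> ball 0 1. a \<le> norm w \<and> norm w < b}"
proof -
  have "ennreal (omega_hat \<omega> a - omega_hat \<omega> b) = (\<integral>\<^sup>+t. ennreal (\<omega> t) * indicator {a..<b} t \<partial>lborel)"
    using assms by (simp add: nn_integral_weight)
  also have "\<dots> \<le> (\<integral>\<^sup>+t. ennreal (2 * t * \<omega> t) * indicator {0..<1} t * indicator {a..<b} t \<partial>lborel)"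
  proof (intro nn_integral_mono)
    fix t
    show "ennreal (\<omega> t) * indicator {a..<b} t \<le> ennreal (2 * t * \<omega> t) * indicator {0..<1} t * indicator {a..<b} t"
      using weight_nonneg[of t] assms mult_right_mono[of 1 "2 * t" "\<omega> t"]
      by (auto split: split_indicator intro!: ennreal_leI)
  qed
  also have "\<dots> = (\<integral>\<^sup>+w. indicator {a..<b} (norm w) \<partial>wA \<omega>)"
    by (rule nn_integral_wA_radial[symmetric]) simp
  also have "\<dots> = emeasure (wA \<omega>) {w \<in> ball 0 1. a \<le> norm w \<and> norm w < b}"
    by (subst nn_integral_indicator[symmetric]) (auto intro!: nn_integral_cong sets_wAI split: split_indicator)
  finally show ?thesis .
qed

end

section \<open>Carleson squares\<close>

text \<open>One choice of the doubling constants is fixed here, so that every later constant is an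
  explicit expression in them and visibly independent of \<mu>.\<close>

locale D_weight = radial +
  fixes B K R :: real
  assumes B: "1 \<le> B" and doubling: "\<And>r. 0 \<le> r \<Longrightarrow> r < 1 \<Longrightarrow> omega_hat \<omega> r \<le> B * omega_hat \<omega> ((1 + r) / 2)"
    and K: "1 < K" and R: "1 < R"
    and reverse_doubling: "\<And>r. 0 \<le> r \<Longrightarrow> r < 1 \<Longrightarrow> R * omega_hat \<omega> (1 - (1 - r) / K) \<le> omega_hat \<omega> r"
begin

text \<open>Each doubling step halves 1 - r. Monotonicity of \<open>omega_hat\<close> absorbs the
  overshoot when the iterates pass t.\<close>

lemma omega_hat_doubling_power:
  "0 \<le> r \<Longrightarrow> t < 1 \<Longrightarrow> 1 - r \<le> 2 ^ j * (1 - t) \<Longrightarrow> 0 \<le> t \<Longrightarrow> omega_hat \<omega> r \<le> B ^ j * omega_hat \<omega> t"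
proof (induction j arbitrary: r)
  case 0
  then show ?case using omega_hat_antimono[of t r] by simp
next
  case (Suc j)
  show ?case
  proof (cases "r < 1")
    case True
    have "omega_hat \<omega> ((1 + r) / 2) \<le> B ^ j * omega_hat \<omega> t"
      using Suc.prems by (intro Suc.IH) (auto simp: field_simps)
    then have "B * omega_hat \<omega> ((1 + r) / 2) \<le> B * (B ^ j * omega_hat \<omega> t)"
      using B by (intro mult_left_mono) auto
    then show ?thesis using doubling[of r] True Suc.prems by simp
  next
    case False
    then have "omega_hat \<omega> r \<le> 1 * omega_hat \<omega> t"
      using omega_hat_antimono[of t r] Suc.prems by simp
    also have "\<dots> \<le> B ^ Suc j * omega_hat \<omega> t"
      using B omega_hat_nonneg[of t] Suc.prems by (intro mult_right_mono one_le_power) auto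
    finally show ?thesis .
  qed
qed

lemma omega_hat_reverse:
  assumes "0 \<le> r" "r < 1"
  shows "(1 - 1 / R) * omega_hat \<omega> r \<le> omega_hat \<omega> r - omega_hat \<omega> (1 - (1 - r) / K)"
  using reverse_doubling[OF assms] R by (simp add: field_simps)

end

text \<open>Counted in turns, the rotations that bring w into the square form open intervals of
  length (1-|a|)/(2 pi), one around c + k for every integer k. The window [-1,2] contains one of
  them completely, wherever c lies, and meets only boundedly many.\<close>

lemma cis_average_indicator_carleson_square:
  assumes "norm a \<le> norm w" "norm w < 1" "w \<noteq> 0"
  defines "S \<equiv> {x \<in> {-1..2}. w * cis (2 * pi * x) \<in> carleson_square a}"
  shows "S \<in> sets lborel" "ennreal ((1 - norm a) / (2 * pi)) \<le> emeasure lborel S"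
    "emeasure lborel S \<le> ennreal (5 * (1 - norm a))"
proof -
  define h where "h = 1 - norm a"
  have h: "0 < h" "h \<le> 1" using assms by (auto simp: h_def)
  \<comment> \<open>\<open>c\<close> is the number of turns that gives w the argument of a;
    \<open>e\<close> below is the half-width of the square's arc, also in turns.\<close>
  define c where "c = (Arg a - Arg w) / (2 * pi)"
  have c: "-1 < c" "c < 1"
    using Arg_bounded[of a] Arg_bounded[of w] unfolding c_def by (auto simp: field_simps)
  define e where "e = h / (4 * pi)"
  define I where "I = (\<lambda>k::int. {c + k - e <..< c + k + e})"
  have w: "w = norm w * cis (Arg w)"
    using rcis_cmod_Arg[of w] by (simp add: rcis_def)
  have iff: "w * cis (2 * pi * x) \<in> carleson_square a \<longleftrightarrow> (\<exists>k::int. x \<in> I k)" for x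
  proof
    assume "w * cis (2 * pi * x) \<in> carleson_square a"
    then obtain \<theta> where \<theta>: "w * cis (2 * pi * x) = norm w * cis \<theta>" "\<bar>Arg a - \<theta>\<bar> < h / 2"
      by (auto simp: carleson_square_def norm_mult h_def)
    have "norm w * cis (Arg w + 2 * pi * x) = norm w * cis \<theta>"
      using \<theta>(1) w by (metis cis_mult mult.assoc)
    then have "cis (Arg w + 2 * pi * x) = cis \<theta>"
      using \<open>w \<noteq> 0\<close> by simp
    then obtain k :: int where k: "Arg w + 2 * pi * x = \<theta> + 2 * pi * k"
      unfolding cis_conv_exp exp_eq by (auto simp: complex_eq_iff)
    then have "x = (\<theta> - Arg w + 2 * pi * k) / (2 * pi)"
      by (simp add: field_simps)
    then have "x = c + k + (\<theta> - Arg a) / (2 * pi)"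
      by (simp add: c_def add_divide_distrib diff_divide_distrib)
    moreover define d where "d = (\<theta> - Arg a) / (2 * pi)"
    moreover have "\<bar>d\<bar> < e"
      using \<theta>(2) by (simp add: e_def d_def field_simps abs_minus_commute)
    ultimately have "x = c + k + d" "\<bar>d\<bar> < e"
      by auto
    then show "\<exists>k::int. x \<in> I k"
      unfolding I_def by (intro exI[of _ k]) (auto simp: abs_less_iff)
  next
    assume "\<exists>k::int. x \<in> I k"
    then obtain k :: int where k: "x \<in> I k" by auto
    define \<theta> where "\<theta> = Arg w + 2 * pi * x - 2 * pi * k"
    have "\<theta> - Arg a = 2 * pi * (x - c - k)"
      by (simp add: \<theta>_def c_def field_simps)
    then have "\<bar>Arg a - \<theta>\<bar> = 2 * pi * \<bar>x - c - k\<bar>"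
      by (metis abs_minus_commute abs_mult abs_of_pos pi_gt_zero mult_pos_pos zero_less_numeral)
    also have "\<dots> < 2 * pi * e"
      using k by (intro mult_strict_left_mono) (auto simp: I_def abs_less_iff)
    finally have "\<bar>Arg a - \<theta>\<bar> < h / 2" by (simp add: e_def)
    moreover have "cis (Arg w + 2 * pi * x) = cis \<theta>"
      unfolding \<theta>_def by (simp add: cis_divide[symmetric] cis_multiple_2pi)
    then have "w * cis (2 * pi * x) = norm w * cis \<theta>"
      by (metis w cis_mult mult.assoc)
    ultimately show "w * cis (2 * pi * x) \<in> carleson_square a"
      using assms(1,2) by (auto simp: carleson_square_def norm_mult h_def)
  qed
  have S: "S = {-1..2} \<inter> (\<Union>k. I k)"
    by (auto simp: S_def iff)
  show "S \<in> sets lborel"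
    unfolding S by (auto simp: I_def)
  have h4: "0 < e" "e < 1"
    using h pi_gt3 by (simp_all add: e_def field_simps)
  have mI: "emeasure lborel (I k) = ennreal (h / (2 * pi))" for k
    using h by (simp add: I_def e_def field_simps)
  \<comment> \<open>A generous count: nine intervals of length h/(2 pi) have total length at most
    5h.\<close>
  have "emeasure lborel S \<le> emeasure lborel (\<Union>k\<in>{-4..4}. I k)"
  proof (intro emeasure_mono)
    show "S \<subseteq> (\<Union>k\<in>{-4..4}. I k)"
    proof
      fix x assume "x \<in> S"
      then obtain k :: int where k: "x \<in> I k" "-1 \<le> x" "x \<le> 2" unfolding S by auto
      then have "of_int k < (5::real)" "-5 < (of_int k::real)"
        using h4 c by (auto simp: I_def)
      then have "k \<in> {-4..4}" by auto
      then show "x \<in> (\<Union>k\<in>{-4..4}. I k)" using k by auto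
    qed
  qed (auto simp: I_def)
  also have "\<dots> \<le> (\<Sum>k\<in>{-4..4}. emeasure lborel (I k))"
    by (intro emeasure_subadditive_finite) (auto simp: I_def)
  also have "\<dots> = ennreal (9 * (h / (2 * pi)))"
    using h ennreal_mult[of 9 "h / (2 * pi)"] by (simp add: mI)
  also have "\<dots> \<le> ennreal (5 * h)"
    using h pi_gt3 by (intro ennreal_leI) (simp add: field_simps)
  finally show "emeasure lborel S \<le> ennreal (5 * (1 - norm a))" by (simp add: h_def)
  \<comment> \<open>Shifting a negative \<open>c\<close> by one turn puts the centre into [0,1), and
    e < 1 keeps the interval inside the window.\<close>
  define k0 :: int where "k0 = (if c < 0 then 1 else 0)"
  have "I k0 \<subseteq> {-1..2}"
    using c h4 by (auto simp: I_def k0_def)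
  then have "I k0 \<subseteq> S"
    unfolding S by blast
  then have "emeasure lborel (I k0) \<le> emeasure lborel S"
    by (intro emeasure_mono) (auto simp: S I_def)
  then show "ennreal ((1 - norm a) / (2 * pi)) \<le> emeasure lborel S"
    by (simp add: mI h_def)
qed

text \<open>Removes the existential angle, so that measurability becomes visible: cosine is
  decreasing on [0, pi], and the half-angle is at most 1/2. The case a = 0 is excluded because the
  square then contains 0, where the strict inequality fails.\<close>

lemma carleson_square_eq:
  assumes "a \<noteq> 0"
  shows "carleson_square a = {w. norm a \<le> norm w \<and> norm w < 1 \<and>
     norm w * cos ((1 - norm a) / 2) < Re (w * cis (- Arg a))}"
proof (intro set_eqI iffI)
  fix w assume "w \<in> carleson_square a"
  then obtain \<theta> where w: "norm a \<le> norm w" "norm w < 1" "w = norm w * cis \<theta>" "\<bar>Arg a - \<theta>\<bar> < (1 - norm a) / 2"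
    by (auto simp: carleson_square_def)
  have "w * cis (- Arg a) = norm w * cis (\<theta> - Arg a)"
    by (subst w(3)) (simp add: cis_mult mult.assoc)
  then have "Re (w * cis (- Arg a)) = norm w * cos \<bar>Arg a - \<theta>\<bar>"
    by (simp add: abs_minus_commute[of "Arg a"])
  moreover have "cos ((1 - norm a) / 2) < cos \<bar>Arg a - \<theta>\<bar>"
    using w pi_gt3 norm_ge_zero[of a] by (intro cos_monotone_0_pi) (auto simp del: norm_ge_zero)
  moreover have "norm w > 0" using w assms by (metis norm_le_zero_iff not_le order_trans)
  ultimately show "w \<in> {w. norm a \<le> norm w \<and> norm w < 1 \<and> norm w * cos ((1 - norm a) / 2) < Re (w * cis (- Arg a))}"
    using w by simp
next
  fix w assume "w \<in> {w. norm a \<le> norm w \<and> norm w < 1 \<and> norm w * cos ((1 - norm a) / 2) < Re (w * cis (- Arg a))}"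
  then have w: "norm a \<le> norm w" "norm w < 1" "norm w * cos ((1 - norm a) / 2) < Re (w * cis (- Arg a))"
    by auto
  have nw: "norm w > 0" using w assms by (metis norm_le_zero_iff not_le order_trans)
  define \<phi> where "\<phi> = Arg (w * cis (- Arg a))"
  have e: "w * cis (- Arg a) = norm w * cis \<phi>"
    using rcis_cmod_Arg[of "w * cis (- Arg a)"] by (simp add: rcis_def norm_mult \<phi>_def)
  then have "Re (w * cis (- Arg a)) = norm w * cos \<phi>"
    by simp
  then have "cos ((1 - norm a) / 2) < cos \<bar>\<phi>\<bar>"
    using w nw by simp
  moreover have "\<bar>\<phi>\<bar> \<le> pi"
    using Arg_bounded[of "w * cis (- Arg a)"] by (auto simp: \<phi>_def)
  ultimately have "\<bar>\<phi>\<bar> < (1 - norm a) / 2"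
    using cos_monotone_0_pi_le[of "(1 - norm a) / 2" "\<bar>\<phi>\<bar>"] w by (smt (verit) norm_ge_zero divide_nonneg_nonneg)
  moreover have "w = norm w * cis (Arg a + \<phi>)"
  proof -
    have "w = (w * cis (- Arg a)) * cis (Arg a)" by (simp add: mult.assoc cis_mult)
    also have "\<dots> = norm w * cis (Arg a + \<phi>)" by (simp add: e mult.assoc cis_mult add.commute)
    finally show ?thesis .
  qed
  ultimately show "w \<in> carleson_square a"
    using w by (auto simp: carleson_square_def intro!: exI[of _ "Arg a + \<phi>"])
qed

lemma carleson_square_borel: "a \<noteq> 0 \<Longrightarrow> carleson_square a \<in> sets borel"
  by (simp add: carleson_square_eq)

section \<open>The weighted area of Carleson squares\<close>

context radial
begin

text \<open>Averaging the indicator of the square over three full turns gives 3\<omega>(S(a)) on one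
  side. On the other side it gives the integral over the annulus of \<open>G\<close>, the length of
  the set of admissible rotations, which is comparable to 1-|a|.\<close>

lemma emeasure_carleson_square:
  assumes "a \<noteq> 0" "norm a < 1"
  defines "A \<equiv> {w \<in> ball 0 1. norm a \<le> norm w}"
  shows "emeasure (wA \<omega>) (carleson_square a) \<le> ennreal (5 * (1 - norm a)) * emeasure (wA \<omega>) A"
    and "ennreal ((1 - norm a) / (2 * pi)) * emeasure (wA \<omega>) A \<le> 3 * emeasure (wA \<omega>) (carleson_square a)"
proof -
  define G where "G w = emeasure lborel {x \<in> {-1..2}. w * cis (2 * pi * x) \<in> carleson_square a}" for w
  have A: "A \<in> sets (wA \<omega>)"
    by (auto simp: A_def intro!: sets_wAI)
  have "(\<integral>\<^sup>+w. (\<integral>\<^sup>+x. indicator (carleson_square a) (w * cis (2 * pi * x)) * indicator {-1..2} x \<partial>lborel) \<partial>wA \<omega>)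
      = ennreal (2 - (-1)) * (\<integral>\<^sup>+w. indicator (carleson_square a) w \<partial>wA \<omega>)"
    using carleson_square_borel[OF assms(1)] by (intro nn_integral_wA_average) auto
  also have "(\<integral>\<^sup>+w. indicator (carleson_square a) w \<partial>wA \<omega>) = emeasure (wA \<omega>) (carleson_square a)"
    using carleson_square_borel[OF assms(1)]
    by (intro nn_integral_indicator sets_wAI) (auto simp: carleson_square_def)
  also have "(\<integral>\<^sup>+w. (\<integral>\<^sup>+x. indicator (carleson_square a) (w * cis (2 * pi * x)) * indicator {-1..2} x \<partial>lborel) \<partial>wA \<omega>)
      = (\<integral>\<^sup>+w. G w * indicator A w \<partial>wA \<omega>)"
  proof (intro nn_integral_cong)
    fix w assume w: "w \<in> space (wA \<omega>)"
    show "(\<integral>\<^sup>+x. indicator (carleson_square a) (w * cis (2 * pi * x)) * indicator {-1..2} x \<partial>lborel) = G w * indicator A w"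
    proof (cases "w \<in> A")
      case True
      then have "{x \<in> {-1..2}. w * cis (2 * pi * x) \<in> carleson_square a} \<in> sets lborel"
        using assms(1) by (intro cis_average_indicator_carleson_square) (auto simp: A_def)
      then have "G w = (\<integral>\<^sup>+x. indicator {x \<in> {-1..2}. w * cis (2 * pi * x) \<in> carleson_square a} x \<partial>lborel)"
        unfolding G_def by (rule nn_integral_indicator[symmetric])
      then show ?thesis using True
        by (auto intro!: nn_integral_cong split: split_indicator)
    next
      case False
      then have "w * cis (2 * pi * x) \<notin> carleson_square a" for x
        using w by (auto simp: A_def carleson_square_def norm_mult)
      then show ?thesis using False by simp
    qed
  qed
  finally have eq: "(\<integral>\<^sup>+w. G w * indicator A w \<partial>wA \<omega>) = 3 * emeasure (wA \<omega>) (carleson_square a)"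
    by simp
  have G: "ennreal ((1 - norm a) / (2 * pi)) \<le> G w" "G w \<le> ennreal (5 * (1 - norm a))" if "w \<in> A" for w
  proof -
    have "w \<noteq> 0" "norm a \<le> norm w" "norm w < 1"
      using that assms(1) by (auto simp: A_def)
    then show "ennreal ((1 - norm a) / (2 * pi)) \<le> G w" "G w \<le> ennreal (5 * (1 - norm a))"
      using cis_average_indicator_carleson_square[of a w] by (auto simp: G_def)
  qed
  have "ennreal ((1 - norm a) / (2 * pi)) * emeasure (wA \<omega>) A = (\<integral>\<^sup>+w. ennreal ((1 - norm a) / (2 * pi)) * indicator A w \<partial>wA \<omega>)"
    using A by (simp add: nn_integral_cmult_indicator)
  also have "\<dots> \<le> (\<integral>\<^sup>+w. G w * indicator A w \<partial>wA \<omega>)"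
    using G(1) by (intro nn_integral_mono) (auto split: split_indicator)
  finally show "ennreal ((1 - norm a) / (2 * pi)) * emeasure (wA \<omega>) A \<le> 3 * emeasure (wA \<omega>) (carleson_square a)"
    by (simp add: eq)
  have "emeasure (wA \<omega>) (carleson_square a) \<le> 3 * emeasure (wA \<omega>) (carleson_square a)"
    using mult_right_mono[of 1 "3::ennreal"] by simp
  also have "\<dots> = (\<integral>\<^sup>+w. G w * indicator A w \<partial>wA \<omega>)"
    by (simp add: eq)
  also have "\<dots> \<le> (\<integral>\<^sup>+w. ennreal (5 * (1 - norm a)) * indicator A w \<partial>wA \<omega>)"
    using G(2) by (intro nn_integral_mono) (auto split: split_indicator)
  also have "\<dots> = ennreal (5 * (1 - norm a)) * emeasure (wA \<omega>) A"
    using A by (simp add: nn_integral_cmult_indicator)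
  finally show "emeasure (wA \<omega>) (carleson_square a) \<le> ennreal (5 * (1 - norm a)) * emeasure (wA \<omega>) A" .
qed

text \<open>With the next lemma this lets \<omega>(S(a)) be replaced by (1-|a|) times
  \<open>omega_hat\<close> at |a|, the form in which all kernel estimates are made.\<close>

lemma measure_carleson_square_le:
  assumes "a \<noteq> 0" "norm a < 1"
  shows "measure (wA \<omega>) (carleson_square a) \<le> 10 * ((1 - norm a) * omega_hat \<omega> (norm a))"
proof -
  have "emeasure (wA \<omega>) (carleson_square a) \<le> ennreal (5 * (1 - norm a)) * ennreal (2 * omega_hat \<omega> (norm a))"
    using assms emeasure_annulus_le[of "norm a"]
    by (intro order_trans[OF emeasure_carleson_square(1)] mult_left_mono) auto
  also have "\<dots> = ennreal (10 * ((1 - norm a) * omega_hat \<omega> (norm a)))"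
    using assms by (subst ennreal_mult[symmetric]) (auto simp: omega_hat_nonneg algebra_simps)
  finally show ?thesis
    using assms by (subst measure_def) (auto intro!: enn2real_leI mult_nonneg_nonneg omega_hat_nonneg)
qed

lemma measure_carleson_square_ge:
  assumes "1 / 2 \<le> norm a" "norm a < 1"
  shows "(1 - norm a) * omega_hat \<omega> (norm a) \<le> 24 * measure (wA \<omega>) (carleson_square a)"
proof -
  have a0: "a \<noteq> 0" using assms by auto
  have fin: "emeasure (wA \<omega>) (carleson_square a) < \<infinity>"
    using assms a0 emeasure_annulus_le[of "norm a"]
    by (intro order_le_less_trans[OF emeasure_carleson_square(1)])
       (auto simp: ennreal_mult_less_top intro: order_le_less_trans)
  have "emeasure (wA \<omega>) {w \<in> ball 0 1. norm a \<le> norm w \<and> norm w < 1} = emeasure (wA \<omega>) {w \<in> ball 0 1. norm a \<le> norm w}"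
    by (intro arg_cong2[where f=emeasure]) auto
  then have ge: "ennreal (omega_hat \<omega> (norm a)) \<le> emeasure (wA \<omega>) {w \<in> ball 0 1. norm a \<le> norm w}"
    using emeasure_annulus_ge[of "norm a" 1] assms by (simp add: omega_hat_1)
  have "ennreal ((1 - norm a) / (2 * pi) * omega_hat \<omega> (norm a))
      = ennreal ((1 - norm a) / (2 * pi)) * ennreal (omega_hat \<omega> (norm a))"
    using assms by (intro ennreal_mult) (auto simp: omega_hat_nonneg)
  also have "\<dots> \<le> 3 * emeasure (wA \<omega>) (carleson_square a)"
    using assms a0 by (intro order_trans[OF mult_left_mono[OF ge] emeasure_carleson_square(2)]) auto
  also have "\<dots> = ennreal (3 * measure (wA \<omega>) (carleson_square a))"
    using fin by (simp add: emeasure_eq_ennreal_measure ennreal_mult)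
  finally have "(1 - norm a) / (2 * pi) * omega_hat \<omega> (norm a) \<le> 3 * measure (wA \<omega>) (carleson_square a)"
    by (simp add: ennreal_le_iff)
  then have "(1 - norm a) * omega_hat \<omega> (norm a) \<le> (6 * pi) * measure (wA \<omega>) (carleson_square a)"
    by (simp add: field_simps)
  also have "\<dots> \<le> 24 * measure (wA \<omega>) (carleson_square a)"
    using pi_less_4 by (intro mult_right_mono) auto
  finally show ?thesis .
qed

end

section \<open>The Poisson integral on circles\<close>

text \<open>The Poisson kernel of the circle about 0 through w. The radius is read off from w, so
  that one function serves all circles of an annulus at once.\<close>

definition poisson :: "complex \<Rightarrow> complex \<Rightarrow> real" where
  "poisson z w = ((norm w)\<^sup>2 - (norm z)\<^sup>2) / (norm (w - z))\<^sup>2"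

text \<open>Cauchy's formula for h(u) = f(u)(t^2-|z|^2)/(t^2 - cnj z u), which takes the value f(z)
  at z. On the circle |u| = t the denominator equals u cnj(u - z), so Cauchy's kernel turns into the
  Poisson kernel.\<close>

lemma poisson_integral_circle:
  assumes f: "f holomorphic_on ball 0 1" and t: "t < 1" "norm z < t"
  shows "((\<lambda>x. f (t * cis (2 * pi * x)) * of_real (poisson z (t * cis (2 * pi * x)))) has_integral f z) {0..1}"
proof -
  define h where "h u = f u * of_real (t\<^sup>2 - (norm z)\<^sup>2) / (of_real (t\<^sup>2) - cnj z * u)" for u
  have t0: "0 < t" using t norm_ge_zero[of z] by linarith
  have nz: "of_real (t\<^sup>2) - cnj z * u \<noteq> 0" if "norm u \<le> t" for u
  proof
    assume "of_real (t\<^sup>2) - cnj z * u = 0"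
    then have "norm (complex_of_real (t\<^sup>2)) = norm z * norm u"
      by (metis complex_mod_cnj eq_iff_diff_eq_0 norm_mult)
    then have "t\<^sup>2 = norm z * norm u" by (simp add: norm_power)
    also have "\<dots> \<le> norm z * t" using that by (intro mult_left_mono) auto
    also have "\<dots> < t * t" using t t0 by (intro mult_strict_right_mono) auto
    finally show False by (simp add: power2_eq_square)
  qed
  have hol: "h holomorphic_on cball 0 t"
    unfolding h_def using nz t by (intro holomorphic_intros holomorphic_on_subset[OF f]) auto
  have hz: "h z = f z"
  proof -
    have "complex_of_real (t\<^sup>2) - cnj z * z = of_real (t\<^sup>2 - (norm z)\<^sup>2)"
      using complex_norm_square[of z] by (simp add: mult.commute[of "cnj z"])
    moreover have "of_real (t\<^sup>2) - cnj z * z \<noteq> 0" using nz[of z] t by auto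
    ultimately show ?thesis by (simp add: h_def)
  qed
  have "((\<lambda>u. h u / (u - z)) has_contour_integral (2 * of_real pi * \<i> * h z)) (circlepath 0 t)"
    using t by (intro Cauchy_integral_circlepath_simple hol) auto
  then have "((\<lambda>x. h (circlepath 0 t x) / (circlepath 0 t x - z) * vector_derivative (circlepath 0 t) (at x within {0..1}))
      has_integral (2 * of_real pi * \<i> * f z)) {0..1}"
    by (simp add: has_contour_integral_def hz)
  then have "((\<lambda>x. 2 * of_real pi * \<i> * (f (t * cis (2 * pi * x)) * of_real (poisson z (t * cis (2 * pi * x)))))
      has_integral (2 * of_real pi * \<i> * f z)) {0..1}"
  proof (rule has_integral_eq[rotated])
    fix x :: real assume x: "x \<in> {0..1}"
    define u where "u = t * cis (2 * pi * x)"
    have c: "circlepath 0 t x = u"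
      by (simp add: circlepath u_def cis_conv_exp mult_ac)
    have d: "vector_derivative (circlepath 0 t) (at x within {0..1}) = 2 * of_real pi * \<i> * u"
      using x by (subst vector_derivative_circlepath01) (auto simp: u_def cis_conv_exp mult_ac)
    have nu: "norm u = t" using t0 by (simp add: u_def norm_mult)
    have u0: "u \<noteq> 0" using nu t0 by auto
    have e: "of_real (t\<^sup>2) - cnj z * u = u * cnj (u - z)"
      using complex_norm_square[of u] by (simp add: nu algebra_simps)
    have n: "complex_of_real ((norm (u - z))\<^sup>2) = (u - z) * cnj (u - z)"
      by (rule complex_norm_square)
    have alg: "(F * A / (u * c)) / v * (k * u) = k * (F * (A / (v * c)))" for F A c v k :: complex
      using u0 by (simp add: field_simps)
    show "h (circlepath 0 t x) / (circlepath 0 t x - z) * vector_derivative (circlepath 0 t) (at x within {0..1})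
        = 2 * of_real pi * \<i> * (f (t * cis (2 * pi * x)) * of_real (poisson z (t * cis (2 * pi * x))))"
      unfolding c d h_def poisson_def u_def[symmetric] nu of_real_divide n e by (rule alg)
  qed
  note int = this
  have inv: "inverse (2 * of_real pi * \<i>) * (2 * of_real pi * \<i> * y) = y" for y :: complex
    by (simp add: field_simps)
  show ?thesis
    using has_integral_mult_right[OF int, of "inverse (2 * of_real pi * \<i>)"] by (simp only: inv)
qed

lemma continuous_on_poisson_circle:
  assumes "norm z < t"
  shows "continuous_on S (\<lambda>x. poisson z (t * cis (2 * pi * x)))"
proof -
  have "t * cis (2 * pi * x) \<noteq> z" for x
  proof
    assume "t * cis (2 * pi * x) = z"
    then have "norm z = \<bar>t\<bar>" by (auto simp: norm_mult)
    then show False using assms by simp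
  qed
  then show ?thesis
    unfolding poisson_def cis_conv_exp by (intro continuous_intros) auto
qed

lemma poisson_nonneg: "norm z \<le> norm w \<Longrightarrow> 0 \<le> poisson z w"
  by (simp add: poisson_def power_mono)

text \<open>The tangent line inequality is the source of every convexity argument below: integrated
  against a probability density, or summed with weights of total 1, it yields Jensen's
  inequality.\<close>

lemma powr_tangent:
  fixes x y p :: real
  assumes "0 \<le> x" "0 \<le> y" "1 < p"
  shows "y powr p + p * y powr (p - 1) * (x - y) \<le> x powr p"
proof (cases "x = 0 \<or> y = 0")
  case True
  have "y powr (p - 1) * y = y powr p"
    using powr_mult_base[OF assms(2), of "p - 1"] by (simp add: mult.commute)
  then have "y powr p + p * y powr (p - 1) * (0 - y) = (1 - p) * y powr p"
    by (simp add: algebra_simps)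
  also have "\<dots> \<le> 0" using assms by (simp add: mult_nonpos_nonneg)
  finally show ?thesis using True assms by auto
next
  case False
  then have xy: "0 < x" "0 < y" using assms by auto
  have "p * y powr (p - 1) * (x - y) \<le> x powr p - y powr p"
    using xy assms
    by (intro convex_on_imp_above_tangent[where A="{0<..}"] powr_convex)
       (auto intro!: derivative_eq_intros simp: interior_open)
  then show ?thesis by simp
qed

lemma powr_norm_le_poisson_circle:
  assumes f: "f holomorphic_on ball 0 1" and t: "t < 1" "norm z < t" and p: "1 < p"
  shows "norm (f z) powr p \<le> integral {0..1} (\<lambda>x. norm (f (t * cis (2 * pi * x))) powr p * poisson z (t * cis (2 * pi * x)))"
proof -
  define P where "P x = poisson z (t * cis (2 * pi * x))" for x
  define g where "g x = f (t * cis (2 * pi * x))" for x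
  define y where "y = norm (f z)"
  have t0: "0 < t" using t norm_ge_zero[of z] by linarith
  have cP: "continuous_on {0..1} P"
    unfolding P_def by (rule continuous_on_poisson_circle) fact
  have cg: "continuous_on {0..1} g"
    unfolding g_def cis_conv_exp
    using t t0 by (intro continuous_on_compose2[OF holomorphic_on_imp_continuous_on[OF f]] continuous_intros)
      (auto simp: norm_mult)
  have P0: "0 \<le> P x" for x
    using t t0 unfolding P_def by (intro poisson_nonneg) (auto simp: norm_mult)
  have Pc: "((\<lambda>x. complex_of_real (P x)) has_integral 1) {0..1}"
    using poisson_integral_circle[of "\<lambda>_. 1" t z] t by (simp add: P_def)
  then have P1: "(P has_integral 1) {0..1}"
    using has_integral_linear[OF Pc bounded_linear_Re] by (simp add: o_def)
  have i1: "(\<lambda>x. norm (g x) * P x) integrable_on {0..1}"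
    by (intro integrable_continuous_real continuous_intros cP cg)
  have i2: "(\<lambda>x. norm (g x) powr p * P x) integrable_on {0..1}"
    using p by (intro integrable_continuous_real continuous_intros continuous_on_powr' cP cg) auto
  have gi: "((\<lambda>x. g x * of_real (P x)) has_integral f z) {0..1}"
    unfolding g_def P_def by (rule poisson_integral_circle[OF f t])
  have y: "y \<le> integral {0..1} (\<lambda>x. norm (g x) * P x)"
    unfolding y_def integral_unique[OF gi, symmetric]
    using gi i1 P0 by (intro integral_norm_bound_integral) (auto simp: norm_mult)
  \<comment> \<open>The added term is nonnegative by the triangle inequality \<open>y\<close>. Since
    \<open>P\<close> has mass 1, the sum is the integral of the tangent at y, which lies below
    |g|^p.\<close>
  have "y powr p \<le> y powr p + p * y powr (p - 1) * (integral {0..1} (\<lambda>x. norm (g x) * P x) - y)"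
    using y p by (simp add: )
  also have "\<dots> = integral {0..1} (\<lambda>x. (y powr p + p * y powr (p - 1) * (norm (g x) - y)) * P x)"
  proof -
    have "((\<lambda>x. (y powr p - p * y powr (p - 1) * y) * P x + p * y powr (p - 1) * (norm (g x) * P x)) has_integral
        (y powr p - p * y powr (p - 1) * y) * 1 + p * y powr (p - 1) * integral {0..1} (\<lambda>x. norm (g x) * P x)) {0..1}"
      using i1 P1 by (intro has_integral_add has_integral_mult_right) (auto simp: integrable_integral)
    then show ?thesis
      by (intro integral_unique[symmetric]) (simp add: algebra_simps)
  qed
  also have "\<dots> \<le> integral {0..1} (\<lambda>x. norm (g x) powr p * P x)"
    using powr_tangent[of _ y p] p P0
    by (intro integral_le i2 integrable_continuous_real continuous_intros cP cg mult_right_mono)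
       (auto simp: y_def)
  finally show ?thesis by (simp add: y_def g_def P_def)
qed

lemma poisson_rotate:
  "poisson (z * cis (- \<alpha>)) (w * cis (- \<alpha>)) = poisson z w"
  by (simp add: poisson_def norm_mult left_diff_distrib[symmetric])

text \<open>Rotating by Arg w moves the start of the circle from the positive axis to an arbitrary
  point w, as needed when the circles are the rotation orbits of the points of
  \<open>wA \<omega>\<close>.\<close>

lemma powr_norm_le_nn_integral_poisson_circle:
  assumes f: "f holomorphic_on ball 0 1" and w: "norm w < 1" "norm z < norm w" and p: "1 < p"
  shows "ennreal (norm (f z) powr p) \<le>
    (\<integral>\<^sup>+x. ennreal (norm (f (w * cis (2 * pi * x))) powr p * poisson z (w * cis (2 * pi * x))) * indicator {0..1} x \<partial>lborel)"
proof -
  define \<alpha> where "\<alpha> = Arg w"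
  define t where "t = norm w"
  define g where "g u = f (u * cis \<alpha>)" for u
  define z' where "z' = z * cis (- \<alpha>)"
  have t: "t < 1" "norm z' < t" "0 < t"
    using w by (auto simp: t_def z'_def norm_mult intro: order_le_less_trans[OF norm_ge_zero])
  have g: "g holomorphic_on ball 0 1"
  proof -
    have "(\<lambda>u. u * cis \<alpha>) holomorphic_on ball 0 1"
      by (intro holomorphic_intros)
    moreover have "(\<lambda>u. u * cis \<alpha>) ` ball 0 1 \<subseteq> ball 0 1"
      by (auto simp: norm_mult)
    ultimately show ?thesis
      using holomorphic_on_compose_gen[OF _ f] unfolding g_def o_def by blast
  qed
  have w': "w = t * cis \<alpha>"
    using rcis_cmod_Arg[of w] by (simp add: rcis_def t_def \<alpha>_def)
  have gz: "g z' = f z"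
    by (simp add: g_def z'_def mult.assoc cis_mult)
  have wc: "w * cis (2 * pi * x) = t * cis (2 * pi * x) * cis \<alpha>" for x
    by (subst w') (simp add: mult_ac)
  have gx: "g (t * cis (2 * pi * x)) = f (w * cis (2 * pi * x))" for x
    unfolding g_def wc ..
  have Px: "poisson z' (t * cis (2 * pi * x)) = poisson z (w * cis (2 * pi * x))" for x
  proof -
    have "t * cis (2 * pi * x) = w * cis (2 * pi * x) * cis (- \<alpha>)"
      unfolding wc by (simp add: mult.assoc cis_mult)
    then show ?thesis by (metis z'_def poisson_rotate)
  qed
  define F where "F x = norm (g (t * cis (2 * pi * x))) powr p * poisson z' (t * cis (2 * pi * x))" for x
  have "continuous_on {0..1} (\<lambda>x. g (t * cis (2 * pi * x)))"
    unfolding cis_conv_exp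
    using t by (intro continuous_on_compose2[OF holomorphic_on_imp_continuous_on[OF g]] continuous_intros)
      (auto simp: norm_mult)
  then have cF: "continuous_on {0..1} F"
    unfolding F_def using p t
    by (intro continuous_intros continuous_on_powr' continuous_on_poisson_circle) auto
  have F0: "0 \<le> F x" for x
    unfolding F_def using t by (intro mult_nonneg_nonneg poisson_nonneg) (auto simp: norm_mult)
  have "ennreal (norm (f z) powr p) \<le> ennreal (integral {0..1} F)"
    using powr_norm_le_poisson_circle[OF g t(1,2) p] by (intro ennreal_leI) (simp add: gz F_def[abs_def])
  also have "\<dots> = (\<integral>\<^sup>+x. ennreal (F x) * indicator {0..1} x \<partial>lborel)"
    using integrable_continuous_real[OF cF]
    by (intro nn_integral_has_integral_lebesgue'[symmetric] F0) (simp add: integrable_integral)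
  finally show ?thesis by (simp add: F_def gx Px)
qed

lemma nn_integral_poisson_circle:
  assumes w: "norm w < 1" "norm z < norm w"
  shows "(\<integral>\<^sup>+x. ennreal (poisson z (w * cis (2 * pi * x))) * indicator {0..1} x \<partial>lborel) = 1"
proof -
  have t: "norm (z * cis (- Arg w)) < norm w" using w by (simp add: norm_mult)
  have wc: "poisson (z * cis (- Arg w)) (norm w * cis (2 * pi * x)) = poisson z (w * cis (2 * pi * x))" for x
  proof -
    have "w * cis (- Arg w) = norm w * cis (Arg w) * cis (- Arg w)"
      using rcis_cmod_Arg[of w] by (simp add: rcis_def)
    then have "w * cis (- Arg w) = norm w"
      by (simp add: mult.assoc cis_mult)
    then have "norm w * cis (2 * pi * x) = w * cis (2 * pi * x) * cis (- Arg w)"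
      by (simp add: mult_ac)
    then show ?thesis by (metis poisson_rotate)
  qed
  have "((\<lambda>x. complex_of_real (poisson z (w * cis (2 * pi * x)))) has_integral 1) {0..1}"
    using poisson_integral_circle[OF _ w(1) t, of "\<lambda>_. 1"] by (simp add: wc)
  from has_integral_linear[OF this bounded_linear_Re]
  have "((\<lambda>x. poisson z (w * cis (2 * pi * x))) has_integral 1) {0..1}" by (simp add: o_def)
  moreover have "0 \<le> poisson z (w * cis (2 * pi * x))" for x
    using w by (intro poisson_nonneg) (auto simp: norm_mult)
  ultimately show ?thesis
    using nn_integral_has_integral_lebesgue'[of "{0..1}" "\<lambda>x. poisson z (w * cis (2 * pi * x))" 1] by simp
qed

section \<open>Weighted mean value estimates\<close>

lemma borel_measurable_cutoff_disc:
  "f holomorphic_on ball 0 1 \<Longrightarrow> (\<lambda>w. indicator (ball 0 1) w *\<^sub>R (f w::complex)) \<in> borel_measurable borel"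
  by (intro borel_measurable_continuous_on_indicator holomorphic_on_imp_continuous_on) auto

lemma measurable_ident_disc [measurable]: "(\<lambda>x. x) \<in> borel_measurable (restrict_space borel (ball (0::complex) 1))"
  by (simp add: measurable_restrict_space1)

lemma poisson_measurable [measurable]: "poisson z \<in> borel_measurable borel"
  unfolding poisson_def[abs_def] by measurable

lemma (in radial) holomorphic_measurable_wA:
  "f holomorphic_on ball 0 1 \<Longrightarrow> f \<in> borel_measurable (wA \<omega>)"
  by (simp add: measurable_cong_sets[OF sets_wA refl] borel_measurable_continuous_on_restrict holomorphic_on_imp_continuous_on)

context D_weight
begin

text \<open>The inner edge keeps w at distance at least (1-|z|)/2 from z, so the Poisson kernel is
  harmless. The outer edge is the point that reverse doubling assigns to the inner one, so the
  annulus carries a fixed share of the mass.\<close>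

definition ring :: "complex \<Rightarrow> complex set" where
  "ring z = {w. (1 + norm z) / 2 \<le> norm w \<and> norm w < 1 - (1 - norm z) / (2 * K)}"

lemma ring_borel [measurable]: "ring z \<in> sets borel"
  unfolding ring_def by measurable

lemma ring_disc: "norm z < 1 \<Longrightarrow> w \<in> ring z \<Longrightarrow> norm w < 1"
  using K by (auto simp: ring_def intro: less_trans)

lemma ring_rotate: "w * cis t \<in> ring z \<longleftrightarrow> w \<in> ring z"
  by (simp add: ring_def norm_mult)

definition ring_const :: real where "ring_const = B / (1 - 1 / R)"

lemma ring_const_pos: "0 < ring_const"
  using B R by (simp add: ring_const_def)

text \<open>Doubling passes from |z| to the inner edge \<rho> at the cost of a factor B; by reverse
  doubling the share 1 - 1/R of the mass beyond \<rho> lies before the outer edge.\<close>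

lemma omega_hat_le_ring:
  assumes "norm z < 1"
  shows "ennreal (omega_hat \<omega> (norm z)) \<le> ennreal ring_const * emeasure (wA \<omega>) (ring z)"
proof -
  define \<rho> where "\<rho> = (1 + norm z) / 2"
  have \<rho>: "1/2 \<le> \<rho>" "\<rho> < 1" "1 - (1 - norm z) / (2 * K) = 1 - (1 - \<rho>) / K"
    using assms K by (auto simp: \<rho>_def field_simps)
  have \<rho>K: "\<rho> \<le> 1 - (1 - \<rho>) / K" "1 - (1 - \<rho>) / K \<le> 1"
    using \<rho> K mult_right_mono[of 1 K "1 - \<rho>"] by (auto simp: field_simps)
  have "omega_hat \<omega> (norm z) \<le> B * omega_hat \<omega> \<rho>"
    unfolding \<rho>_def using doubling[of "norm z"] assms by simp
  also have "\<dots> = ring_const * ((1 - 1 / R) * omega_hat \<omega> \<rho>)"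
    using R by (simp add: ring_const_def)
  also have "\<dots> \<le> ring_const * (omega_hat \<omega> \<rho> - omega_hat \<omega> (1 - (1 - \<rho>) / K))"
    using omega_hat_reverse[of \<rho>] \<rho> ring_const_pos by (intro mult_left_mono) auto
  finally have "ennreal (omega_hat \<omega> (norm z)) \<le> ennreal ring_const * ennreal (omega_hat \<omega> \<rho> - omega_hat \<omega> (1 - (1 - \<rho>) / K))"
    using ring_const_pos \<rho> \<rho>K by (subst ennreal_mult[symmetric]) (auto intro!: ennreal_leI omega_hat_antimono)
  also have "\<dots> \<le> ennreal ring_const * emeasure (wA \<omega>) {w \<in> ball 0 1. \<rho> \<le> norm w \<and> norm w < 1 - (1 - \<rho>) / K}"
    using \<rho> \<rho>K by (intro mult_left_mono emeasure_annulus_ge) auto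
  also have "{w \<in> ball 0 1. \<rho> \<le> norm w \<and> norm w < 1 - (1 - \<rho>) / K} = ring z"
    using \<rho> \<rho>K by (auto simp: ring_def \<rho>_def)
  finally show ?thesis .
qed

text \<open>The Poisson inequality holds on each circle of the annulus and is integrated over the
  orbits. The point z' differs from the centre z because Cauchy's estimate later needs the bound on
  a disc around z, with one and the same annulus.\<close>

lemma powr_norm_le_ring:
  assumes f: "f holomorphic_on ball 0 1" and z: "norm z < 1" "norm z' < (1 + norm z) / 2" and p: "1 < p"
  shows "ennreal (norm (f z') powr p) * emeasure (wA \<omega>) (ring z)
     \<le> (\<integral>\<^sup>+w. ennreal (norm (f w) powr p * poisson z' w) * indicator (ring z) w \<partial>wA \<omega>)"
proof -
  \<comment> \<open>f is arbitrary outside the disc; cutting it off there yields a Borel function on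
    the plane, which the averaging lemma asks for.\<close>
  define g where "g w = indicator (ball 0 1) w *\<^sub>R f w" for w
  have [measurable]: "g \<in> borel_measurable borel"
    unfolding g_def[abs_def] using f by (rule borel_measurable_cutoff_disc)
  define F where "F w = ennreal (norm (g w) powr p * poisson z' w) * indicator (ring z) w" for w
  have [measurable]: "F \<in> borel_measurable borel"
    unfolding F_def[abs_def] by measurable
  have Feq: "F w = ennreal (norm (f w) powr p * poisson z' w) * indicator (ring z) w" for w
    using ring_disc[OF z(1), of w] by (auto simp: F_def g_def split: split_indicator)
  have sets: "ring z \<in> sets (wA \<omega>)"
    using ring_disc[OF z(1)] by (intro sets_wAI) auto
  have "ennreal (norm (f z') powr p) * emeasure (wA \<omega>) (ring z)
      = (\<integral>\<^sup>+w. ennreal (norm (f z') powr p) * indicator (ring z) w \<partial>wA \<omega>)"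
    using sets by (simp add: nn_integral_cmult_indicator)
  also have "\<dots> \<le> (\<integral>\<^sup>+w. (\<integral>\<^sup>+x. F (w * cis (2 * pi * x)) * indicator {0..1} x \<partial>lborel) \<partial>wA \<omega>)"
  proof (intro nn_integral_mono)
    fix w assume "w \<in> space (wA \<omega>)"
    show "ennreal (norm (f z') powr p) * indicator (ring z) w \<le> (\<integral>\<^sup>+x. F (w * cis (2 * pi * x)) * indicator {0..1} x \<partial>lborel)"
    proof (cases "w \<in> ring z")
      case True
      then have "norm w < 1" "norm z' < norm w"
        using ring_disc[OF z(1)] z by (auto simp: ring_def)
      from powr_norm_le_nn_integral_poisson_circle[OF f this p] show ?thesis
        using True by (simp add: Feq ring_rotate)
    qed simp
  qed
  also have "\<dots> = (\<integral>\<^sup>+w. F w \<partial>wA \<omega>)"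
    by (subst nn_integral_wA_average) auto
  finally show ?thesis by (simp add: Feq)
qed

text \<open>Up to constants the kernel is 1-|z| times the Poisson kernel of any point z' near z.
  Centring it at z makes the same mean serve for all these z'.\<close>

definition ring_mean :: "real \<Rightarrow> (complex \<Rightarrow> complex) \<Rightarrow> complex \<Rightarrow> ennreal" where
  "ring_mean p f z = (\<integral>\<^sup>+w. ennreal (norm (f w) powr p * ((1 - norm z)\<^sup>2 / (norm (w - z))\<^sup>2)) * indicator (ring z) w \<partial>wA \<omega>)"

lemma powr_norm_le_ring_mean:
  assumes f: "f holomorphic_on ball 0 1" and z: "norm z < 1" "norm (z' - z) \<le> (1 - norm z) / 4" and p: "1 < p"
  shows "ennreal (norm (f z') powr p * ((1 - norm z) * omega_hat \<omega> (norm z))) \<le> ennreal (10 * ring_const) * ring_mean p f z"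
proof -
  define h where "h = 1 - norm z"
  have h: "0 < h" and nz: "norm z = 1 - h" and zd: "norm (z' - z) \<le> h / 4"
    using z by (simp_all add: h_def)
  have z': "norm z' \<le> norm z + h / 4" "norm z \<le> norm z' + h / 4"
    using z(2) norm_triangle_ineq[of "z' - z" z] norm_triangle_ineq[of "z - z'" z']
    unfolding h_def[symmetric] norm_minus_commute[of z z'] by simp_all
  have [measurable]: "f \<in> borel_measurable (wA \<omega>)" "poisson z' \<in> borel_measurable (wA \<omega>)" "ring z \<in> sets (wA \<omega>)"
    using holomorphic_measurable_wA[OF f] borel_measurable_wA[of "poisson z'"] ring_disc[OF z(1)]
    by (auto intro!: sets_wAI)
  have zz: "norm z' < (1 + norm z) / 2"
    using z'(1) h nz by (simp add: field_simps)
  \<comment> \<open>10 = 4 times 5/2: the numerator of the Poisson kernel is at most 5h/2, and |w-z|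
    \<le> 2|w-z'|.\<close>
  have P: "h * poisson z' w \<le> 10 * (h\<^sup>2 / (norm (w - z))\<^sup>2)" if w: "w \<in> ring z" for w
  proof -
    have w1: "norm w < 1" "1 - h / 2 \<le> norm w"
      using ring_disc[OF z(1) w] w by (auto simp: ring_def h_def field_simps)
    have d: "h / 4 \<le> norm (w - z')"
      using norm_triangle_ineq2[of w z'] w1 z' nz by linarith
    have "norm (w - z) \<le> norm (w - z') + norm (z' - z)"
      by (metis diff_add_cancel add_diff_eq norm_triangle_ineq)
    then have d2: "norm (w - z) \<le> 2 * norm (w - z')" using d zd by linarith
    have pos: "norm (w - z) > 0"
      using norm_triangle_ineq2[of w z] w1 h nz by linarith
    have pos': "norm (w - z') > 0" using d h by linarith
    have "(norm w)\<^sup>2 - (norm z')\<^sup>2 = (norm w - norm z') * (norm w + norm z')"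
      by (simp add: power2_eq_square algebra_simps)
    also have "\<dots> \<le> (5 / 4 * h) * 2"
      using w1 z' h nz by (intro mult_mono) auto
    finally have n: "(norm w)\<^sup>2 - (norm z')\<^sup>2 \<le> 5 / 2 * h" by simp
    have "poisson z' w \<le> (5 / 2 * h) / (norm (w - z'))\<^sup>2"
      unfolding poisson_def using n by (rule divide_right_mono) simp
    also have "\<dots> \<le> (5 / 2 * h) / ((norm (w - z))\<^sup>2 / 4)"
    proof (rule divide_left_mono)
      have "(norm (w - z))\<^sup>2 \<le> (2 * norm (w - z'))\<^sup>2" using d2 by (rule power_mono) simp
      then show "(norm (w - z))\<^sup>2 / 4 \<le> (norm (w - z'))\<^sup>2" by (simp add: power_mult_distrib)
    qed (use h pos pos' in \<open>simp_all add: zero_less_mult_iff\<close>)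
    finally have "h * poisson z' w \<le> h * ((5 / 2 * h) / ((norm (w - z))\<^sup>2 / 4))"
      using h by (intro mult_left_mono) auto
    then show ?thesis by (simp add: power2_eq_square mult.left_commute)
  qed
  have "ennreal h * (\<integral>\<^sup>+w. ennreal (norm (f w) powr p * poisson z' w) * indicator (ring z) w \<partial>wA \<omega>)
     = (\<integral>\<^sup>+w. ennreal h * (ennreal (norm (f w) powr p * poisson z' w) * indicator (ring z) w) \<partial>wA \<omega>)"
    by (rule nn_integral_cmult[symmetric]) measurable
  also have "\<dots> \<le> (\<integral>\<^sup>+w. ennreal 10 * (ennreal (norm (f w) powr p * (h\<^sup>2 / (norm (w - z))\<^sup>2)) * indicator (ring z) w) \<partial>wA \<omega>)"
  proof (intro nn_integral_mono)
    fix w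
    show "ennreal h * (ennreal (norm (f w) powr p * poisson z' w) * indicator (ring z) w)
      \<le> ennreal 10 * (ennreal (norm (f w) powr p * (h\<^sup>2 / (norm (w - z))\<^sup>2)) * indicator (ring z) w)"
    proof (cases "w \<in> ring z")
      case True
      have "norm (f w) powr p * (h * poisson z' w) \<le> norm (f w) powr p * (10 * (h\<^sup>2 / (norm (w - z))\<^sup>2))"
        using P[OF True] by (rule mult_left_mono) simp
      then have "ennreal (h * (norm (f w) powr p * poisson z' w)) \<le> ennreal (10 * (norm (f w) powr p * (h\<^sup>2 / (norm (w - z))\<^sup>2)))"
        by (intro ennreal_leI) (simp add: mult_ac)
      then show ?thesis
        using True h by (simp only: ennreal_mult' ennreal_mult'' indicator_simps mult_1_right)
    qed simp
  qed
  also have "\<dots> = ennreal 10 * ring_mean p f z"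
    unfolding ring_mean_def h_def by (rule nn_integral_cmult) measurable
  finally have J: "ennreal h * (\<integral>\<^sup>+w. ennreal (norm (f w) powr p * poisson z' w) * indicator (ring z) w \<partial>wA \<omega>)
      \<le> ennreal 10 * ring_mean p f z" .
  have "ennreal (norm (f z') powr p * (h * omega_hat \<omega> (norm z)))
      = ennreal h * (ennreal (norm (f z') powr p) * ennreal (omega_hat \<omega> (norm z)))"
    using h by (simp add: ennreal_mult[symmetric] omega_hat_nonneg mult_ac)
  also have "\<dots> \<le> ennreal h * (ennreal (norm (f z') powr p) * (ennreal ring_const * emeasure (wA \<omega>) (ring z)))"
    using omega_hat_le_ring[OF z(1)] by (intro mult_left_mono) auto
  also have "\<dots> = ennreal ring_const * (ennreal h * (ennreal (norm (f z') powr p) * emeasure (wA \<omega>) (ring z)))"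
    by (simp add: mult_ac)
  also have "\<dots> \<le> ennreal ring_const * (ennreal h * (\<integral>\<^sup>+w. ennreal (norm (f w) powr p * poisson z' w) * indicator (ring z) w \<partial>wA \<omega>))"
    using zz by (intro mult_left_mono powr_norm_le_ring f z p) auto
  also have "\<dots> \<le> ennreal ring_const * (ennreal 10 * ring_mean p f z)"
    using J by (rule mult_left_mono) simp
  also have "\<dots> = ennreal (10 * ring_const) * ring_mean p f z"
    using ring_const_pos by (simp add: ennreal_mult mult_ac)
  finally show ?thesis by (simp add: h_def)
qed

lemma ring_mean_le:
  assumes f: "f holomorphic_on ball 0 1" and z: "norm z < 1"
  shows "ring_mean p f z \<le> 4 * (\<integral>\<^sup>+w. ennreal (norm (f w) powr p) \<partial>wA \<omega>)"
proof -
  have [measurable]: "f \<in> borel_measurable (wA \<omega>)"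
    using f by (rule holomorphic_measurable_wA)
  have "ring_mean p f z \<le> (\<integral>\<^sup>+w. ennreal 4 * ennreal (norm (f w) powr p) \<partial>wA \<omega>)"
    unfolding ring_mean_def
  proof (intro nn_integral_mono)
    fix w
    show "ennreal (norm (f w) powr p * ((1 - norm z)\<^sup>2 / (norm (w - z))\<^sup>2)) * indicator (ring z) w \<le> ennreal 4 * ennreal (norm (f w) powr p)"
    proof (cases "w \<in> ring z")
      case True
      then have "(1 - norm z) \<le> 2 * norm (w - z)"
        using norm_triangle_ineq2[of w z] by (auto simp: ring_def field_simps)
      then have "(1 - norm z)\<^sup>2 \<le> (2 * norm (w - z))\<^sup>2"
        using z by (intro power_mono) auto
      then have "(1 - norm z)\<^sup>2 / (norm (w - z))\<^sup>2 \<le> 4"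
        by (simp add: power_mult_distrib divide_le_eq)
      then have "norm (f w) powr p * ((1 - norm z)\<^sup>2 / (norm (w - z))\<^sup>2) \<le> norm (f w) powr p * 4"
        by (rule mult_left_mono) simp
      then show ?thesis
        using True by (simp add: ennreal_mult'[symmetric] ennreal_leI mult.commute del: ennreal_numeral)
    qed simp
  qed
  also have "\<dots> = ennreal 4 * (\<integral>\<^sup>+w. ennreal (norm (f w) powr p) \<partial>wA \<omega>)"
    by (rule nn_integral_cmult) measurable
  finally show ?thesis by simp
qed

definition deriv_const :: "real \<Rightarrow> nat \<Rightarrow> real" where
  "deriv_const p n = (fact n * 4 ^ n) powr p * (10 * ring_const)"

lemma deriv_const_pos: "0 < deriv_const p n"
  using ring_const_pos by (simp add: deriv_const_def)

text \<open>The previous bound, the same for all z' with |z'-z| \<le> (1-|z|)/4, becomes a sup bound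
  \<open>M\<close> on that disc after taking p-th roots. Cauchy's inequality on the disc then
  produces the factor n! 4^n.\<close>

lemma powr_norm_deriv_le_ring_mean:
  assumes f: "f holomorphic_on ball 0 1" and z: "norm z < 1" and p: "1 < p"
  shows "ennreal (((1 - norm z) ^ n * norm ((deriv ^^ n) f z)) powr p * ((1 - norm z) * omega_hat \<omega> (norm z)))
     \<le> ennreal (deriv_const p n) * ring_mean p f z"
proof (cases "ring_mean p f z = \<infinity>")
  case True
  then show ?thesis using deriv_const_pos[of p n] by (simp add: ennreal_mult_top)
next
  case False
  then obtain g where g: "0 \<le> g" "ring_mean p f z = ennreal g"
    by (cases "ring_mean p f z") auto
  define h where "h = 1 - norm z"
  define W where "W = h * omega_hat \<omega> (norm z)"
  have h: "0 < h" using z by (simp add: h_def)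
  have W: "0 < W" using h omega_hat_pos[of "norm z"] z by (simp add: W_def)
  define M where "M = (10 * ring_const * g / W) powr (1 / p)"
  have M0: "0 \<le> 10 * ring_const * g / W" using g ring_const_pos W by simp
  have "norm (f z') \<le> M" if "norm (z' - z) \<le> h / 4" for z'
  proof -
    have "ennreal (norm (f z') powr p * W) \<le> ennreal (10 * ring_const * g)"
      using powr_norm_le_ring_mean[OF f z _ p, of z'] that g ring_const_pos
      by (simp add: h_def W_def ennreal_mult)
    then have "norm (f z') powr p * W \<le> 10 * ring_const * g"
      using g ring_const_pos by (simp add: ennreal_le_iff)
    then have "norm (f z') powr p \<le> 10 * ring_const * g / W"
      using W by (simp add: field_simps)
    then have "(norm (f z') powr p) powr (1 / p) \<le> M"
      unfolding M_def using p by (intro powr_mono2) auto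
    then show ?thesis using p by (simp add: powr_powr)
  qed
  moreover have "cball z (h / 4) \<subseteq> ball 0 1"
  proof
    fix x assume "x \<in> cball z (h / 4)"
    then have "norm (x - z) \<le> h / 4" by (simp add: dist_norm norm_minus_commute)
    then show "x \<in> ball 0 1"
      using norm_triangle_ineq[of "x - z" z] h by (simp add: h_def)
  qed
  ultimately have "norm ((deriv ^^ n) f z) \<le> fact n * M / (h / 4) ^ n"
    using h f
    by (intro Cauchy_inequality)
       (auto intro: holomorphic_on_subset holomorphic_on_imp_continuous_on continuous_on_subset simp: norm_minus_commute subset_iff)
  then have "h ^ n * norm ((deriv ^^ n) f z) \<le> h ^ n * (fact n * M / (h / 4) ^ n)"
    using h by (intro mult_left_mono) auto
  also have "\<dots> = fact n * 4 ^ n * M"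
    using h by (simp add: power_divide)
  finally have "(h ^ n * norm ((deriv ^^ n) f z)) powr p \<le> (fact n * 4 ^ n * M) powr p"
    using h p by (intro powr_mono2) auto
  also have "\<dots> = (fact n * 4 ^ n) powr p * (10 * ring_const * g / W)"
    using g W ring_const_pos p by (simp add: powr_mult M_def powr_powr)
  finally have "(h ^ n * norm ((deriv ^^ n) f z)) powr p * W \<le> deriv_const p n * g"
    using W by (simp add: deriv_const_def field_simps)
  then show ?thesis
    unfolding g using deriv_const_pos[of p n] g
    by (simp add: h_def W_def ennreal_mult[symmetric] ennreal_leI)
qed

end

text \<open>Both \<mu> and \<open>wA \<omega>\<close> live on the trace sigma-algebra of the disc;
  joint measurability of the kernels is checked once on the full planes and pulled back along the
  identity maps.\<close>

lemma measurable_pair_borelI: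
  assumes "(\<lambda>x. x) \<in> measurable M borel" "(\<lambda>x. x) \<in> measurable N borel"
    and F: "F \<in> borel_measurable (borel \<Otimes>\<^sub>M borel)"
  shows "F \<in> borel_measurable (M \<Otimes>\<^sub>M N)"
proof -
  have "(\<lambda>p. (fst p, snd p)) \<in> measurable (M \<Otimes>\<^sub>M N) (borel \<Otimes>\<^sub>M borel)"
    by (intro measurable_Pair measurable_compose[OF measurable_fst assms(1)] measurable_compose[OF measurable_snd assms(2)])
  from measurable_compose[OF this F] show ?thesis by simp
qed

section \<open>Area integrals of the inverse square kernel\<close>

lemma omega_hat_const: "r \<le> 1 \<Longrightarrow> omega_hat (\<lambda>_. 1) r = 1 - r"
  by (simp add: omega_hat_def set_lebesgue_integral_def)

text \<open>Lebesgue measure on the disc is pi times \<open>wA\<close> of the constant weight, so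
  the averaging lemma for radial weights also applies to area integrals.\<close>

interpretation area: radial "\<lambda>_. 1"
  by standard (auto simp: radial_weight_def omega_hat_const set_integrable_def)

lemma nn_integral_lborel_disc:
  assumes [measurable]: "F \<in> borel_measurable borel" and F: "\<And>z. 1 \<le> norm z \<Longrightarrow> F z = 0"
  shows "(\<integral>\<^sup>+z. F z \<partial>lborel) = ennreal pi * (\<integral>\<^sup>+z. F z \<partial>wA (\<lambda>_. 1))"
proof -
  have "ennreal pi * (\<integral>\<^sup>+z. F z \<partial>wA (\<lambda>_. 1)) = (\<integral>\<^sup>+z. ennreal pi * (area.disc_density z * F z) \<partial>lborel)"
    by (simp add: area.nn_integral_wA nn_integral_cmult)
  also have "\<dots> = (\<integral>\<^sup>+z. F z \<partial>lborel)"
    using F by (intro nn_integral_cong)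
      (auto simp: area.disc_density_def area.weight01_def mult.assoc[symmetric] ennreal_mult[symmetric] split: split_indicator)
  finally show ?thesis ..
qed

text \<open>Conjugation moves the rotation from \<zeta> to w. The integrand is then a Poisson kernel
  divided by |w|^2-|\<zeta>|^2, and Poisson kernels have mean 1.\<close>

lemma nn_integral_inverse_square_rotate:
  assumes "norm \<zeta> < norm w" "norm w < 1"
  shows "(\<integral>\<^sup>+x. ennreal (1 / (norm (w - \<zeta> * cis (2 * pi * x)))\<^sup>2) * indicator {0..1} x \<partial>lborel)
    = ennreal (1 / ((norm w)\<^sup>2 - (norm \<zeta>)\<^sup>2))"
proof -
  define d where "d = (norm w)\<^sup>2 - (norm \<zeta>)\<^sup>2"
  have d: "0 < d" using assms by (simp add: d_def power_strict_mono)
  have e: "norm (w - \<zeta> * cis t) = norm (cnj w * cis t - cnj \<zeta>)" for t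
  proof -
    have "norm (w - \<zeta> * cis t) = norm (cnj (w - \<zeta> * cis t)) * norm (cis t)"
      by (simp only: complex_mod_cnj norm_cis mult_1_right)
    also have "\<dots> = norm (cnj w * cis t - cnj \<zeta> * (cis (- t) * cis t))"
      by (subst norm_mult[symmetric]) (simp add: algebra_simps cis_cnj)
    finally show ?thesis by (simp add: cis_mult)
  qed
  have p: "ennreal (1 / (norm (w - \<zeta> * cis t))\<^sup>2) = ennreal (1 / d) * ennreal (poisson (cnj \<zeta>) (cnj w * cis t))" for t
    using d assms by (subst ennreal_mult[symmetric]) (auto simp: e poisson_def norm_mult d_def)
  have "(\<integral>\<^sup>+x. ennreal (1 / (norm (w - \<zeta> * cis (2 * pi * x)))\<^sup>2) * indicator {0..1} x \<partial>lborel)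
     = (\<integral>\<^sup>+x. ennreal (1 / d) * (ennreal (poisson (cnj \<zeta>) (cnj w * cis (2 * pi * x))) * indicator {0..1} x) \<partial>lborel)"
    by (simp add: p mult.assoc)
  also have "\<dots> = ennreal (1 / d) * (\<integral>\<^sup>+x. ennreal (poisson (cnj \<zeta>) (cnj w * cis (2 * pi * x))) * indicator {0..1} x \<partial>lborel)"
  proof (rule nn_integral_cmult)
    have "(\<lambda>x. cnj w * cis (2 * pi * x)) \<in> borel_measurable borel"
      unfolding cis_conv_exp by (intro borel_measurable_continuous_onI continuous_intros)
    from measurable_compose[OF this poisson_measurable]
    show "(\<lambda>x. ennreal (poisson (cnj \<zeta>) (cnj w * cis (2 * pi * x))) * indicator {0..1} x) \<in> borel_measurable lborel"
      by (intro borel_measurable_times_ennreal measurable_compose[OF _ measurable_ennreal]) auto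
  qed
  also have "\<dots> = ennreal (1 / d)"
    using assms by (subst nn_integral_poisson_circle) auto
  finally show ?thesis by (simp add: d_def)
qed

text \<open>With h = 1-|w|, circles at distance at least 3h/4 from |w| contribute a mean of order
  1/h, and the annulus has area of order Ah. The powers of h cancel, which makes the bound uniform
  in w.\<close>

lemma nn_integral_inverse_square_annulus:
  fixes w :: complex
  assumes w: "1 / 2 \<le> norm w" "norm w < 1" and A: "1 \<le> A"
  shows "(\<integral>\<^sup>+\<zeta>. ennreal (1 / (norm (w - \<zeta>))\<^sup>2) * indicator {\<zeta>. norm \<zeta> \<le> norm w - 3/4 * (1 - norm w) \<and> 1 - norm \<zeta> \<le> A * (1 - norm w)} \<zeta> \<partial>lborel)
    \<le> ennreal (6 * pi * A)"
proof -
  define h where "h = 1 - norm w"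
  have h: "0 < h" using w by (simp add: h_def)
  define S where "S = {\<zeta>::complex. norm \<zeta> \<le> norm w - 3/4 * (1 - norm w) \<and> 1 - norm \<zeta> \<le> A * (1 - norm w)}"
  have S [measurable]: "S \<in> sets borel" unfolding S_def by measurable
  have Sd: "norm \<zeta> < norm w" if "\<zeta> \<in> S" for \<zeta> using that h unfolding S_def h_def[symmetric] by auto
  define F where "F \<zeta> = ennreal (1 / (norm (w - \<zeta>))\<^sup>2) * indicator S \<zeta>" for \<zeta>
  have F [measurable]: "F \<in> borel_measurable borel" unfolding F_def by measurable
  \<comment> \<open>The inner radius of the annulus, truncated at 0 when Ah exceeds 1; in both cases
    \<open>1 - a \<le> A * h\<close>.\<close>
  define a where "a = max 0 (1 - A * h)"
  have a: "0 \<le> a" "a < 1" "1 - a \<le> A * h" using h A by (auto simp: a_def)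
  have eq: "(\<integral>\<^sup>+\<zeta>. F \<zeta> \<partial>lborel) = ennreal pi * (\<integral>\<^sup>+\<zeta>. F \<zeta> \<partial>wA (\<lambda>_. 1))"
    using Sd w by (intro nn_integral_lborel_disc) (force simp: F_def split: split_indicator)+
  have "(\<integral>\<^sup>+\<zeta>. F \<zeta> \<partial>wA (\<lambda>_. 1)) = (\<integral>\<^sup>+\<zeta>. (\<integral>\<^sup>+x. F (\<zeta> * cis (2 * pi * x)) * indicator {0..1} x \<partial>lborel) \<partial>wA (\<lambda>_. 1))"
    by (subst area.nn_integral_wA_average) auto
  also have "\<dots> \<le> (\<integral>\<^sup>+\<zeta>. ennreal (8 / (3 * h)) * indicator {\<zeta> \<in> ball 0 1. a \<le> norm \<zeta>} \<zeta> \<partial>wA (\<lambda>_. 1))"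
  proof (intro nn_integral_mono)
    fix \<zeta> assume \<zeta>: "\<zeta> \<in> space (wA (\<lambda>_. 1))"
    show "(\<integral>\<^sup>+x. F (\<zeta> * cis (2 * pi * x)) * indicator {0..1} x \<partial>lborel) \<le> ennreal (8 / (3 * h)) * indicator {\<zeta> \<in> ball 0 1. a \<le> norm \<zeta>} \<zeta>"
    proof (cases "\<zeta> \<in> S")
      case True
      have rot: "\<zeta> * cis t \<in> S" for t using True by (simp add: S_def norm_mult)
      have "(\<integral>\<^sup>+x. F (\<zeta> * cis (2 * pi * x)) * indicator {0..1} x \<partial>lborel) = ennreal (1 / ((norm w)\<^sup>2 - (norm \<zeta>)\<^sup>2))"
        using nn_integral_inverse_square_rotate[OF Sd[OF True] w(2)] by (simp add: F_def rot)
      also have "\<dots> \<le> ennreal (8 / (3 * h))"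
      proof (intro ennreal_leI)
        have "3 / 8 * h = (3 / 4 * h) * (1 / 2)" by simp
        also have "\<dots> \<le> (norm w - norm \<zeta>) * (norm w + norm \<zeta>)"
        proof (rule mult_mono)
          show "3 / 4 * h \<le> norm w - norm \<zeta>" "0 \<le> norm w - norm \<zeta>"
            using True h unfolding S_def h_def[symmetric] by auto
        qed (use w in \<open>auto intro: order_trans\<close>)
        finally have "3 / 8 * h \<le> (norm w)\<^sup>2 - (norm \<zeta>)\<^sup>2" by (simp add: power2_eq_square algebra_simps)
        then have "1 / ((norm w)\<^sup>2 - (norm \<zeta>)\<^sup>2) \<le> 1 / (3 / 8 * h)"
          using h by (intro divide_left_mono) auto
        then show "1 / ((norm w)\<^sup>2 - (norm \<zeta>)\<^sup>2) \<le> 8 / (3 * h)" by simp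
      qed
      finally show ?thesis using True \<zeta> by (auto simp: S_def h_def a_def split: split_indicator)
    next
      case False
      then have rot: "\<zeta> * cis t \<notin> S" for t by (simp add: S_def norm_mult)
      then show ?thesis by (simp add: F_def)
    qed
  qed
  also have "\<dots> = ennreal (8 / (3 * h)) * emeasure (wA (\<lambda>_. 1)) {\<zeta> \<in> ball 0 1. a \<le> norm \<zeta>}"
    by (intro nn_integral_cmult_indicator area.sets_wAI) auto
  also have "\<dots> \<le> ennreal (8 / (3 * h)) * ennreal (2 * (A * h))"
    using a area.emeasure_annulus_le[of a]
    by (intro mult_left_mono order_trans[OF area.emeasure_annulus_le[of a]] ennreal_leI) (auto simp: omega_hat_const)
  also have "\<dots> = ennreal (16 / 3 * A)"
    using h A by (subst ennreal_mult[symmetric]) auto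
  finally have "(\<integral>\<^sup>+\<zeta>. F \<zeta> \<partial>lborel) \<le> ennreal pi * ennreal (16 / 3 * A)"
    by (simp add: eq mult_left_mono)
  also have "\<dots> \<le> ennreal (6 * pi * A)"
    using A by (subst ennreal_mult[symmetric]) (auto intro!: ennreal_leI)
  finally show ?thesis by (simp add: F_def S_def)
qed


section \<open>The gauge of the Carleson condition and the pointwise bound for derivatives\<close>

context D_weight
begin

text \<open>The truncation matters: the weight is unconstrained on negative reals, so only this version is monotone.\<close>

definition omega_hat0 :: "real \<Rightarrow> real" where
  "omega_hat0 r = omega_hat \<omega> (max 0 r)"

lemma omega_hat0_measurable [measurable]: "omega_hat0 \<in> borel_measurable borel"
proof -
  have "mono (\<lambda>r. - omega_hat0 r)"
    by (auto simp: mono_def omega_hat0_def intro!: omega_hat_antimono)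
  then have "(\<lambda>r. - omega_hat0 r) \<in> borel_measurable borel"
    by (rule borel_measurable_mono)
  then have "(\<lambda>r. - (- omega_hat0 r)) \<in> borel_measurable borel"
    by (rule borel_measurable_uminus)
  then show ?thesis by simp
qed

text \<open>The denominator in the theorem with \<omega>(S(z)) replaced by (1-|z|) times
  \<open>omega_hat\<close> at |z|, a quantity that is monotone in |z| and easy to compare between
  neighbouring points.\<close>

definition size_gauge :: "nat \<Rightarrow> real \<Rightarrow> real \<Rightarrow> complex \<Rightarrow> real" where
  "size_gauge n p q z = (1 - norm z) powr (real n * q) * ((1 - norm z) * omega_hat0 (norm z)) powr (q / p)"

lemma size_gauge_measurable [measurable]: "size_gauge n p q \<in> borel_measurable borel"
  unfolding size_gauge_def[abs_def] by measurable

lemma size_gauge_pos: "norm z < 1 \<Longrightarrow> 0 < size_gauge n p q z"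
  using omega_hat_pos[of "norm z"] by (auto simp: size_gauge_def omega_hat0_def max_def)

lemma size_gauge_comparable:
  assumes "norm z < 1" "norm \<zeta> < 1" "1 - norm \<zeta> \<le> 2 * (1 - norm z)" "1 < p" "p \<le> q"
  shows "size_gauge n p q \<zeta> \<le> 2 powr (real n * q) * (2 * B) powr (q / p) * size_gauge n p q z"
proof -
  have "omega_hat \<omega> (norm \<zeta>) \<le> B * omega_hat \<omega> (norm z)"
    using omega_hat_doubling_power[of "norm \<zeta>" "norm z" 1] assms by simp
  then have "(1 - norm \<zeta>) * omega_hat \<omega> (norm \<zeta>) \<le> (2 * (1 - norm z)) * (B * omega_hat \<omega> (norm z))"
    using assms by (intro mult_mono) (auto simp: omega_hat_nonneg)
  then have "((1 - norm \<zeta>) * omega_hat \<omega> (norm \<zeta>)) powr (q / p) \<le> ((2 * (1 - norm z)) * (B * omega_hat \<omega> (norm z))) powr (q / p)"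
    using assms by (intro powr_mono2) (auto simp: omega_hat_nonneg)
  moreover have "(1 - norm \<zeta>) powr (real n * q) \<le> (2 * (1 - norm z)) powr (real n * q)"
    using assms by (intro powr_mono2) auto
  ultimately have "size_gauge n p q \<zeta> \<le> (2 * (1 - norm z)) powr (real n * q) * ((2 * (1 - norm z)) * (B * omega_hat \<omega> (norm z))) powr (q / p)"
    unfolding size_gauge_def omega_hat0_def by (intro mult_mono) (auto simp: max_def)
  also have "\<dots> = 2 powr (real n * q) * (2 * B) powr (q / p) * size_gauge n p q z"
  proof -
    have "(2 * a) powr c * ((2 * a) * (B * b)) powr d = 2 powr c * (2 * B) powr d * (a powr c * (a * b) powr d)"
      if "0 \<le> a" "0 \<le> b" for a b c d :: real
      using that B by (simp add: powr_mult)
    from this[of "1 - norm z" "omega_hat \<omega> (norm z)"] show ?thesis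
      using assms(1) by (simp only: size_gauge_def omega_hat0_def omega_hat_nonneg max_absorb2 norm_ge_zero)
  qed
  finally show ?thesis .
qed

lemma size_gauge_le:
  assumes "r < 1" "norm z \<le> r" "1 < p" "p \<le> q"
  shows "(1 - r) powr (real n * q) * ((1 - r) * omega_hat \<omega> r) powr (q / p) \<le> size_gauge n p q z"
proof -
  have r0: "0 \<le> r" using assms norm_ge_zero[of z] by linarith
  have "(1 - r) * omega_hat \<omega> r \<le> (1 - norm z) * omega_hat \<omega> (norm z)"
    using assms r0 by (intro mult_mono omega_hat_antimono) (auto simp: omega_hat_nonneg)
  then have "((1 - r) * omega_hat \<omega> r) powr (q / p) \<le> ((1 - norm z) * omega_hat \<omega> (norm z)) powr (q / p)"
    using assms r0 by (intro powr_mono2) (auto simp: omega_hat_nonneg)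
  moreover have "(1 - r) powr (real n * q) \<le> (1 - norm z) powr (real n * q)"
    using assms by (intro powr_mono2) auto
  ultimately show ?thesis
    unfolding size_gauge_def omega_hat0_def by (intro mult_mono) (auto simp: max_def)
qed

text \<open>Raising the p-th power bound to the power q/p \<ge> 1 would destroy linearity in
  \<open>ring_mean\<close>. Only one factor of the mean is kept; the remaining power q/p - 1 is
  bounded through the norm of f. A bound linear in |f|^p is what Fubini needs.\<close>

lemma powr_norm_deriv_le:
  assumes f: "f \<in> bergman_space p \<omega>" and z: "norm z < 1" and pq: "1 < p" "p \<le> q"
  defines "N \<equiv> integral\<^sup>L (wA \<omega>) (\<lambda>w. norm (f w) powr p)"
  shows "ennreal (norm ((deriv ^^ n) f z) powr q * size_gauge n p q z)
    \<le> ennreal (deriv_const p n powr (q / p) * (4 * N) powr (q / p - 1)) * ring_mean p f z"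
    and "ring_mean p f z \<le> ennreal (4 * N)"
proof -
  have hol: "f holomorphic_on ball 0 1" and int: "integrable (wA \<omega>) (\<lambda>w. norm (f w) powr p)"
    using f by (auto simp: bergman_space_def)
  have N0: "0 \<le> N" unfolding N_def by (rule integral_nonneg_AE) simp
  have "(\<integral>\<^sup>+w. ennreal (norm (f w) powr p) \<partial>wA \<omega>) = ennreal N"
    unfolding N_def using int by (rule nn_integral_eq_integral) simp
  then show le: "ring_mean p f z \<le> ennreal (4 * N)"
    using ring_mean_le[OF hol z, of p] N0 by (simp add: ennreal_mult)
  then obtain g where g: "0 \<le> g" "ring_mean p f z = ennreal g" "g \<le> 4 * N"
    using N0 by (cases "ring_mean p f z") (auto simp: top_unique ennreal_le_iff)
  define W where "W = (1 - norm z) * omega_hat \<omega> (norm z)"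
  have W: "0 \<le> W" using z by (simp add: W_def omega_hat_nonneg)
  define D where "D = norm ((deriv ^^ n) f z)"
  define X where "X = ((1 - norm z) ^ n * D) powr p * W"
  have "ennreal X \<le> ennreal (deriv_const p n * g)"
    using powr_norm_deriv_le_ring_mean[OF hol z pq(1), of n] g deriv_const_pos[of p n]
    by (simp add: X_def W_def D_def ennreal_mult)
  then have X: "X \<le> deriv_const p n * g"
    using g deriv_const_pos[of p n] by (simp add: ennreal_le_iff)
  have "D powr q * size_gauge n p q z = X powr (q / p)"
  proof -
    define y where "y = (1 - norm z) ^ n"
    have y: "0 \<le> y" using z by (simp add: y_def)
    have "(1 - norm z) powr (real n * q) = y powr q"
      using z by (simp add: y_def powr_realpow[symmetric] powr_powr)
    then have "size_gauge n p q z = y powr q * W powr (q / p)"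
      by (simp add: size_gauge_def omega_hat0_def W_def max_def)
    moreover have "X powr (q / p) = ((y * D) powr p) powr (q / p) * W powr (q / p)"
      using W by (simp add: X_def y_def powr_mult)
    moreover have "((y * D) powr p) powr (q / p) = y powr q * D powr q"
      unfolding powr_powr using pq y by (simp add: powr_mult D_def)
    ultimately show ?thesis by simp
  qed
  also have "\<dots> \<le> (deriv_const p n * g) powr (q / p)"
    using X W pq by (intro powr_mono2) (auto simp: X_def)
  \<comment> \<open>Here the linear factor g is split off; the other factor is bounded by g \<le>
    4N, which uses p \<le> q.\<close>
  also have "\<dots> = deriv_const p n powr (q / p) * (g * g powr (q / p - 1))"
    using g deriv_const_pos[of p n] powr_mult_base[of g "q / p - 1"] by (simp add: powr_mult)
  also have "\<dots> \<le> deriv_const p n powr (q / p) * (g * (4 * N) powr (q / p - 1))"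
    using g pq by (intro mult_left_mono powr_mono2) auto
  finally have "D powr q * size_gauge n p q z \<le> deriv_const p n powr (q / p) * (4 * N) powr (q / p - 1) * g"
    by (simp add: mult_ac)
  then show "ennreal (norm ((deriv ^^ n) f z) powr q * size_gauge n p q z)
    \<le> ennreal (deriv_const p n powr (q / p) * (4 * N) powr (q / p - 1)) * ring_mean p f z"
    unfolding g D_def using g by (simp add: ennreal_mult[symmetric] ennreal_leI)
qed

end

section \<open>The Carleson embedding\<close>

lemma cnj_measurable [measurable]: "cnj \<in> borel_measurable borel"
  by (intro borel_measurable_continuous_onI continuous_intros)

lemma pseudo_hyp_disc_pred [measurable]:
  "Measurable.pred (borel \<Otimes>\<^sub>M borel) (\<lambda>x. snd x \<in> pseudo_hyp_disc s (fst x))"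
proof -
  have "(\<lambda>x. snd x \<in> pseudo_hyp_disc s (fst x)) = (\<lambda>x. norm (snd x) < 1 \<and> norm ((fst x - snd x) / (1 - cnj (fst x) * snd x)) < s)"
    by (auto simp: pseudo_hyp_disc_def)
  moreover have "Measurable.pred (borel \<Otimes>\<^sub>M borel) (\<lambda>x::complex \<times> complex. norm (snd x) < 1 \<and> norm ((fst x - snd x) / (1 - cnj (fst x) * snd x)) < s)"
    by measurable
  ultimately show ?thesis by simp
qed

lemma pseudo_hyp_disc_borel: "pseudo_hyp_disc s a \<in> sets borel"
proof -
  have "(\<lambda>z. (a, z)) \<in> measurable borel (borel \<Otimes>\<^sub>M borel)" by measurable
  from measurable_compose[OF this pseudo_hyp_disc_pred[of s]]
  have "Measurable.pred borel (\<lambda>z. z \<in> pseudo_hyp_disc s a)" by simp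
  then show ?thesis by (simp add: pred_def)
qed

text \<open>Since |1 - cnj \<zeta> z| \<ge> 1-|z|, Euclidean closeness on the scale 1-|z| suffices.
  The pseudohyperbolic disc is centred at \<zeta>, the future variable of integration, and z is the
  point in it.\<close>

lemma mem_pseudo_hyp_disc:
  assumes "norm z < 1" "norm \<zeta> < 1" "norm (\<zeta> - z) < s * (1 - norm z)"
  shows "z \<in> pseudo_hyp_disc s \<zeta>"
proof -
  have "1 - norm z \<le> norm (1 - cnj \<zeta> * z)"
  proof -
    have "norm (cnj \<zeta> * z) \<le> 1 * norm z"
      unfolding norm_mult using assms by (intro mult_right_mono) auto
    then show ?thesis using norm_triangle_ineq2[of 1 "cnj \<zeta> * z"] by simp
  qed
  moreover have "0 < s"
    using assms by (metis diff_gt_0_iff_gt norm_ge_zero order_le_less_trans zero_less_mult_pos2)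
  ultimately have "norm (\<zeta> - z) < s * norm (1 - cnj \<zeta> * z)"
    using assms(3) by (meson less_le_trans mult_le_cancel_left_pos)
  moreover have "0 < norm (1 - cnj \<zeta> * z)"
    using \<open>1 - norm z \<le> norm (1 - cnj \<zeta> * z)\<close> assms(1) by linarith
  ultimately show ?thesis
    using assms by (simp add: pseudo_hyp_disc_def norm_divide divide_less_eq)
qed

context radial
begin

lemma finite_measure_wA: "finite_measure (wA \<omega>)"
proof (rule finite_measureI)
  have "emeasure (wA \<omega>) (space (wA \<omega>)) = emeasure (wA \<omega>) {w \<in> ball 0 1. 0 \<le> norm w}"
    by (intro arg_cong2[where f=emeasure]) auto
  then show "emeasure (wA \<omega>) (space (wA \<omega>)) \<noteq> \<infinity>"
    using emeasure_annulus_le[of 0] by (auto simp: top_unique)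
qed

lemma ident_measurable_wA: "(\<lambda>x. x) \<in> borel_measurable (wA \<omega>)"
  by (rule borel_measurable_wA) simp

end

lemma ident_measurable_disc:
  "sets \<mu> = sets (restrict_space borel (ball (0::complex) 1)) \<Longrightarrow> (\<lambda>x. x) \<in> borel_measurable \<mu>"
  by (simp add: measurable_cong_sets[of \<mu> "restrict_space borel (ball 0 1)"] measurable_restrict_space1)

context D_weight
begin

text \<open>The kernel against which |f(w)|^p is integrated once the derivative bound at z is
  divided by the gauge; the cutoff r < |z| keeps only the part near the boundary.\<close>

definition kern :: "nat \<Rightarrow> real \<Rightarrow> real \<Rightarrow> real \<Rightarrow> complex \<Rightarrow> complex \<Rightarrow> ennreal" where
  "kern n p q r z w = (if r < norm z \<and> w \<in> ring z then ennreal ((1 - norm z)\<^sup>2 / (norm (w - z))\<^sup>2 / size_gauge n p q z) else 0)"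

lemma kern_measurable: "(\<lambda>x. kern n p q r (fst x) (snd x)) \<in> borel_measurable (borel \<Otimes>\<^sub>M borel)"
  unfolding kern_def ring_def mem_Collect_eq by measurable

text \<open>Points within $(1-|z|)/8$ of $z$ see the annulus around $z$ in the same way as $z$ does; this allows
  replacing \<open>\<mu>\<close> by its averages over pseudohyperbolic discs.\<close>

lemma kern_geometry:
  assumes z: "norm z < 1" "r < norm z" and w: "w \<in> ring z" and \<zeta>: "norm (\<zeta> - z) < \<sigma> * (1 - norm z)"
    and \<sigma>: "0 < \<sigma>" "\<sigma> \<le> 1 / 8"
  shows "norm \<zeta> < 1" "1 - norm \<zeta> \<le> 2 * (1 - norm z)" "1 - norm \<zeta> \<le> 2 * (1 - r)"
    "norm (w - \<zeta>) \<le> 2 * norm (w - z)" "0 < norm (w - \<zeta>)"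
    "norm \<zeta> \<le> norm w - 3/4 * (1 - norm w)" "1 - norm \<zeta> \<le> 9/4 * K * (1 - norm w)"
proof -
  define h where "h = 1 - norm z"
  have h: "0 < h" "norm z = 1 - h" using z by (auto simp: h_def)
  have "norm (\<zeta> - z) < \<sigma> * h" using \<zeta> by (simp add: h_def)
  also have "\<dots> \<le> 1 / 8 * h" using \<sigma> h by (intro mult_right_mono) auto
  finally have d: "norm (\<zeta> - z) < h / 8" by simp
  have z1: "norm \<zeta> \<le> norm (\<zeta> - z) + norm z" "norm z \<le> norm (\<zeta> - z) + norm \<zeta>"
    using norm_triangle_ineq[of "\<zeta> - z" z] norm_triangle_ineq[of "z - \<zeta>" \<zeta>] by (auto simp: norm_minus_commute)
  have w1: "1 - norm w \<le> h / 2" using w h by (simp add: ring_def field_simps)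
  have w2: "h \<le> 2 * K * (1 - norm w)"
    using w K by (simp add: ring_def h_def field_simps)
  show "norm \<zeta> < 1" using z1 d h by linarith
  have "1 - norm \<zeta> \<le> 2 * h" using z1 d h by linarith
  then show "1 - norm \<zeta> \<le> 2 * (1 - norm z)" "1 - norm \<zeta> \<le> 2 * (1 - r)"
    using z by (simp_all add: h_def)
  have wz: "h / 2 \<le> norm (w - z)" using norm_triangle_ineq2[of w z] w1 h by linarith
  have "norm (w - \<zeta>) \<le> norm (w - z) + norm (\<zeta> - z)"
    by (metis diff_add_cancel add_diff_eq norm_triangle_ineq norm_minus_commute)
  then show "norm (w - \<zeta>) \<le> 2 * norm (w - z)" using wz d h by linarith
  have wn: "norm w - norm \<zeta> \<le> norm (w - \<zeta>)" by (rule norm_triangle_ineq2)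
  show "0 < norm (w - \<zeta>)" using wn w1 z1 d h by linarith
  define k where "k = 1 - norm w"
  have "k \<le> h / 2" "norm w = 1 - k" using w1 by (simp_all add: k_def)
  then have "norm \<zeta> \<le> norm w - 3/4 * k" using z1 d h by linarith
  then show "norm \<zeta> \<le> norm w - 3/4 * (1 - norm w)" by (simp add: k_def)
  have "1 - norm \<zeta> \<le> 9 / 8 * h" using z1 d h by linarith
  then show "1 - norm \<zeta> \<le> 9/4 * K * (1 - norm w)" using w2 by simp
qed

text \<open>4 times the power of 2 and 2B compares |w-z|^2 times the gauge at z with the same
  expression at \<zeta>; pi \<sigma>^2 comes from the area of the averaging disc; the last factor is
  the annulus integral with A = 9K/4.\<close>

definition carleson_const :: "nat \<Rightarrow> real \<Rightarrow> real \<Rightarrow> real \<Rightarrow> real" where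
  "carleson_const n p q s = 4 * (2 powr (real n * q) * (2 * B) powr (q / p)) / (pi * (min (s / 2) (1 / 8))\<^sup>2) * (6 * pi * (9/4 * K))"

lemma carleson_const_pos: "0 < s \<Longrightarrow> 0 < carleson_const n p q s"
  using B K by (auto simp: carleson_const_def)

text \<open>The factor (1-|z|)^2 in the kernel is, up to a constant, the area of the disc of radius
  \<sigma>(1-|z|) around z, so the kernel is dominated by an area integral over that disc. After
  Fubini the \<mu>-integral in z is at most \<mu>(E_s(\<zeta>)) \<le> \<Lambda> times the gauge at
  \<zeta>; the gauges cancel and the inverse square integral over an annulus remains.\<close>

lemma nn_integral_kern_le:
  assumes sets: "sets \<mu> = sets (restrict_space borel (ball (0::complex) 1))" and fin: "finite_measure \<mu>"
    and s: "0 < s" and pq: "1 < p" "p \<le> q"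
    and \<Lambda>: "\<And>\<zeta>. norm \<zeta> < 1 \<Longrightarrow> 1 - norm \<zeta> \<le> 2 * (1 - r) \<Longrightarrow> emeasure \<mu> (pseudo_hyp_disc s \<zeta>) \<le> \<Lambda> * ennreal (size_gauge n p q \<zeta>)"
    and w: "norm w < 1"
  shows "(\<integral>\<^sup>+z. kern n p q r z w \<partial>\<mu>) \<le> ennreal (carleson_const n p q s) * \<Lambda>"
proof (cases "1 / 2 \<le> norm w")
  \<comment> \<open>Every annulus lies in |w| \<ge> 1/2, so the kernel vanishes; the annulus
    integral is needed only for the other case.\<close>
  case False
  then have "kern n p q r z w = 0" for z
    by (auto simp: kern_def ring_def field_simps) (smt (verit) norm_ge_zero)
  then show ?thesis by simp
next
  case True
  \<comment> \<open>The bound 1/8 serves the geometric lemma, and \<sigma> < s places z in the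
    pseudohyperbolic disc around \<zeta>.\<close>
  define \<sigma> where "\<sigma> = min (s / 2) (1 / 8)"
  have \<sigma>: "0 < \<sigma>" "\<sigma> \<le> 1 / 8" "\<sigma> < s" using s by (auto simp: \<sigma>_def)
  define C where "C = 2 powr (real n * q) * (2 * B) powr (q / p)"
  have C: "0 < C" using B by (simp add: C_def)
  define S where "S = {\<zeta>::complex. norm \<zeta> \<le> norm w - 3/4 * (1 - norm w) \<and> 1 - norm \<zeta> \<le> 9/4 * K * (1 - norm w)}"
  define T where "T = {\<zeta>. norm \<zeta> < 1 \<and> 1 - norm \<zeta> \<le> 2 * (1 - r) \<and> \<zeta> \<in> S}"
  have [measurable]: "S \<in> sets borel" unfolding S_def by measurable
  have [measurable]: "T \<in> sets borel" unfolding T_def by measurable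
  define H where "H \<zeta> = ennreal (1 / ((norm (w - \<zeta>))\<^sup>2 * size_gauge n p q \<zeta>)) * indicator T \<zeta>" for \<zeta>
  have [measurable]: "H \<in> borel_measurable borel" unfolding H_def[abs_def] by measurable
  define F where "F = (\<lambda>x. H (fst x) * indicator (pseudo_hyp_disc s (fst x)) (snd x))"
  have F: "F \<in> borel_measurable (borel \<Otimes>\<^sub>M borel)"
    unfolding F_def by measurable
  have Fm: "F \<in> borel_measurable (lborel \<Otimes>\<^sub>M \<mu>)"
    by (rule measurable_pair_borelI[OF _ ident_measurable_disc[OF sets] F]) simp
  have sp: "space \<mu> = ball 0 1"
    using sets_eq_imp_space_eq[OF sets] by (simp add: space_restrict_space)
  have "(\<integral>\<^sup>+z. kern n p q r z w \<partial>\<mu>) \<le> (\<integral>\<^sup>+z. ennreal (4 * C / (pi * \<sigma>\<^sup>2)) * (\<integral>\<^sup>+\<zeta>. F (\<zeta>, z) \<partial>lborel) \<partial>\<mu>)"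
  proof (intro nn_integral_mono)
    fix z assume "z \<in> space \<mu>"
    then have z: "norm z < 1" by (simp add: sp)
    show "kern n p q r z w \<le> ennreal (4 * C / (pi * \<sigma>\<^sup>2)) * (\<integral>\<^sup>+\<zeta>. F (\<zeta>, z) \<partial>lborel)"
    proof (cases "r < norm z \<and> w \<in> ring z")
      case False
      then show ?thesis by (auto simp: kern_def)
    next
      case True
      note geo = kern_geometry[OF z conjunct1[OF True] conjunct2[OF True] _ \<sigma>(1,2)]
      define h where "h = 1 - norm z"
      have h: "0 < h" using z by (simp add: h_def)
      define v where "v = (norm (w - z))\<^sup>2 * size_gauge n p q z"
      have wz: "0 < norm (w - z)" using True geo(4,5)[of z] \<sigma> z by simp
      have v: "0 < v" using wz size_gauge_pos[OF z] by (simp add: v_def)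
      \<comment> \<open>The square of 1-|z| is rewritten as a multiple of the area of the disc
        around z, to be read as an integral in \<zeta>.\<close>
      have "kern n p q r z w = ennreal (1 / (pi * \<sigma>\<^sup>2) * (1 / v) * (pi * (\<sigma> * h)\<^sup>2))"
        using True \<sigma> by (simp add: kern_def v_def h_def power_mult_distrib)
      also have "\<dots> = ennreal (1 / (pi * \<sigma>\<^sup>2)) * (ennreal (1 / v) * emeasure lborel (ball z (\<sigma> * h)))"
        using v \<sigma> h by (simp add: emeasure_lborel_ball_complex ennreal_mult[symmetric] mult.assoc)
      also have "ennreal (1 / v) * emeasure lborel (ball z (\<sigma> * h)) = (\<integral>\<^sup>+\<zeta>. ennreal (1 / v) * indicator (ball z (\<sigma> * h)) \<zeta> \<partial>lborel)"
        by (intro nn_integral_cmult_indicator[symmetric]) auto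
      also have "ennreal (1 / (pi * \<sigma>\<^sup>2)) * (\<integral>\<^sup>+\<zeta>. ennreal (1 / v) * indicator (ball z (\<sigma> * h)) \<zeta> \<partial>lborel) \<le> ennreal (1 / (pi * \<sigma>\<^sup>2)) * (\<integral>\<^sup>+\<zeta>. ennreal (4 * C) * F (\<zeta>, z) \<partial>lborel)"
      proof (intro mult_left_mono nn_integral_mono)
        fix \<zeta>
        show "ennreal (1 / v) * indicator (ball z (\<sigma> * h)) \<zeta> \<le> ennreal (4 * C) * F (\<zeta>, z)"
        proof (cases "\<zeta> \<in> ball z (\<sigma> * h)")
          case False
          then show ?thesis by simp
        next
          case in_ball: True
          then have d: "norm (\<zeta> - z) < \<sigma> * (1 - norm z)"
            by (simp add: dist_norm norm_minus_commute h_def)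
          note g = geo[OF d]
          have "\<sigma> * (1 - norm z) < s * (1 - norm z)"
            using \<sigma> z by (intro mult_strict_right_mono) auto
          then have mem: "z \<in> pseudo_hyp_disc s \<zeta>"
            using mem_pseudo_hyp_disc[OF z g(1)] d by simp
          have T: "\<zeta> \<in> T" using g by (simp add: T_def S_def)
          define u where "u = (norm (w - \<zeta>))\<^sup>2 * size_gauge n p q \<zeta>"
          have u: "0 < u" using g(5) size_gauge_pos[OF g(1)] by (simp add: u_def)
          have "u \<le> (2 * norm (w - z))\<^sup>2 * (C * size_gauge n p q z)"
            unfolding u_def C_def using g size_gauge_comparable[OF z g(1,2) pq] size_gauge_pos[OF g(1), of n p q]
            by (intro mult_mono power_mono) auto
          also have "\<dots> = 4 * C * v" by (simp add: v_def power_mult_distrib)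
          finally have "1 / v \<le> 4 * C * (1 / u)" using u v by (simp add: field_simps)
          then have "ennreal (1 / v) \<le> ennreal (4 * C) * ennreal (1 / u)"
            using C u by (subst ennreal_mult[symmetric]) (auto intro!: ennreal_leI)
          then show ?thesis using in_ball mem T by (simp add: F_def H_def u_def)
        qed
      qed simp
      also have "(\<integral>\<^sup>+\<zeta>. ennreal (4 * C) * F (\<zeta>, z) \<partial>lborel) = ennreal (4 * C) * (\<integral>\<^sup>+\<zeta>. F (\<zeta>, z) \<partial>lborel)"
        using measurable_compose[of "\<lambda>\<zeta>. (\<zeta>, z)" borel "borel \<Otimes>\<^sub>M borel" F borel] F
        by (intro nn_integral_cmult) auto
      also have "ennreal (1 / (pi * \<sigma>\<^sup>2)) * (ennreal (4 * C) * (\<integral>\<^sup>+\<zeta>. F (\<zeta>, z) \<partial>lborel)) = ennreal (4 * C / (pi * \<sigma>\<^sup>2)) * (\<integral>\<^sup>+\<zeta>. F (\<zeta>, z) \<partial>lborel)"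
        using C \<sigma> by (simp add: mult.assoc[symmetric] ennreal_mult[symmetric])
      finally show ?thesis .
    qed
  qed
  also have "\<dots> = ennreal (4 * C / (pi * \<sigma>\<^sup>2)) * (\<integral>\<^sup>+z. (\<integral>\<^sup>+\<zeta>. F (\<zeta>, z) \<partial>lborel) \<partial>\<mu>)"
  proof (rule nn_integral_cmult)
    have "(\<lambda>x. F (snd x, fst x)) \<in> borel_measurable (borel \<Otimes>\<^sub>M borel)"
      by (rule measurable_compose[OF _ F]) measurable
    then have "(\<lambda>x. F (snd x, fst x)) \<in> borel_measurable (\<mu> \<Otimes>\<^sub>M lborel)"
      by (intro measurable_pair_borelI[OF ident_measurable_disc[OF sets]]) auto
    then show "(\<lambda>z. \<integral>\<^sup>+\<zeta>. F (\<zeta>, z) \<partial>lborel) \<in> borel_measurable \<mu>"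
      by (intro lborel.borel_measurable_nn_integral) (simp add: case_prod_beta)
  qed
  finally have 1: "(\<integral>\<^sup>+z. kern n p q r z w \<partial>\<mu>)
      \<le> ennreal (4 * C / (pi * \<sigma>\<^sup>2)) * (\<integral>\<^sup>+z. (\<integral>\<^sup>+\<zeta>. F (\<zeta>, z) \<partial>lborel) \<partial>\<mu>)" .
  interpret P: pair_sigma_finite "lborel :: complex measure" \<mu>
    using fin by (intro pair_sigma_finite.intro sigma_finite_lborel) (simp add: finite_measure_def)
  have "(\<integral>\<^sup>+z. (\<integral>\<^sup>+\<zeta>. F (\<zeta>, z) \<partial>lborel) \<partial>\<mu>) = (\<integral>\<^sup>+\<zeta>. (\<integral>\<^sup>+z. F (\<zeta>, z) \<partial>\<mu>) \<partial>lborel)"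
    by (rule P.Fubini[OF Fm])
  also have "\<dots> \<le> (\<integral>\<^sup>+\<zeta>. \<Lambda> * (ennreal (1 / (norm (w - \<zeta>))\<^sup>2) * indicator S \<zeta>) \<partial>lborel)"
  proof (intro nn_integral_mono)
    fix \<zeta>
    have "(\<integral>\<^sup>+z. F (\<zeta>, z) \<partial>\<mu>) = H \<zeta> * emeasure \<mu> (pseudo_hyp_disc s \<zeta>)"
      unfolding F_def fst_conv snd_conv
      using pseudo_hyp_disc_borel[of s \<zeta>] by (intro nn_integral_cmult_indicator)
        (auto simp: sets sets_restrict_space_iff pseudo_hyp_disc_def)
    also have "\<dots> \<le> \<Lambda> * (ennreal (1 / (norm (w - \<zeta>))\<^sup>2) * indicator S \<zeta>)"
    proof (cases "\<zeta> \<in> T")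
      case False
      then show ?thesis by (simp add: H_def)
    next
      case True
      then have t: "norm \<zeta> < 1" "1 - norm \<zeta> \<le> 2 * (1 - r)" "\<zeta> \<in> S" by (auto simp: T_def)
      have gp: "0 < size_gauge n p q \<zeta>" using size_gauge_pos[OF t(1)] .
      have "H \<zeta> * emeasure \<mu> (pseudo_hyp_disc s \<zeta>) \<le> H \<zeta> * (\<Lambda> * ennreal (size_gauge n p q \<zeta>))"
        using \<Lambda>[OF t(1,2)] by (intro mult_left_mono) auto
      also have "\<dots> = \<Lambda> * (ennreal (1 / ((norm (w - \<zeta>))\<^sup>2 * size_gauge n p q \<zeta>)) * ennreal (size_gauge n p q \<zeta>))"
        using True by (simp add: H_def mult_ac)
      also have "ennreal (1 / ((norm (w - \<zeta>))\<^sup>2 * size_gauge n p q \<zeta>)) * ennreal (size_gauge n p q \<zeta>) = ennreal (1 / (norm (w - \<zeta>))\<^sup>2)"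
        using gp by (subst ennreal_mult[symmetric]) auto
      finally show ?thesis using t by simp
    qed
    finally show "(\<integral>\<^sup>+z. F (\<zeta>, z) \<partial>\<mu>) \<le> \<Lambda> * (ennreal (1 / (norm (w - \<zeta>))\<^sup>2) * indicator S \<zeta>)" .
  qed
  also have "\<dots> = \<Lambda> * (\<integral>\<^sup>+\<zeta>. ennreal (1 / (norm (w - \<zeta>))\<^sup>2) * indicator S \<zeta> \<partial>lborel)"
    by (intro nn_integral_cmult) auto
  also have "\<dots> \<le> \<Lambda> * ennreal (6 * pi * (9/4 * K))"
    unfolding S_def using True w K by (intro mult_left_mono nn_integral_inverse_square_annulus) auto
  finally have 2: "(\<integral>\<^sup>+z. (\<integral>\<^sup>+\<zeta>. F (\<zeta>, z) \<partial>lborel) \<partial>\<mu>) \<le> \<Lambda> * ennreal (6 * pi * (9/4 * K))" .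
  have "ennreal (4 * C / (pi * \<sigma>\<^sup>2)) * (\<Lambda> * ennreal (6 * pi * (9/4 * K)))
      = ennreal (4 * C / (pi * \<sigma>\<^sup>2)) * ennreal (6 * pi * (9/4 * K)) * \<Lambda>"
    by (simp only: mult_ac)
  also have "ennreal (4 * C / (pi * \<sigma>\<^sup>2)) * ennreal (6 * pi * (9/4 * K)) = ennreal (carleson_const n p q s)"
    using C K unfolding carleson_const_def \<sigma>_def[symmetric] C_def[symmetric]
    by (intro ennreal_mult[symmetric]) auto
  finally show ?thesis
    using order_trans[OF 1 mult_left_mono[OF 2]] by simp
qed

text \<open>The left side only sees r < |z|, and the averaging discs around such z stay in
  1-|\<zeta>| \<le> 2(1-r); this is why the Carleson condition is required only there. The power
  N^(q/p) is the linear factor N from Fubini times N^(q/p-1) from the pointwise bound.\<close>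

lemma carleson_embedding:
  assumes sets: "sets \<mu> = sets (restrict_space borel (ball (0::complex) 1))" and fin: "finite_measure \<mu>"
    and s: "0 < s" and pq: "1 < p" "p \<le> q"
    and \<Lambda>: "\<And>\<zeta>. norm \<zeta> < 1 \<Longrightarrow> 1 - norm \<zeta> \<le> 2 * (1 - r) \<Longrightarrow> emeasure \<mu> (pseudo_hyp_disc s \<zeta>) \<le> \<Lambda> * ennreal (size_gauge n p q \<zeta>)"
    and f: "f \<in> bergman_space p \<omega>"
  defines "N \<equiv> integral\<^sup>L (wA \<omega>) (\<lambda>w. norm (f w) powr p)"
  shows "(\<integral>\<^sup>+z. ennreal (norm ((deriv ^^ n) f z) powr q) * indicator {z. r < norm z} z \<partial>\<mu>)
    \<le> ennreal (deriv_const p n powr (q / p) * 4 powr (q / p - 1) * carleson_const n p q s * N powr (q / p)) * \<Lambda>"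
proof -
  have hol: "f holomorphic_on ball 0 1" and int: "integrable (wA \<omega>) (\<lambda>w. norm (f w) powr p)"
    using f by (auto simp: bergman_space_def)
  have N0: "0 \<le> N" unfolding N_def by (rule integral_nonneg_AE) simp
  have N: "(\<integral>\<^sup>+w. ennreal (norm (f w) powr p) \<partial>wA \<omega>) = ennreal N"
    unfolding N_def using int by (rule nn_integral_eq_integral) simp
  have [measurable]: "f \<in> borel_measurable (wA \<omega>)"
    using hol by (rule holomorphic_measurable_wA)
  have sp: "space \<mu> = ball 0 1"
    using sets_eq_imp_space_eq[OF sets] by (simp add: space_restrict_space)
  define c where "c = deriv_const p n powr (q / p) * (4 * N) powr (q / p - 1)"
  have c0: "0 \<le> c" by (simp add: c_def)
  define g where "g w = indicator (ball 0 1) w *\<^sub>R f w" for w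
  have [measurable]: "g \<in> borel_measurable borel"
    unfolding g_def[abs_def] using hol by (rule borel_measurable_cutoff_disc)
  define F where "F = (\<lambda>x. ennreal (norm (g (fst x)) powr p) * kern n p q r (snd x) (fst x))"
  have F: "F \<in> borel_measurable (borel \<Otimes>\<^sub>M borel)"
    unfolding F_def using measurable_compose[OF measurable_pair_swap' kern_measurable, of n p q r]
    by (intro borel_measurable_times_ennreal) (measurable, simp add: case_prod_beta)
  have Fm: "F \<in> borel_measurable (wA \<omega> \<Otimes>\<^sub>M \<mu>)"
    by (rule measurable_pair_borelI[OF ident_measurable_wA ident_measurable_disc[OF sets] F])
  have "(\<integral>\<^sup>+z. ennreal (norm ((deriv ^^ n) f z) powr q) * indicator {z. r < norm z} z \<partial>\<mu>)
      \<le> (\<integral>\<^sup>+z. ennreal c * (\<integral>\<^sup>+w. F (w, z) \<partial>wA \<omega>) \<partial>\<mu>)"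
  proof (intro nn_integral_mono)
    fix z assume "z \<in> space \<mu>"
    then have z: "norm z < 1" by (simp add: sp)
    show "ennreal (norm ((deriv ^^ n) f z) powr q) * indicator {z. r < norm z} z \<le> ennreal c * (\<integral>\<^sup>+w. F (w, z) \<partial>wA \<omega>)"
    proof (cases "r < norm z")
      case True
      define G where "G = size_gauge n p q z"
      have G: "0 < G" unfolding G_def using size_gauge_pos[OF z] .
      have "ennreal (norm ((deriv ^^ n) f z) powr q) = ennreal (1 / G) * ennreal (norm ((deriv ^^ n) f z) powr q * G)"
        using G by (subst ennreal_mult[symmetric]) auto
      also have "\<dots> \<le> ennreal (1 / G) * (ennreal c * ring_mean p f z)"
        unfolding c_def G_def N_def using powr_norm_deriv_le(1)[OF f z pq, of n] by (intro mult_left_mono) auto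
      also have "\<dots> = ennreal c * (ennreal (1 / G) * ring_mean p f z)"
        by (simp only: mult_ac)
      also have "ennreal (1 / G) * ring_mean p f z = (\<integral>\<^sup>+w. ennreal (1 / G) * (ennreal (norm (f w) powr p * ((1 - norm z)\<^sup>2 / (norm (w - z))\<^sup>2)) * indicator (ring z) w) \<partial>wA \<omega>)"
        unfolding ring_mean_def using ring_disc[OF z]
        by (intro nn_integral_cmult[symmetric] borel_measurable_times_ennreal borel_measurable_indicator sets_wAI) auto
      also have "\<dots> = (\<integral>\<^sup>+w. F (w, z) \<partial>wA \<omega>)"
        using True G by (intro nn_integral_cong)
          (auto simp: F_def g_def kern_def G_def[symmetric] ennreal_mult[symmetric] mult_ac split: split_indicator)
      finally show ?thesis using True by simp
    qed simp
  qed
  also have "\<dots> = ennreal c * (\<integral>\<^sup>+z. (\<integral>\<^sup>+w. F (w, z) \<partial>wA \<omega>) \<partial>\<mu>)"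
  proof (rule nn_integral_cmult)
    have "(\<lambda>x. F (snd x, fst x)) \<in> borel_measurable (borel \<Otimes>\<^sub>M borel)"
      by (rule measurable_compose[OF _ F]) measurable
    then have "(\<lambda>x. F (snd x, fst x)) \<in> borel_measurable (\<mu> \<Otimes>\<^sub>M wA \<omega>)"
      by (rule measurable_pair_borelI[OF ident_measurable_disc[OF sets] ident_measurable_wA])
    moreover have "sigma_finite_measure (wA \<omega>)"
      using finite_measure_wA by (simp add: finite_measure_def)
    ultimately show "(\<lambda>z. \<integral>\<^sup>+w. F (w, z) \<partial>wA \<omega>) \<in> borel_measurable \<mu>"
      by (intro sigma_finite_measure.borel_measurable_nn_integral) (auto simp: case_prod_beta)
  qed
  finally have 1: "(\<integral>\<^sup>+z. ennreal (norm ((deriv ^^ n) f z) powr q) * indicator {z. r < norm z} z \<partial>\<mu>)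
      \<le> ennreal c * (\<integral>\<^sup>+z. (\<integral>\<^sup>+w. F (w, z) \<partial>wA \<omega>) \<partial>\<mu>)" .
  interpret P: pair_sigma_finite "wA \<omega>" \<mu>
    using fin finite_measure_wA by (intro pair_sigma_finite.intro) (simp_all add: finite_measure_def)
  have "(\<integral>\<^sup>+z. (\<integral>\<^sup>+w. F (w, z) \<partial>wA \<omega>) \<partial>\<mu>) = (\<integral>\<^sup>+w. (\<integral>\<^sup>+z. F (w, z) \<partial>\<mu>) \<partial>wA \<omega>)"
    by (rule P.Fubini[OF Fm])
  also have "\<dots> \<le> (\<integral>\<^sup>+w. (ennreal (carleson_const n p q s) * \<Lambda>) * ennreal (norm (f w) powr p) \<partial>wA \<omega>)"
  proof (intro nn_integral_mono)
    fix w assume "w \<in> space (wA \<omega>)"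
    then have w: "norm w < 1" by simp
    have "(\<lambda>z. kern n p q r z w) \<in> borel_measurable borel"
      using measurable_compose[OF _ kern_measurable, of "\<lambda>z. (z, w)" borel n p q r] by simp
    then have "(\<lambda>z. kern n p q r z w) \<in> borel_measurable \<mu>"
      using measurable_compose[OF ident_measurable_disc[OF sets]] by blast
    then have "(\<integral>\<^sup>+z. F (w, z) \<partial>\<mu>) = ennreal (norm (f w) powr p) * (\<integral>\<^sup>+z. kern n p q r z w \<partial>\<mu>)"
      using w by (simp add: F_def g_def nn_integral_cmult)
    also have "\<dots> \<le> ennreal (norm (f w) powr p) * (ennreal (carleson_const n p q s) * \<Lambda>)"
      by (intro mult_left_mono nn_integral_kern_le[OF sets fin s pq \<Lambda> w]) auto
    finally show "(\<integral>\<^sup>+z. F (w, z) \<partial>\<mu>) \<le> (ennreal (carleson_const n p q s) * \<Lambda>) * ennreal (norm (f w) powr p)"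
      by (simp add: mult.commute)
  qed
  also have "\<dots> = (ennreal (carleson_const n p q s) * \<Lambda>) * ennreal N"
    by (subst nn_integral_cmult) (auto simp: N)
  finally have 2: "(\<integral>\<^sup>+z. (\<integral>\<^sup>+w. F (w, z) \<partial>wA \<omega>) \<partial>\<mu>) \<le> (ennreal (carleson_const n p q s) * \<Lambda>) * ennreal N" .
  have "ennreal c * ((ennreal (carleson_const n p q s) * \<Lambda>) * ennreal N)
      = (ennreal c * ennreal (carleson_const n p q s) * ennreal N) * \<Lambda>"
    by (simp only: mult_ac)
  also have "ennreal c * ennreal (carleson_const n p q s) * ennreal N = ennreal (c * carleson_const n p q s * N)"
    using c0 carleson_const_pos[OF s, of n p q] N0 by (simp add: ennreal_mult)
  also have "c * carleson_const n p q s * N = deriv_const p n powr (q / p) * 4 powr (q / p - 1) * carleson_const n p q s * N powr (q / p)"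
    using N0 powr_mult_base[OF N0, of "q / p - 1"] by (simp add: c_def powr_mult mult_ac)
  finally show ?thesis
    using order_trans[OF 1 mult_left_mono[OF 2]] by simp
qed

end

section \<open>Operators between Bergman and Lebesgue spaces\<close>

text \<open>A crude replacement for Minkowski's inequality; the factor 2^q is harmless because only
  comparability up to constants is claimed.\<close>

lemma powr_norm_diff_le:
  fixes a b :: complex
  assumes "0 \<le> q"
  shows "norm (a - b) powr q \<le> 2 powr q * (norm a powr q + norm b powr q)"
proof -
  have "norm (a - b) \<le> 2 * max (norm a) (norm b)"
    using norm_triangle_ineq4[of a b] by (simp add: max_def)
  then have "norm (a - b) powr q \<le> (2 * max (norm a) (norm b)) powr q"
    using assms by (intro powr_mono2) auto
  also have "\<dots> = 2 powr q * max (norm a) (norm b) powr q"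
    by (simp add: powr_mult le_max_iff_disj)
  also have "\<dots> \<le> 2 powr q * (norm a powr q + norm b powr q)"
    by (intro mult_left_mono) (auto simp: max_def)
  finally show ?thesis .
qed

lemma Lq_space_diff:
  assumes g: "g1 \<in> Lq_space \<mu> q" "g2 \<in> Lq_space \<mu> q" and q: "0 \<le> q"
  shows "(\<lambda>z. g1 z - g2 z) \<in> Lq_space \<mu> q"
    and "(\<integral>z. norm (g1 z - g2 z) powr q \<partial>\<mu>) \<le> 2 powr q * ((\<integral>z. norm (g1 z) powr q \<partial>\<mu>) + (\<integral>z. norm (g2 z) powr q \<partial>\<mu>))"
proof -
  have [measurable]: "g1 \<in> borel_measurable \<mu>" "g2 \<in> borel_measurable \<mu>"
    and i: "integrable \<mu> (\<lambda>z. norm (g1 z) powr q)" "integrable \<mu> (\<lambda>z. norm (g2 z) powr q)"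
    using g by (auto simp: Lq_space_def)
  have j: "integrable \<mu> (\<lambda>z. 2 powr q * (norm (g1 z) powr q + norm (g2 z) powr q))"
    using i by auto
  have k: "integrable \<mu> (\<lambda>z. norm (g1 z - g2 z) powr q)"
    by (rule Bochner_Integration.integrable_bound[OF j]) (use powr_norm_diff_le[OF q] in auto)
  then show "(\<lambda>z. g1 z - g2 z) \<in> Lq_space \<mu> q"
    by (simp add: Lq_space_def)
  have "(\<integral>z. norm (g1 z - g2 z) powr q \<partial>\<mu>) \<le> (\<integral>z. 2 powr q * (norm (g1 z) powr q + norm (g2 z) powr q) \<partial>\<mu>)"
    using k j powr_norm_diff_le[OF q] by (intro integral_mono) auto
  then show "(\<integral>z. norm (g1 z - g2 z) powr q \<partial>\<mu>) \<le> 2 powr q * ((\<integral>z. norm (g1 z) powr q \<partial>\<mu>) + (\<integral>z. norm (g2 z) powr q \<partial>\<mu>))"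
    using i by simp
qed

lemma Lq_norm_nonneg: "0 \<le> Lq_norm \<mu> q g"
  by (simp add: Lq_norm_def)

lemma Lq_norm_powr: "0 < q \<Longrightarrow> Lq_norm \<mu> q g powr q = (\<integral>z. norm (g z) powr q \<partial>\<mu>)"
  by (simp add: Lq_norm_def powr_powr integral_nonneg_AE)

lemma bergman_norm_nonneg: "0 \<le> bergman_norm p \<omega> f"
  by (simp add: bergman_norm_def)

lemma bergman_norm_powr: "0 < p \<Longrightarrow> bergman_norm p \<omega> f powr p = (\<integral>z. norm (f z) powr p \<partial>wA \<omega>)"
  by (simp add: bergman_norm_def powr_powr integral_nonneg_AE)

lemma bergman_norm_le_1_iff:
  assumes "0 < p"
  shows "bergman_norm p \<omega> f \<le> 1 \<longleftrightarrow> (\<integral>z. norm (f z) powr p \<partial>wA \<omega>) \<le> 1"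
proof
  assume "bergman_norm p \<omega> f \<le> 1"
  then have "bergman_norm p \<omega> f powr p \<le> 1 powr p"
    using assms by (intro powr_mono2 bergman_norm_nonneg) auto
  then show "(\<integral>z. norm (f z) powr p \<partial>wA \<omega>) \<le> 1" using assms by (simp add: bergman_norm_powr)
next
  assume "(\<integral>z. norm (f z) powr p \<partial>wA \<omega>) \<le> 1"
  then have "(\<integral>z. norm (f z) powr p \<partial>wA \<omega>) powr (1 / p) \<le> 1 powr (1 / p)"
    using assms by (intro powr_mono2) (auto intro: integral_nonneg_AE)
  then show "bergman_norm p \<omega> f \<le> 1" by (simp add: bergman_norm_def)
qed

text \<open>\<open>op_norm\<close> is a supremum of reals and bounds its members only when they are
  bounded above; boundedness of both operators provides that bound.\<close>

lemma Lq_norm_diff_le_op_norm: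
  assumes T: "bounded_op p \<omega> \<mu> q T" and K: "bounded_op p \<omega> \<mu> q K" and q: "0 < q"
    and f: "f \<in> bergman_space p \<omega>" "bergman_norm p \<omega> f \<le> 1"
  shows "Lq_norm \<mu> q (\<lambda>z. T f z - K f z) \<le> op_norm p \<omega> \<mu> q (\<lambda>f z. T f z - K f z)"
proof -
  obtain C1 where C1: "\<And>f. f \<in> bergman_space p \<omega> \<Longrightarrow> T f \<in> Lq_space \<mu> q"
      "\<And>f. f \<in> bergman_space p \<omega> \<Longrightarrow> Lq_norm \<mu> q (T f) \<le> C1 * bergman_norm p \<omega> f"
    using T by (auto simp: bounded_op_def)
  obtain C2 where C2: "\<And>f. f \<in> bergman_space p \<omega> \<Longrightarrow> K f \<in> Lq_space \<mu> q"
      "\<And>f. f \<in> bergman_space p \<omega> \<Longrightarrow> Lq_norm \<mu> q (K f) \<le> C2 * bergman_norm p \<omega> f"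
    using K by (auto simp: bounded_op_def)
  have "Lq_norm \<mu> q (\<lambda>z. T f z - K f z) \<le> (2 powr q * (\<bar>C1\<bar> powr q + \<bar>C2\<bar> powr q)) powr (1 / q)"
    if f: "f \<in> bergman_space p \<omega>" "bergman_norm p \<omega> f \<le> 1" for f
  proof -
    have bnd: "Lq_norm \<mu> q g powr q \<le> \<bar>C\<bar> powr q" if "Lq_norm \<mu> q g \<le> C * bergman_norm p \<omega> f" for g C
    proof -
      have "C * bergman_norm p \<omega> f \<le> \<bar>C\<bar> * 1"
        using f(2) bergman_norm_nonneg[of p \<omega> f] by (intro mult_mono) auto
      then show ?thesis using that q by (intro powr_mono2) (auto simp: Lq_norm_nonneg)
    qed
    have "(\<integral>z. norm (T f z - K f z) powr q \<partial>\<mu>) \<le> 2 powr q * (Lq_norm \<mu> q (T f) powr q + Lq_norm \<mu> q (K f) powr q)"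
      using Lq_space_diff(2)[OF C1(1)[OF f(1)] C2(1)[OF f(1)]] q by (simp add: Lq_norm_powr)
    also have "\<dots> \<le> 2 powr q * (\<bar>C1\<bar> powr q + \<bar>C2\<bar> powr q)"
      using bnd[OF C1(2)[OF f(1)]] bnd[OF C2(2)[OF f(1)]] by (intro mult_left_mono add_mono) auto
    finally show ?thesis
      unfolding Lq_norm_def using q by (intro powr_mono2) (auto intro: integral_nonneg_AE)
  qed
  then show ?thesis
    unfolding op_norm_def using f by (intro cSup_upper bdd_aboveI[where M="(2 powr q * (\<bar>C1\<bar> powr q + \<bar>C2\<bar> powr q)) powr (1 / q)"]) auto
qed

lemma zero_in_bergman: "0 < p \<Longrightarrow> (\<lambda>_. 0) \<in> bergman_space p \<omega>" "0 < p \<Longrightarrow> bergman_norm p \<omega> (\<lambda>_. 0) = 0"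
  by (auto simp: bergman_space_def bergman_norm_def)

lemma op_norm_diff_nonneg:
  assumes "bounded_op p \<omega> \<mu> q T" "bounded_op p \<omega> \<mu> q K" "0 < q" "0 < p"
  shows "0 \<le> op_norm p \<omega> \<mu> q (\<lambda>f z. T f z - K f z)"
proof -
  have "Lq_norm \<mu> q (\<lambda>z. T (\<lambda>_. 0) z - K (\<lambda>_. 0) z) \<le> op_norm p \<omega> \<mu> q (\<lambda>f z. T f z - K f z)"
    using assms by (intro Lq_norm_diff_le_op_norm) (auto simp: zero_in_bergman)
  then show ?thesis using Lq_norm_nonneg order_trans by blast
qed

lemma compact_op_bounded: "compact_op p \<omega> \<mu> q K \<Longrightarrow> bounded_op p \<omega> \<mu> q K"
  by (simp add: compact_op_def)

lemma essential_norm_le: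
  assumes T: "bounded_op p \<omega> \<mu> q T" and K: "compact_op p \<omega> \<mu> q K" and "0 < q" "0 < p"
  shows "essential_norm p \<omega> \<mu> q T \<le> op_norm p \<omega> \<mu> q (\<lambda>f z. T f z - K f z)"
  unfolding essential_norm_def
proof (rule cInf_lower)
  show "bdd_below {op_norm p \<omega> \<mu> q (\<lambda>f z. T f z - K f z) |K. compact_op p \<omega> \<mu> q K}"
    using op_norm_diff_nonneg[OF T compact_op_bounded assms(3,4)] by (intro bdd_belowI[where m=0]) blast
qed (use K in blast)

text \<open>Some compact operator must be exhibited, so that the infimum of reals is taken over a
  nonempty set.\<close>

lemma essential_norm_nonneg:
  assumes T: "bounded_op p \<omega> \<mu> q T" and K: "compact_op p \<omega> \<mu> q K" and "0 < q" "0 < p"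
  shows "0 \<le> essential_norm p \<omega> \<mu> q T"
  unfolding essential_norm_def
  using K op_norm_diff_nonneg[OF T compact_op_bounded assms(3,4)] by (intro cInf_greatest) blast+

lemma space_borel_measure_on_disc: "borel_measure_on_disc \<mu> \<Longrightarrow> space \<mu> = ball 0 1"
  unfolding borel_measure_on_disc_def by (drule sets_eq_imp_space_eq) (simp add: space_restrict_space)

lemma borel_measure_on_disc_continuous:
  "borel_measure_on_disc \<mu> \<Longrightarrow> continuous_on (ball 0 1) g \<Longrightarrow> (g :: complex \<Rightarrow> complex) \<in> borel_measurable \<mu>"
  unfolding borel_measure_on_disc_def
  by (simp add: measurable_cong_sets[of \<mu> "restrict_space borel (ball 0 1)"] borel_measurable_continuous_on_restrict)

lemma higher_deriv_power_self: "(deriv ^^ n) (\<lambda>w. w ^ n) z = (fact n :: complex)"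
  using higher_deriv_power[of n 0 n z] by (simp add: pochhammer_fact Suc_diff_le)

lemma (in radial) bounded_in_bergman:
  assumes "f holomorphic_on ball 0 1" "\<And>z. norm z < 1 \<Longrightarrow> norm (f z) \<le> M" "0 < p"
  shows "f \<in> bergman_space p \<omega>"
proof -
  interpret finite_measure "wA \<omega>" by (rule finite_measure_wA)
  have [measurable]: "f \<in> borel_measurable (wA \<omega>)"
    using assms(1) by (rule holomorphic_measurable_wA)
  have "norm (f z) powr p \<le> M powr p" if "norm z < 1" for z
    using assms(2)[OF that] assms(3) by (intro powr_mono2) auto
  then have "integrable (wA \<omega>) (\<lambda>z. norm (f z) powr p)"
    by (intro integrable_const_bound[where B="M powr p"] AE_I2) auto
  then show ?thesis using assms by (simp add: bergman_space_def)
qed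

text \<open>Tested on z^n, whose n-th derivative is the constant n!, boundedness forces \<mu> to
  have finite mass.\<close>

lemma (in radial) finite_measure_of_bounded_diff_op:
  assumes \<mu>: "borel_measure_on_disc \<mu>" and T: "bounded_op p \<omega> \<mu> q (diff_op n)" and "0 < p"
  shows "finite_measure \<mu>"
proof -
  have "(\<lambda>z. z ^ n) \<in> bergman_space p \<omega>"
    using assms by (intro bounded_in_bergman[where M=1] holomorphic_intros)
      (auto simp: norm_power intro!: power_le_one)
  then have "diff_op n (\<lambda>z. z ^ n) \<in> Lq_space \<mu> q"
    using T by (auto simp: bounded_op_def)
  then have "integrable \<mu> (\<lambda>z. (fact n :: real) powr q)"
    by (simp add: Lq_space_def diff_op_def higher_deriv_power_self)
  then have "emeasure \<mu> (space \<mu>) < \<infinity>"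
    by (auto simp: integrable_iff_bounded ennreal_mult_less_top)
  then show ?thesis by (intro finite_measureI) auto
qed

section \<open>The upper bound\<close>

definition truncated_diff :: "nat \<Rightarrow> real \<Rightarrow> (complex \<Rightarrow> complex) \<Rightarrow> complex \<Rightarrow> complex" where
  "truncated_diff n r f z = (if norm z \<le> r then (deriv ^^ n) f z else 0)"

lemma norm_truncated_diff_le: "norm (truncated_diff n r f z) \<le> norm ((deriv ^^ n) f z)"
  by (simp add: truncated_diff_def)

lemma truncated_measurable:
  assumes "borel_measure_on_disc \<mu>" and [measurable]: "g \<in> borel_measurable \<mu>"
  shows "(\<lambda>z. if norm z \<le> r then g z else (0::complex)) \<in> borel_measurable \<mu>"
proof -
  have [measurable]: "(\<lambda>x. x) \<in> borel_measurable \<mu>"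
    using assms(1) by (intro ident_measurable_disc) (simp add: borel_measure_on_disc_def)
  show ?thesis by measurable
qed

lemma Lq_norm_mono:
  assumes "g1 \<in> borel_measurable \<mu>" "g2 \<in> Lq_space \<mu> q" "\<And>z. norm (g1 z) \<le> norm (g2 z)" "0 < q"
  shows "g1 \<in> Lq_space \<mu> q" "Lq_norm \<mu> q g1 \<le> Lq_norm \<mu> q g2"
proof -
  have le: "norm (g1 z) powr q \<le> norm (g2 z) powr q" for z
    using assms by (intro powr_mono2) auto
  have i2: "integrable \<mu> (\<lambda>z. norm (g2 z) powr q)" using assms by (simp add: Lq_space_def)
  have i1: "integrable \<mu> (\<lambda>z. norm (g1 z) powr q)"
    using assms(1) le by (intro Bochner_Integration.integrable_bound[OF i2]) auto
  then show "g1 \<in> Lq_space \<mu> q" using assms by (simp add: Lq_space_def)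
  have "(\<integral>z. norm (g1 z) powr q \<partial>\<mu>) \<le> (\<integral>z. norm (g2 z) powr q \<partial>\<mu>)"
    using i1 i2 le by (intro integral_mono) auto
  then show "Lq_norm \<mu> q g1 \<le> Lq_norm \<mu> q g2"
    unfolding Lq_norm_def using assms by (intro powr_mono2) (auto intro: integral_nonneg_AE)
qed

lemma bounded_op_truncated_diff:
  assumes \<mu>: "borel_measure_on_disc \<mu>" and T: "bounded_op p \<omega> \<mu> q (diff_op n)" and q: "0 < q"
  shows "bounded_op p \<omega> \<mu> q (truncated_diff n r)"
proof -
  obtain C where C: "\<And>f. f \<in> bergman_space p \<omega> \<Longrightarrow> diff_op n f \<in> Lq_space \<mu> q"
      "\<And>f. f \<in> bergman_space p \<omega> \<Longrightarrow> Lq_norm \<mu> q (diff_op n f) \<le> C * bergman_norm p \<omega> f"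
    using T by (auto simp: bounded_op_def)
  have *: "truncated_diff n r f \<in> Lq_space \<mu> q" "Lq_norm \<mu> q (truncated_diff n r f) \<le> Lq_norm \<mu> q (diff_op n f)"
    if f: "f \<in> bergman_space p \<omega>" for f
  proof -
    have "diff_op n f \<in> borel_measurable \<mu>" using C(1)[OF f] by (simp add: Lq_space_def)
    from truncated_measurable[OF \<mu> this, of r] have "truncated_diff n r f \<in> borel_measurable \<mu>"
      unfolding truncated_diff_def[abs_def] diff_op_def .
    with Lq_norm_mono[OF this C(1)[OF f]] q norm_truncated_diff_le
    show "truncated_diff n r f \<in> Lq_space \<mu> q" "Lq_norm \<mu> q (truncated_diff n r f) \<le> Lq_norm \<mu> q (diff_op n f)"
      by (auto simp: diff_op_def)
  qed
  then show ?thesis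
    unfolding bounded_op_def using C(2) order_trans by blast
qed

lemma compact_subset_disc:
  assumes "compact S" "S \<subseteq> ball (0::complex) 1"
  obtains r where "0 \<le> r" "r < 1" "S \<subseteq> cball 0 r"
proof (cases "S = {}")
  case True
  then show ?thesis using that[of 0] by auto
next
  case False
  obtain x where x: "x \<in> S" "\<And>y. y \<in> S \<Longrightarrow> norm y \<le> norm x"
    using continuous_attains_sup[OF assms(1) False, of norm] by (auto intro: continuous_intros)
  then have "S \<subseteq> cball 0 (norm x)" by auto
  moreover have "norm x < 1" using x(1) assms(2) by auto
  ultimately show ?thesis using that[of "norm x"] by simp
qed

context D_weight
begin

text \<open>For f in the unit ball the ring mean is at most 4, and the gauge is bounded below on |z|
  \<le> r. This is the local boundedness that Montel's theorem asks for.\<close>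

lemma norm_deriv_locally_bounded:
  assumes pq: "1 < p" "p \<le> q" and r: "0 \<le> r" "r < 1"
  obtains M where "\<And>f z. f \<in> bergman_space p \<omega> \<Longrightarrow> bergman_norm p \<omega> f \<le> 1 \<Longrightarrow> norm z \<le> r \<Longrightarrow> norm ((deriv ^^ n) f z) \<le> M"
proof -
  define G where "G = (1 - r) powr (real n * q) * ((1 - r) * omega_hat \<omega> r) powr (q / p)"
  have G: "0 < G" using r omega_hat_pos[of r] by (simp add: G_def)
  define A where "A = deriv_const p n powr (q / p) * 4 powr (q / p - 1) * 4"
  have "norm ((deriv ^^ n) f z) \<le> (A / G) powr (1 / q)"
    if f: "f \<in> bergman_space p \<omega>" "bergman_norm p \<omega> f \<le> 1" and z: "norm z \<le> r" for f z
  proof -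
    define N where "N = (\<integral>w. norm (f w) powr p \<partial>wA \<omega>)"
    have N: "0 \<le> N" "N \<le> 1"
      using f(2) pq bergman_norm_le_1_iff[of p \<omega> f] by (auto simp: N_def intro: integral_nonneg_AE)
    have z1: "norm z < 1" using z r by simp
    note b = powr_norm_deriv_le(1)[OF f(1) z1 pq, of n, folded N_def] powr_norm_deriv_le(2)[OF f(1) z1 pq, folded N_def]
    have "ennreal (norm ((deriv ^^ n) f z) powr q * size_gauge n p q z)
        \<le> ennreal (deriv_const p n powr (q / p) * (4 * N) powr (q / p - 1)) * ennreal (4 * N)"
      using b by (meson mult_left_mono order_trans zero_le)
    also have "\<dots> = ennreal (deriv_const p n powr (q / p) * (4 * N) powr (q / p - 1) * (4 * N))"
      using N by (subst ennreal_mult) auto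
    finally have "norm ((deriv ^^ n) f z) powr q * size_gauge n p q z \<le> deriv_const p n powr (q / p) * (4 * N) powr (q / p - 1) * (4 * N)"
      using N by (simp add: ennreal_le_iff)
    also have "\<dots> \<le> A"
      unfolding A_def using N pq deriv_const_pos[of p n] by (intro mult_mono powr_mono2) auto
    finally have "norm ((deriv ^^ n) f z) powr q * size_gauge n p q z \<le> A" .
    moreover have "norm ((deriv ^^ n) f z) powr q * G \<le> norm ((deriv ^^ n) f z) powr q * size_gauge n p q z"
      unfolding G_def using r z pq by (intro mult_left_mono size_gauge_le) auto
    ultimately have "norm ((deriv ^^ n) f z) powr q \<le> A / G"
      using G by (simp add: field_simps)
    then have "(norm ((deriv ^^ n) f z) powr q) powr (1 / q) \<le> (A / G) powr (1 / q)"
      using pq by (intro powr_mono2) auto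
    then show ?thesis using pq by (simp add: powr_powr)
  qed
  then show ?thesis using that by blast
qed

lemma compact_op_truncated_diff:
  assumes \<mu>: "borel_measure_on_disc \<mu>" and T: "bounded_op p \<omega> \<mu> q (diff_op n)" and pq: "1 < p" "p \<le> q"
    and r: "0 \<le> r" "r < 1"
  shows "compact_op p \<omega> \<mu> q (truncated_diff n r)"
  unfolding compact_op_def
proof (intro conjI ballI allI impI)
  have sp: "space \<mu> = ball 0 1" using \<mu> by (rule space_borel_measure_on_disc)
  interpret finite_measure \<mu>
    using pq by (intro finite_measure_of_bounded_diff_op[OF \<mu> T]) auto
  show "bounded_op p \<omega> \<mu> q (truncated_diff n r)"
    using pq by (intro bounded_op_truncated_diff[OF \<mu> T]) auto
  show "AE z in \<mu>. truncated_diff n r (\<lambda>w. a * f w + b * g w) z = a * truncated_diff n r f z + b * truncated_diff n r g z"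
    if "f \<in> bergman_space p \<omega>" "g \<in> bergman_space p \<omega>" for f g a b
  proof (rule AE_I2)
    fix z assume "z \<in> space \<mu>"
    then have z: "z \<in> ball 0 1" by (simp add: sp)
    have fg: "f holomorphic_on ball 0 1" "g holomorphic_on ball 0 1" using that by (auto simp: bergman_space_def)
    then have "(deriv ^^ n) (\<lambda>w. a * f w + b * g w) z = (deriv ^^ n) (\<lambda>w. a * f w) z + (deriv ^^ n) (\<lambda>w. b * g w) z"
      using z by (intro higher_deriv_add[where S="ball 0 1"] holomorphic_intros) auto
    also have "\<dots> = a * (deriv ^^ n) f z + b * (deriv ^^ n) g z"
      using higher_deriv_cmult[OF fg(1) z] higher_deriv_cmult[OF fg(2) z] by simp
    finally show "truncated_diff n r (\<lambda>w. a * f w + b * g w) z = a * truncated_diff n r f z + b * truncated_diff n r g z"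
      by (simp add: truncated_diff_def)
  qed
  fix F :: "nat \<Rightarrow> complex \<Rightarrow> complex"
  assume F: "\<forall>k. F k \<in> bergman_space p \<omega> \<and> bergman_norm p \<omega> (F k) \<le> 1"
  \<comment> \<open>Montel's theorem is applied to the n-th derivatives themselves; uniform
    convergence on |z| \<le> r then gives norm convergence because \<mu> is finite.\<close>
  define H where "H = {(deriv ^^ n) f | f. f \<in> bergman_space p \<omega> \<and> bergman_norm p \<omega> f \<le> 1}"
  obtain g \<rho> where g: "g holomorphic_on ball 0 1" "strict_mono (\<rho> :: nat \<Rightarrow> nat)"
    and lim: "\<And>S. compact S \<Longrightarrow> S \<subseteq> ball 0 1 \<Longrightarrow> uniform_limit S ((\<lambda>k. (deriv ^^ n) (F k)) \<circ> \<rho>) g sequentially"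
  proof (rule Montel[of "ball 0 1" H "\<lambda>k. (deriv ^^ n) (F k)"])
    show "h holomorphic_on ball 0 1" if "h \<in> H" for h
      using that by (auto simp: H_def bergman_space_def intro!: holomorphic_higher_deriv)
    show "\<exists>B. \<forall>h\<in>H. \<forall>z\<in>S. norm (h z) \<le> B" if S: "compact S" "S \<subseteq> ball 0 1" for S
    proof -
      obtain r where r: "0 \<le> r" "r < 1" "S \<subseteq> cball 0 r" using compact_subset_disc[OF S] .
      obtain M where M: "\<And>f z. f \<in> bergman_space p \<omega> \<Longrightarrow> bergman_norm p \<omega> f \<le> 1 \<Longrightarrow> norm z \<le> r \<Longrightarrow> norm ((deriv ^^ n) f z) \<le> M"
        using norm_deriv_locally_bounded[OF pq r(1,2), where n=n] by blast
      then show ?thesis using r(3) by (intro exI[of _ M]) (auto simp: H_def)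
    qed
  qed (use F in \<open>auto simp: H_def\<close>)
  define G where "G z = (if norm z \<le> r then g z else 0)" for z
  have gm: "g \<in> borel_measurable \<mu>"
    using g(1) by (intro borel_measure_on_disc_continuous[OF \<mu>] holomorphic_on_imp_continuous_on)
  have Gm: "G \<in> borel_measurable \<mu>"
    unfolding G_def[abs_def] by (rule truncated_measurable[OF \<mu> gm])
  have cont: "continuous_on (cball 0 r) g"
    using g(1) r by (intro continuous_on_subset[OF holomorphic_on_imp_continuous_on]) auto
  then have "bounded (g ` cball 0 r)"
    by (intro compact_imp_bounded compact_continuous_image) auto
  then obtain M where "0 < M" and M': "\<forall>z\<in>cball 0 r. norm (g z) \<le> M"
    by (auto simp: bounded_pos)
  then have M: "\<And>z. norm z \<le> r \<Longrightarrow> norm (g z) \<le> M" "0 < M"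
    by auto
  have "norm (G z) powr q \<le> M powr q" for z
    using M pq by (intro powr_mono2) (auto simp: G_def)
  then have "integrable \<mu> (\<lambda>z. norm (G z) powr q)"
    using Gm by (intro integrable_const_bound[where B="M powr q"] AE_I2) auto
  then have GL: "G \<in> Lq_space \<mu> q" using Gm by (simp add: Lq_space_def)
  define m where "m = measure \<mu> (space \<mu>) powr (1 / q)"
  have ev: "eventually (\<lambda>k. Lq_norm \<mu> q (\<lambda>z. truncated_diff n r (F (\<rho> k)) z - G z) \<le> \<delta> * m) sequentially"
    if \<delta>: "0 < \<delta>" for \<delta>
  proof -
    have "eventually (\<lambda>k. \<forall>z\<in>cball 0 r. dist (((\<lambda>k. (deriv ^^ n) (F k)) \<circ> \<rho>) k z) (g z) < \<delta>) sequentially"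
      using r by (intro uniform_limitD[OF lim \<delta>]) auto
    then show ?thesis
    proof eventually_elim
      case (elim k)
      have le: "norm (truncated_diff n r (F (\<rho> k)) z - G z) powr q \<le> \<delta> powr q" for z
        using elim \<delta> pq by (intro powr_mono2) (auto simp: truncated_diff_def G_def dist_norm less_imp_le)
      have "(\<integral>z. norm (truncated_diff n r (F (\<rho> k)) z - G z) powr q \<partial>\<mu>) \<le> (\<integral>z. \<delta> powr q \<partial>\<mu>)"
        using le by (intro integral_mono') auto
      also have "\<dots> = measure \<mu> (space \<mu>) * \<delta> powr q" by simp
      finally have "Lq_norm \<mu> q (\<lambda>z. truncated_diff n r (F (\<rho> k)) z - G z) \<le> (measure \<mu> (space \<mu>) * \<delta> powr q) powr (1 / q)"
        unfolding Lq_norm_def using pq by (intro powr_mono2) (auto intro: integral_nonneg_AE)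
      also have "\<dots> = \<delta> * m" using \<delta> pq by (simp add: m_def powr_mult powr_powr)
      finally show ?case .
    qed
  qed
  have "(\<lambda>k. Lq_norm \<mu> q (\<lambda>z. truncated_diff n r (F (\<rho> k)) z - G z)) \<longlonglongrightarrow> 0"
  proof (rule tendstoI)
    fix e :: real assume e: "0 < e"
    have m0: "0 \<le> m" by (simp add: m_def)
    \<comment> \<open>m is the norm of the constant 1 and may be 0, hence the division by m +
      1.\<close>
    have "e / (m + 1) * m < e" using e m0 by (simp add: field_simps)
    moreover have "0 < e / (m + 1)" using e m0 by simp
    ultimately show "\<forall>\<^sub>F k in sequentially. dist (Lq_norm \<mu> q (\<lambda>z. truncated_diff n r (F (\<rho> k)) z - G z)) 0 < e"
      using ev[of "e / (m + 1)"] by (auto simp: Lq_norm_nonneg dist_norm elim!: eventually_mono)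
  qed
  then show "\<exists>\<rho> g. strict_mono \<rho> \<and> g \<in> Lq_space \<mu> q \<and> (\<lambda>k. Lq_norm \<mu> q (\<lambda>z. truncated_diff n r (F (\<rho> k)) z - g z)) \<longlonglongrightarrow> 0"
    using g(2) GL by blast
qed

text \<open>\<open>\<Lambda>\<close> ranges over the extended reals because it will be a supremum of
  quotients that is not known to be finite; an infinite value makes the claim trivial.\<close>

lemma essential_norm_le_carleson:
  assumes \<mu>: "borel_measure_on_disc \<mu>" and T: "bounded_op p \<omega> \<mu> q (diff_op n)" and pq: "1 < p" "p \<le> q"
    and r: "0 \<le> r" "r < 1" and s: "0 < s"
    and \<Lambda>: "\<And>\<zeta>. norm \<zeta> < 1 \<Longrightarrow> 1 - norm \<zeta> \<le> 2 * (1 - r) \<Longrightarrow> emeasure \<mu> (pseudo_hyp_disc s \<zeta>) \<le> \<Lambda> * ennreal (size_gauge n p q \<zeta>)"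
  defines "c \<equiv> deriv_const p n powr (q / p) * 4 powr (q / p - 1) * carleson_const n p q s"
  shows "ennreal (essential_norm p \<omega> \<mu> q (diff_op n) powr q) \<le> ennreal c * \<Lambda>"
proof (cases "\<Lambda> = \<infinity>")
  case True
  have "0 < c" using deriv_const_pos[of p n] carleson_const_pos[OF s, of n p q] by (simp add: c_def)
  then show ?thesis using True by (simp add: ennreal_mult_top)
next
  case False
  then obtain l where l: "0 \<le> l" "\<Lambda> = ennreal l" by (cases \<Lambda>) auto
  have c: "0 \<le> c" using carleson_const_pos[OF s, of n p q] by (simp add: c_def)
  have fin: "finite_measure \<mu>"
    using pq by (intro finite_measure_of_bounded_diff_op[OF \<mu> T]) auto
  note sets = \<mu>[unfolded borel_measure_on_disc_def]
  note K = compact_op_truncated_diff[OF \<mu> T pq r]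
  let ?D = "\<lambda>f z. diff_op n f z - truncated_diff n r f z"
  have "Lq_norm \<mu> q (?D f) \<le> (c * l) powr (1 / q)" if f: "f \<in> bergman_space p \<omega>" "bergman_norm p \<omega> f \<le> 1" for f
  proof -
    define N where "N = (\<integral>w. norm (f w) powr p \<partial>wA \<omega>)"
    have N: "0 \<le> N" "N \<le> 1"
      using f(2) pq bergman_norm_le_1_iff[of p \<omega> f] by (auto simp: N_def intro: integral_nonneg_AE)
    then have N': "N powr (q / p) \<le> 1" using pq by (intro powr_le1) auto
    have Lq: "?D f \<in> Lq_space \<mu> q"
      using T compact_op_bounded[OF K] f(1) pq by (intro Lq_space_diff(1)) (auto simp: bounded_op_def)
    have "ennreal (\<integral>z. norm (?D f z) powr q \<partial>\<mu>) = (\<integral>\<^sup>+z. ennreal (norm (?D f z) powr q) \<partial>\<mu>)"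
      using Lq by (intro nn_integral_eq_integral[symmetric]) (auto simp: Lq_space_def)
    also have "\<dots> = (\<integral>\<^sup>+z. ennreal (norm ((deriv ^^ n) f z) powr q) * indicator {z. r < norm z} z \<partial>\<mu>)"
      by (intro nn_integral_cong) (auto simp: diff_op_def truncated_diff_def split: split_indicator)
    also have "\<dots> \<le> ennreal (c * N powr (q / p)) * \<Lambda>"
      unfolding c_def N_def by (rule carleson_embedding[OF sets fin s pq \<Lambda> f(1)])
    also have "\<dots> = ennreal (c * N powr (q / p) * l)"
      using l c by (simp add: ennreal_mult)
    finally have "(\<integral>z. norm (?D f z) powr q \<partial>\<mu>) \<le> c * N powr (q / p) * l"
      using l c by (simp add: ennreal_le_iff)
    also have "\<dots> \<le> c * 1 * l" using c l N' by (intro mult_right_mono mult_left_mono) auto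
    finally show ?thesis
      unfolding Lq_norm_def using pq by (intro powr_mono2) (auto intro: integral_nonneg_AE)
  qed
  then have "op_norm p \<omega> \<mu> q ?D \<le> (c * l) powr (1 / q)"
    unfolding op_norm_def using zero_in_bergman[of p \<omega>] pq
    by (intro cSup_least) (auto intro!: exI[of _ "\<lambda>_. 0"])
  then have "essential_norm p \<omega> \<mu> q (diff_op n) \<le> (c * l) powr (1 / q)"
    using essential_norm_le[OF T K] pq by simp
  then have "essential_norm p \<omega> \<mu> q (diff_op n) powr q \<le> ((c * l) powr (1 / q)) powr q"
    using essential_norm_nonneg[OF T K] pq by (intro powr_mono2) auto
  also have "\<dots> = c * l" using c l pq by (simp add: powr_powr)
  finally show ?thesis using c l by (simp add: ennreal_mult[symmetric] ennreal_leI)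
qed

end

section \<open>Compact operators on locally null sequences\<close>

text \<open>Convexity applied to x + y = t(x/t) + (1-t)(y/(1-t)). For t near 1 the coefficient of
  x^p is as close to 1 as desired, at the price of a large one for y^p.\<close>

lemma powr_add_le_split:
  fixes x y t p :: real
  assumes "0 \<le> x" "0 \<le> y" "0 < t" "t < 1" "1 < p"
  shows "(x + y) powr p \<le> t powr (1 - p) * x powr p + (1 - t) powr (1 - p) * y powr p"
proof -
  define m where "m = x + y"
  have scale: "u * (v / u) powr p = u powr (1 - p) * v powr p" if "0 < u" "0 \<le> v" for u v
    using that by (simp add: powr_divide powr_diff)
  have "m powr p = t * (m powr p + p * m powr (p - 1) * (x / t - m)) + (1 - t) * (m powr p + p * m powr (p - 1) * (y / (1 - t) - m))"
  proof -
    have "t * (x / t - m) = x - t * m" "(1 - t) * (y / (1 - t) - m) = y - (1 - t) * m"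
      using assms by (simp_all add: right_diff_distrib)
    then have "t * (x / t - m) + (1 - t) * (y / (1 - t) - m) = 0"
      by (simp add: m_def algebra_simps)
    moreover have "t * (m powr p + p * m powr (p - 1) * (x / t - m)) + (1 - t) * (m powr p + p * m powr (p - 1) * (y / (1 - t) - m))
        = m powr p + p * m powr (p - 1) * (t * (x / t - m) + (1 - t) * (y / (1 - t) - m))"
      by (simp add: algebra_simps)
    ultimately show ?thesis by simp
  qed
  also have "\<dots> \<le> t * (x / t) powr p + (1 - t) * (y / (1 - t)) powr p"
    using assms by (intro add_mono mult_left_mono powr_tangent) (auto simp: m_def)
  also have "\<dots> = t powr (1 - p) * x powr p + (1 - t) powr (1 - p) * y powr p"
    using assms by (simp only: scale)
  finally show ?thesis by (simp add: m_def)
qed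

lemma powr_mean_le:
  fixes x :: "nat \<Rightarrow> real"
  assumes "\<And>i. i < N \<Longrightarrow> 0 \<le> x i" "0 < N" "1 < q"
  shows "((\<Sum>i<N. x i) / N) powr q \<le> (\<Sum>i<N. x i powr q) / N"
proof -
  define m where "m = (\<Sum>i<N. x i) / N"
  have m: "0 \<le> m" using assms by (auto simp: m_def intro!: sum_nonneg divide_nonneg_nonneg)
  have "(\<Sum>i<N. m powr q + q * m powr (q - 1) * (x i - m)) \<le> (\<Sum>i<N. x i powr q)"
    using assms m by (intro sum_mono powr_tangent) auto
  also have "(\<Sum>i<N. m powr q + q * m powr (q - 1) * (x i - m)) = N * m powr q + q * m powr (q - 1) * ((\<Sum>i<N. x i) - N * m)"
    by (simp add: sum.distrib sum_distrib_left[symmetric] sum_subtractf)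
  also have "(\<Sum>i<N. x i) - N * m = 0" using assms by (simp add: m_def)
  finally show ?thesis using assms by (simp add: m_def field_simps)
qed

definition locally_null :: "(nat \<Rightarrow> complex \<Rightarrow> complex) \<Rightarrow> bool" where
  "locally_null F \<longleftrightarrow> (\<forall>\<rho><1. \<forall>e>0. \<exists>J. \<forall>j\<ge>J. \<forall>z. norm z \<le> \<rho> \<longrightarrow> norm (F j z) \<le> e)"

lemma locally_null_subseq: "locally_null F \<Longrightarrow> strict_mono r \<Longrightarrow> locally_null (\<lambda>k. F (r k))"
  unfolding locally_null_def by (meson le_trans seq_suble)

context radial
begin

lemma bergman_add:
  assumes "f \<in> bergman_space p \<omega>" "g \<in> bergman_space p \<omega>" "1 < p"
  shows "(\<lambda>w. f w + g w) \<in> bergman_space p \<omega>"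
proof -
  have hol: "f holomorphic_on ball 0 1" "g holomorphic_on ball 0 1"
    and i: "integrable (wA \<omega>) (\<lambda>z. norm (f z) powr p)" "integrable (wA \<omega>) (\<lambda>z. norm (g z) powr p)"
    using assms by (auto simp: bergman_space_def)
  have h: "(\<lambda>w. f w + g w) holomorphic_on ball 0 1" using hol by (intro holomorphic_intros)
  have m: "(\<lambda>w. f w + g w) \<in> borel_measurable (wA \<omega>)" using h by (rule holomorphic_measurable_wA)
  have "integrable (wA \<omega>) (\<lambda>z. norm (f z + g z) powr p)"
  proof (rule Bochner_Integration.integrable_bound)
    show "integrable (wA \<omega>) (\<lambda>z. 2 powr p * (norm (f z) powr p + norm (g z) powr p))" using i by auto
    show "AE z in wA \<omega>. norm (norm (f z + g z) powr p) \<le> norm (2 powr p * (norm (f z) powr p + norm (g z) powr p))"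
      using powr_norm_diff_le[of p "f _" "- g _"] assms by auto
  qed (use m in auto)
  then show ?thesis using h by (simp add: bergman_space_def)
qed

lemma integral_tail_small:
  assumes int: "integrable (wA \<omega>) u" and e: "0 < e"
  obtains \<rho> :: real where "0 \<le> \<rho>" "\<rho> < 1" "(\<integral>z. indicator {z. \<rho> < norm z} z * u z \<partial>wA \<omega>) < (e::real)"
proof -
  define \<rho> where "\<rho> k = 1 - 1 / real (Suc k)" for k
  have [measurable]: "(\<lambda>x. x) \<in> borel_measurable (wA \<omega>)" by (rule ident_measurable_wA)
  have um [measurable]: "u \<in> borel_measurable (wA \<omega>)" using int by auto
  have "(\<lambda>k. \<integral>z. indicator {z. \<rho> k < norm z} z * u z \<partial>wA \<omega>) \<longlonglongrightarrow> (\<integral>z. 0 \<partial>wA \<omega>)"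
  proof (rule integral_dominated_convergence[where w="\<lambda>z. norm (u z)"])
    show "AE z in wA \<omega>. (\<lambda>k. indicator {z. \<rho> k < norm z} z * u z) \<longlonglongrightarrow> 0"
    proof (rule AE_I2)
      fix z assume "z \<in> space (wA \<omega>)"
      then have z: "norm z < 1" by simp
      have "\<rho> \<longlonglongrightarrow> 1 - 0"
        unfolding \<rho>_def by (intro tendsto_diff tendsto_const) (use LIMSEQ_inverse_real_of_nat in \<open>simp add: inverse_eq_divide\<close>)
      then have "eventually (\<lambda>k. norm z < \<rho> k) sequentially"
        using z by (intro order_tendstoD(1)[where y=1]) auto
      then have "eventually (\<lambda>k. indicator {z. \<rho> k < norm z} z * u z = 0) sequentially"
        by eventually_elim auto
      then show "(\<lambda>k. indicator {z. \<rho> k < norm z} z * u z) \<longlonglongrightarrow> 0" by (rule tendsto_eventually)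
    qed
    show "AE z in wA \<omega>. norm (indicator {z. \<rho> k < norm z} z * u z) \<le> norm (u z)" for k
      by (intro AE_I2) (auto split: split_indicator)
    show "(\<lambda>z. indicator {z. \<rho> k < norm z} z * u z) \<in> borel_measurable (wA \<omega>)" for k
      unfolding indicator_def of_bool_def mem_Collect_eq by measurable
  qed (use int in auto)
  then have "eventually (\<lambda>k. (\<integral>z. indicator {z. \<rho> k < norm z} z * u z \<partial>wA \<omega>) < e) sequentially"
    using e by (intro order_tendstoD(2)[where y=0]) auto
  then obtain k where "(\<integral>z. indicator {z. \<rho> k < norm z} z * u z \<partial>wA \<omega>) < e"
    by (auto simp: eventually_sequentially)
  moreover have "0 \<le> \<rho> k" "\<rho> k < 1" by (auto simp: \<rho>_def)
  ultimately show ?thesis using that by blast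
qed

text \<open>The step of the sliding hump: G has little mass beyond some \<rho>, and F j is small
  inside \<rho> for large j, so the integrals of p-th powers nearly add. Of the increment 2, one
  unit is the integral of |F j|^p, the other pays for the errors.\<close>

lemma integral_add_locally_null:
  assumes p: "1 < p" and G: "G \<in> bergman_space p \<omega>"
    and F: "\<And>j. F j \<in> bergman_space p \<omega>" "\<And>j. (\<integral>z. norm (F j z) powr p \<partial>wA \<omega>) \<le> 1" "locally_null F"
  obtains J where "\<And>j. j \<ge> J \<Longrightarrow> (\<integral>z. norm (G z + F j z) powr p \<partial>wA \<omega>) \<le> (\<integral>z. norm (G z) powr p \<partial>wA \<omega>) + 2"
proof -
  interpret finite_measure "wA \<omega>" by (rule finite_measure_wA)
  have [measurable]: "(\<lambda>x. x) \<in> borel_measurable (wA \<omega>)" by (rule ident_measurable_wA)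
  define M where "M = (\<integral>z. norm (G z) powr p \<partial>wA \<omega>)"
  have M: "0 \<le> M" by (auto simp: M_def intro: integral_nonneg_AE)
  have iG: "integrable (wA \<omega>) (\<lambda>z. norm (G z) powr p)" and iF: "integrable (wA \<omega>) (\<lambda>z. norm (F j z) powr p)" for j
    using G F by (auto simp: bergman_space_def)
  have mF [measurable]: "F j \<in> borel_measurable (wA \<omega>)" and mG [measurable]: "G \<in> borel_measurable (wA \<omega>)" for j
    using F G by (auto simp: bergman_space_def intro!: holomorphic_measurable_wA)
  \<comment> \<open>Chosen so that t^(1-p)(M+1) = M + 3/2: the main terms lose 1/2, and 1/4 is left
    for each of the two remainders.\<close>
  define t where "t = ((M + 3/2) / (M + 1)) powr (1 / (1 - p))"
  have b: "1 < (M + 3/2) / (M + 1)" using M by simp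
  have t: "0 < t" "t < 1"
    using b M p unfolding t_def by (auto intro!: powr_less_one)
  have tp: "t powr (1 - p) = (M + 3/2) / (M + 1)"
    using b p M by (simp add: t_def powr_powr)
  define c where "c = (1 - t) powr (1 - p)"
  have c: "0 < c" using t by (simp add: c_def)
  obtain \<rho> where \<rho>: "0 \<le> \<rho>" "\<rho> < 1" and tail: "(\<integral>z. indicator {z. \<rho> < norm z} z * norm (G z) powr p \<partial>wA \<omega>) < 1 / (4 * c)"
    using integral_tail_small[OF iG, of "1 / (4 * c)"] c by auto
  define V where "V = measure (wA \<omega>) (space (wA \<omega>)) + 1"
  have V: "0 < V" by (simp add: V_def add_nonneg_pos)
  \<comment> \<open>With this e, c e^p integrated over the disc is at most 1/4; the summand 1 in
    \<open>V\<close> keeps the divisor positive.\<close>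
  define e where "e = (1 / (4 * c * V)) powr (1 / p)"
  have e: "0 < e" "e powr p = 1 / (4 * c * V)" using c V p by (auto simp: e_def powr_powr)
  obtain J where J: "\<And>j z. j \<ge> J \<Longrightarrow> norm z \<le> \<rho> \<Longrightarrow> norm (F j z) \<le> e"
    using F(3) \<rho> e(1) unfolding locally_null_def by blast
  have "(\<integral>z. norm (G z + F j z) powr p \<partial>wA \<omega>) \<le> M + 2" if j: "j \<ge> J" for j
  proof -
    define A where "A z = indicator {z. \<rho> < norm z} z * norm (G z) powr p" for z
    have iA: "integrable (wA \<omega>) A"
    proof (rule Bochner_Integration.integrable_bound[OF iG])
      show "A \<in> borel_measurable (wA \<omega>)"
        unfolding A_def indicator_def of_bool_def mem_Collect_eq by measurable
    qed (auto simp: A_def split: split_indicator)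
    have pt: "norm (G z + F j z) powr p \<le> (M + 3/2) / (M + 1) * (norm (G z) powr p + norm (F j z) powr p) + c * (1 / (4 * c * V) + A z)" for z
    proof -
      have "norm (G z + F j z) powr p \<le> (norm (G z) + norm (F j z)) powr p"
        using p by (intro powr_mono2 norm_triangle_ineq) auto
      also have "\<dots> \<le> t powr (1 - p) * (norm (G z) powr p + norm (F j z) powr p) + c * (1 / (4 * c * V) + A z)"
      proof (cases "norm z \<le> \<rho>")
        case True
        have "(norm (G z) + norm (F j z)) powr p \<le> t powr (1 - p) * norm (G z) powr p + c * norm (F j z) powr p"
          unfolding c_def using t p by (intro powr_add_le_split) auto
        also have "norm (F j z) powr p \<le> 1 / (4 * c * V)"
          unfolding e(2)[symmetric] using J[OF j True] p by (intro powr_mono2) auto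
        also have "t powr (1 - p) * norm (G z) powr p \<le> t powr (1 - p) * (norm (G z) powr p + norm (F j z) powr p)"
          by (intro mult_left_mono) auto
        finally show ?thesis
          using c True by (simp add: A_def)
      next
        case False
        \<comment> \<open>Beyond \<rho> the roles are exchanged: F j gets the coefficient near 1,
          and G, small in the mean there, gets the large one.\<close>
        have "(norm (F j z) + norm (G z)) powr p \<le> t powr (1 - p) * norm (F j z) powr p + c * norm (G z) powr p"
          unfolding c_def using t p by (intro powr_add_le_split) auto
        also have "\<dots> \<le> t powr (1 - p) * (norm (G z) powr p + norm (F j z) powr p) + c * (1 / (4 * c * V) + A z)"
          using False c V by (intro add_mono mult_left_mono) (auto simp: A_def)
        finally show ?thesis by (simp add: add.commute)
      qed
      finally show ?thesis by (simp only: tp)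
    qed
    have "(\<integral>z. norm (G z + F j z) powr p \<partial>wA \<omega>) \<le> (\<integral>z. (M + 3/2) / (M + 1) * (norm (G z) powr p + norm (F j z) powr p) + c * (1 / (4 * c * V) + A z) \<partial>wA \<omega>)"
      using pt bergman_add[OF G F(1)[of j] p] iG iF[of j] iA
      by (intro integral_mono) (auto simp: bergman_space_def)
    also have "\<dots> = (M + 3/2) / (M + 1) * (M + (\<integral>z. norm (F j z) powr p \<partial>wA \<omega>)) + c * ((V - 1) * (1 / (4 * c * V)) + (\<integral>z. A z \<partial>wA \<omega>))"
      using iG iF[of j] iA by (simp add: M_def V_def)
    also have "\<dots> \<le> (M + 3/2) / (M + 1) * (M + 1) + c * (V * (1 / (4 * c * V)) + 1 / (4 * c))"
      using M F(2)[of j] tail c V by (intro add_mono mult_left_mono mult_right_mono) (auto simp: A_def)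
    also have "\<dots> = M + 2" using M c V by (simp add: field_simps)
    finally show ?thesis .
  qed
  then show ?thesis unfolding M_def by (rule that)
qed

text \<open>S is a sum of N members chosen one after another, each far enough out for the previous
  partial sum. Only its size and its image are recorded, the latter almost everywhere, as
  \<open>compact_op\<close> provides linearity only in that sense. The lower bound l keeps all
  images close to their limit.\<close>

lemma sum_locally_null:
  assumes p: "1 < p" and F: "\<And>j. F j \<in> bergman_space p \<omega>" "\<And>j. (\<integral>z. norm (F j z) powr p \<partial>wA \<omega>) \<le> 1" "locally_null F"
    and K: "\<And>f g a b. f \<in> bergman_space p \<omega> \<Longrightarrow> g \<in> bergman_space p \<omega> \<Longrightarrow>
        AE z in \<mu>. K (\<lambda>w. a * f w + b * g w) z = a * K f z + b * (K g z :: complex)"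
  shows "\<exists>S j. S \<in> bergman_space p \<omega> \<and> (\<integral>z. norm (S z) powr p \<partial>wA \<omega>) \<le> 2 * real N \<and> (\<forall>i. l \<le> j i) \<and>
     (AE z in \<mu>. K S z = (\<Sum>i<N. K (F (j i)) z))"
proof (induction N)
  case 0
  have z: "(\<lambda>_. 0) \<in> bergman_space p \<omega>" using p by (intro zero_in_bergman) auto
  have "AE z in \<mu>. K (\<lambda>_. 0) z = 0" using K[OF z z, of 0 0] by simp
  then show ?case using z p by (intro exI[of _ "\<lambda>_. 0"] exI[of _ "\<lambda>_. l"]) auto
next
  case (Suc N)
  then obtain S j where S: "S \<in> bergman_space p \<omega>" "(\<integral>z. norm (S z) powr p \<partial>wA \<omega>) \<le> 2 * real N"
    "\<And>i. l \<le> j i" "AE z in \<mu>. K S z = (\<Sum>i<N. K (F (j i)) z)" by blast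
  obtain J where J: "\<And>j. j \<ge> J \<Longrightarrow> (\<integral>z. norm (S z + F j z) powr p \<partial>wA \<omega>) \<le> (\<integral>z. norm (S z) powr p \<partial>wA \<omega>) + 2"
    using integral_add_locally_null[OF p S(1) F] by blast
  define k where "k = max J l"
  define S' where "S' w = S w + F k w" for w
  have "AE z in \<mu>. K S' z = K S z + K (F k) z"
    using K[OF S(1) F(1)[of k], of 1 1] by (simp add: S'_def[abs_def])
  then have "AE z in \<mu>. K S' z = (\<Sum>i<Suc N. K (F ((j(N := k)) i)) z)"
    using S(4)
  proof eventually_elim
    case (elim z)
    have "(\<Sum>i<N. K (F ((j(N := k)) i)) z) = (\<Sum>i<N. K (F (j i)) z)" by (intro sum.cong) auto
    then show ?case using elim by simp
  qed
  moreover have "S' \<in> bergman_space p \<omega>" unfolding S'_def by (rule bergman_add[OF S(1) F(1) p])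
  moreover have "(\<integral>z. norm (S' z) powr p \<partial>wA \<omega>) \<le> 2 * real (Suc N)"
    using J[of k] S(2) by (simp add: S'_def k_def)
  ultimately show ?case using S(3)
    by (intro exI[of _ S'] exI[of _ "j(N := k)"]) (auto simp: k_def)
qed

text \<open>Compactness gives a subsequence whose images converge to some g; the work lies in
  showing g = 0, by comparing g with means of images far out in that subsequence.\<close>

lemma compact_op_locally_null:
  assumes pq: "1 < p" "p \<le> q" and K: "compact_op p \<omega> \<mu> q K"
    and F: "\<And>j. F j \<in> bergman_space p \<omega>" "\<And>j. (\<integral>z. norm (F j z) powr p \<partial>wA \<omega>) \<le> 1" "locally_null F"
  obtains r :: "nat \<Rightarrow> nat" where "strict_mono r" "(\<lambda>k. \<integral>z. norm (K (F (r k)) z) powr q \<partial>\<mu>) \<longlonglongrightarrow> 0"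
proof -
  have bd: "bounded_op p \<omega> \<mu> q K" using K by (rule compact_op_bounded)
  have lin: "\<And>f g a b. f \<in> bergman_space p \<omega> \<Longrightarrow> g \<in> bergman_space p \<omega> \<Longrightarrow>
        AE z in \<mu>. K (\<lambda>w. a * f w + b * g w) z = a * K f z + b * K g z"
    using K unfolding compact_op_def by blast
  have cpt: "\<forall>F::nat \<Rightarrow> complex \<Rightarrow> complex. (\<forall>k. F k \<in> bergman_space p \<omega> \<and> bergman_norm p \<omega> (F k) \<le> 1) \<longrightarrow>
        (\<exists>r g. strict_mono r \<and> g \<in> Lq_space \<mu> q \<and> (\<lambda>k. Lq_norm \<mu> q (\<lambda>z. K (F (r k)) z - g z)) \<longlonglongrightarrow> 0)"
    using K unfolding compact_op_def by (elim conjE)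
  have p0: "0 < p" and q1: "1 < q" and q0: "0 < q" using pq by auto
  have nF: "\<forall>k. F k \<in> bergman_space p \<omega> \<and> bergman_norm p \<omega> (F k) \<le> 1"
    using F(1,2) bergman_norm_le_1_iff[OF p0] by simp
  obtain r g where r: "strict_mono r" and g: "g \<in> Lq_space \<mu> q"
    and lim: "(\<lambda>k. Lq_norm \<mu> q (\<lambda>z. K (F (r k)) z - g z)) \<longlonglongrightarrow> 0"
    using spec[OF cpt, of F, THEN mp, OF nF] by blast
  obtain C where C: "\<And>f. f \<in> bergman_space p \<omega> \<Longrightarrow> K f \<in> Lq_space \<mu> q"
      "\<And>f. f \<in> bergman_space p \<omega> \<Longrightarrow> Lq_norm \<mu> q (K f) \<le> C * bergman_norm p \<omega> f"
    using bd by (auto simp: bounded_op_def)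
  define D where "D k = (\<integral>z. norm (K (F (r k)) z - g z) powr q \<partial>\<mu>)" for k
  have "(\<lambda>k. Lq_norm \<mu> q (\<lambda>z. K (F (r k)) z - g z) powr q) \<longlonglongrightarrow> 0 powr q"
    using lim q0 by (intro tendsto_powr2) (auto simp: Lq_norm_nonneg)
  then have D: "D \<longlonglongrightarrow> 0" using q0 by (simp add: Lq_norm_powr D_def[abs_def])
  have g0: "(\<integral>z. norm (g z) powr q \<partial>\<mu>) \<le> 0"
  proof (rule field_le_epsilon)
    fix \<epsilon> :: real assume \<epsilon>: "0 < \<epsilon>"
    \<comment> \<open>Makes 2^q(e + e) equal to \<epsilon> in the final quasi-triangle
      inequality.\<close>
    define e where "e = \<epsilon> / (2 * 2 powr q)"
    have e: "0 < e" using \<epsilon> by (simp add: e_def)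
    obtain J0 where J0: "\<And>k. k \<ge> J0 \<Longrightarrow> D k < e"
      using order_tendstoD(2)[OF D e] by (auto simp: eventually_sequentially)
    \<comment> \<open>The image of S has norm at most C(2N)^(1/p); after division by N its q-th
      power is of order N^(q/p-q), which tends to 0 since p > 1.\<close>
    have "(\<lambda>N. \<bar>C\<bar> powr q * 2 powr (q / p) * real N powr (q / p - q)) \<longlonglongrightarrow> \<bar>C\<bar> powr q * 2 powr (q / p) * 0"
    proof (intro tendsto_mult tendsto_const tendsto_neg_powr filterlim_real_sequentially)
      have "q / p < q" using pq by (simp add: divide_less_eq)
      then show "q / p - q < 0" by simp
    qed
    then have "eventually (\<lambda>N. \<bar>C\<bar> powr q * 2 powr (q / p) * real N powr (q / p - q) < e) sequentially"
      using e by (intro order_tendstoD(2)[where y=0]) auto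
    then obtain N where N: "0 < N" "\<bar>C\<bar> powr q * 2 powr (q / p) * real N powr (q / p - q) < e"
      unfolding eventually_sequentially by (metis le_add1 le_add2 less_le_trans zero_less_one)
    have Fr: "\<And>j. F (r j) \<in> bergman_space p \<omega>" "\<And>j. (\<integral>z. norm (F (r j) z) powr p \<partial>wA \<omega>) \<le> 1"
      "locally_null (\<lambda>j. F (r j))"
      using F r by (auto intro: locally_null_subseq)
    obtain S j where S: "S \<in> bergman_space p \<omega>" "(\<integral>z. norm (S z) powr p \<partial>wA \<omega>) \<le> 2 * real N"
      "\<And>i. J0 \<le> j i" "AE z in \<mu>. K S z = (\<Sum>i<N. K (F (r (j i))) z)"
      using sum_locally_null[where F="\<lambda>j. F (r j)" and K=K and l=J0 and N=N, OF pq(1) Fr lin] by blast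
    \<comment> \<open>u is the mean of the N images: small by the norm bound on S, and close to g
      because every index is at least J0.\<close>
    define u where "u z = K S z / of_nat N" for z
    have iKS: "integrable \<mu> (\<lambda>z. norm (K S z) powr q)" and mKS: "K S \<in> borel_measurable \<mu>"
      using C(1)[OF S(1)] by (auto simp: Lq_space_def)
    have un: "norm (u z) powr q = norm (K S z) powr q / real N powr q" for z
      by (simp add: u_def norm_divide powr_divide)
    have uL: "u \<in> Lq_space \<mu> q"
    proof -
      have "integrable \<mu> (\<lambda>z. norm (u z) powr q)" unfolding un using iKS by simp
      moreover have "u \<in> borel_measurable \<mu>" unfolding u_def[abs_def] using mKS by measurable
      ultimately show ?thesis by (simp add: Lq_space_def)
    qed
    have "(\<integral>z. norm (K S z) powr q \<partial>\<mu>) = Lq_norm \<mu> q (K S) powr q" using q0 by (simp add: Lq_norm_powr)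
    also have "\<dots> \<le> (\<bar>C\<bar> * (2 * real N) powr (1 / p)) powr q"
    proof (rule powr_mono2)
      have "bergman_norm p \<omega> S \<le> (2 * real N) powr (1 / p)"
        unfolding bergman_norm_def using S(2) p0 by (intro powr_mono2) (auto intro: integral_nonneg_AE)
      then have "C * bergman_norm p \<omega> S \<le> \<bar>C\<bar> * (2 * real N) powr (1 / p)"
        using bergman_norm_nonneg[of p \<omega> S] by (intro mult_mono) auto
      then show "Lq_norm \<mu> q (K S) \<le> \<bar>C\<bar> * (2 * real N) powr (1 / p)"
        using C(2)[OF S(1)] by simp
    qed (use q0 in \<open>auto simp: Lq_norm_nonneg\<close>)
    also have "\<dots> = \<bar>C\<bar> powr q * 2 powr (q / p) * real N powr (q / p)"
      by (simp add: powr_mult powr_powr)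
    finally have "(\<integral>z. norm (u z) powr q \<partial>\<mu>) \<le> \<bar>C\<bar> powr q * 2 powr (q / p) * real N powr (q / p) / real N powr q"
      unfolding un by (simp add: divide_right_mono)
    also have "\<dots> < e" using N by (simp add: powr_diff)
    finally have u1: "(\<integral>z. norm (u z) powr q \<partial>\<mu>) \<le> e" by simp
    have diffL: "(\<lambda>z. K (F (r (j i))) z - g z) \<in> Lq_space \<mu> q" for i
      using C(1)[OF F(1)] g q0 by (intro Lq_space_diff(1)) auto
    have u2: "(\<integral>z. norm (u z - g z) powr q \<partial>\<mu>) \<le> e"
    proof -
      have "(\<integral>z. norm (u z - g z) powr q \<partial>\<mu>) \<le> (\<integral>z. (\<Sum>i<N. norm (K (F (r (j i))) z - g z) powr q) / N \<partial>\<mu>)"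
      proof (rule integral_mono_AE)
        show "integrable \<mu> (\<lambda>z. norm (u z - g z) powr q)"
          using Lq_space_diff(1)[OF uL g] q0 by (simp add: Lq_space_def)
        show "integrable \<mu> (\<lambda>z. (\<Sum>i<N. norm (K (F (r (j i))) z - g z) powr q) / N)"
          using diffL by (auto simp: Lq_space_def)
        show "AE z in \<mu>. norm (u z - g z) powr q \<le> (\<Sum>i<N. norm (K (F (r (j i))) z - g z) powr q) / N"
          using S(4)
        proof eventually_elim
          case (elim z)
          have "u z - g z = (\<Sum>i<N. K (F (r (j i))) z - g z) / of_nat N"
            using N(1) by (simp add: u_def elim sum_subtractf diff_divide_distrib)
          then have "norm (u z - g z) = norm (\<Sum>i<N. K (F (r (j i))) z - g z) / real N"
            by (simp add: norm_divide)
          also have "\<dots> \<le> (\<Sum>i<N. norm (K (F (r (j i))) z - g z)) / real N"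
            by (intro divide_right_mono norm_sum) auto
          finally have "norm (u z - g z) powr q \<le> ((\<Sum>i<N. norm (K (F (r (j i))) z - g z)) / real N) powr q"
            using q0 by (intro powr_mono2) auto
          also have "\<dots> \<le> (\<Sum>i<N. norm (K (F (r (j i))) z - g z) powr q) / N"
            using N(1) q1 by (intro powr_mean_le) auto
          finally show ?case .
        qed
      qed
      also have "\<dots> = (\<Sum>i<N. D (j i)) / N"
        using diffL by (simp add: D_def Lq_space_def)
      also have "\<dots> \<le> (\<Sum>i<N. e) / N"
        using J0[OF S(3)] by (intro divide_right_mono sum_mono) (auto intro: less_imp_le)
      also have "\<dots> = e" using N(1) by simp
      finally show ?thesis .
    qed
    have "(\<integral>z. norm (g z) powr q \<partial>\<mu>) = (\<integral>z. norm (u z - (u z - g z)) powr q \<partial>\<mu>)" by simp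
    also have "\<dots> \<le> 2 powr q * (e + e)"
    proof -
      have "(\<lambda>z. u z - g z) \<in> Lq_space \<mu> q" using Lq_space_diff(1)[OF uL g] q0 by simp
      from Lq_space_diff(2)[OF uL this] q0
      have "(\<integral>z. norm (u z - (u z - g z)) powr q \<partial>\<mu>)
          \<le> 2 powr q * ((\<integral>z. norm (u z) powr q \<partial>\<mu>) + (\<integral>z. norm (u z - g z) powr q \<partial>\<mu>))" by simp
      also have "\<dots> \<le> 2 powr q * (e + e)" using u1 u2 by (intro mult_left_mono add_mono) auto
      finally show ?thesis .
    qed
    also have "\<dots> = \<epsilon>" by (simp add: e_def)
    finally show "(\<integral>z. norm (g z) powr q \<partial>\<mu>) \<le> 0 + \<epsilon>" by simp
  qed
  have "(\<integral>z. norm (K (F (r k)) z) powr q \<partial>\<mu>) \<le> 2 powr q * D k" for k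
  proof -
    have d: "(\<lambda>z. g z - K (F (r k)) z) \<in> Lq_space \<mu> q"
      using C(1)[OF F(1)] g q0 by (intro Lq_space_diff(1)) auto
    have "(\<integral>z. norm (g z - (g z - K (F (r k)) z)) powr q \<partial>\<mu>)
        \<le> 2 powr q * ((\<integral>z. norm (g z) powr q \<partial>\<mu>) + (\<integral>z. norm (g z - K (F (r k)) z) powr q \<partial>\<mu>))"
      using q0 by (intro Lq_space_diff(2)[OF g d]) auto
    also have "\<dots> \<le> 2 powr q * (0 + D k)"
      using g0 by (intro mult_left_mono add_mono) (auto simp: D_def norm_minus_commute[of "g _"])
    finally show ?thesis by simp
  qed
  note le = this
  have "(\<lambda>k. 2 powr q * D k) \<longlonglongrightarrow> 0"
    using tendsto_mult_left[OF D, of "2 powr q"] by simp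
  then have "(\<lambda>k. \<integral>z. norm (K (F (r k)) z) powr q \<partial>\<mu>) \<longlonglongrightarrow> 0"
    by (rule tendsto_sandwich[OF _ _ tendsto_const, rotated 2]) (auto intro: integral_nonneg_AE always_eventually le)
  with r show ?thesis by (rule that)
qed

end

section \<open>Test functions\<close>

lemma norm_mult_less_1:
  fixes a z :: complex
  assumes "norm a < 1" "norm z < 1"
  shows "norm a * norm z < 1"
  using mult_strict_mono'[OF assms] by simp

lemma norm_one_minus_cnj_ge:
  assumes "norm a < 1"
  shows "1 - norm a * norm z \<le> norm (1 - cnj a * z)"
  using norm_triangle_ineq2[of 1 "cnj a * z"] by (simp add: norm_mult)

text \<open>The circle formula needs |w| < 1, whereas here w = 1. Everything is scaled by 1/2, which
  changes both sides by the factor 4.\<close>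

lemma nn_integral_inverse_square_one_minus:
  assumes "norm a < 1" "norm z < 1"
  shows "(\<integral>\<^sup>+x. ennreal (1 / (norm (1 - cnj a * (z * cis (2 * pi * x))))\<^sup>2) * indicator {0..1} x \<partial>lborel)
    = ennreal (1 / (1 - (norm a * norm z)\<^sup>2))"
proof -
  have az: "norm a * norm z < 1"
    using assms by (rule norm_mult_less_1)
  define \<zeta> where "\<zeta> = (1/2) * (cnj a * z)"
  have half: "norm (1/2 - \<zeta> * cis t) = (1/2) * norm (1 - cnj a * (z * cis t))" for t
  proof -
    have "1/2 - \<zeta> * cis t = (1/2) * (1 - cnj a * (z * cis t))" by (simp add: \<zeta>_def algebra_simps)
    then show ?thesis by (simp only: norm_mult norm_divide norm_one norm_numeral)
  qed
  have e: "1 / (norm (1/2 - \<zeta> * cis t))\<^sup>2 = 4 * (1 / (norm (1 - cnj a * (z * cis t)))\<^sup>2)" for t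
    unfolding half by (simp add: power_mult_distrib power_divide)
  have n\<zeta>: "norm \<zeta> = norm a * norm z / 2" by (simp add: \<zeta>_def norm_mult)
  define X where "X x = ennreal (1 / (norm (1 - cnj a * (z * cis (2 * pi * x))))\<^sup>2) * indicator {0..1} x" for x
  have "ennreal (1 / ((norm (1/2::complex))\<^sup>2 - (norm \<zeta>)\<^sup>2)) = (\<integral>\<^sup>+x. ennreal (1 / (norm (1/2 - \<zeta> * cis (2 * pi * x)))\<^sup>2) * indicator {0..1} x \<partial>lborel)"
    using az by (intro nn_integral_inverse_square_rotate[symmetric]) (auto simp: n\<zeta>)
  also have "\<dots> = (\<integral>\<^sup>+x. ennreal 4 * X x \<partial>lborel)"
    unfolding e X_def by (intro nn_integral_cong) (simp only: ennreal_mult' mult.assoc zero_le_numeral)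
  also have "\<dots> = ennreal 4 * (\<integral>\<^sup>+x. X x \<partial>lborel)"
  proof (rule nn_integral_cmult)
    have "(\<lambda>x. 1 - cnj a * (z * cis (2 * pi * x))) \<in> borel_measurable borel"
      unfolding cis_conv_exp by (intro borel_measurable_continuous_onI continuous_intros)
    then show "X \<in> borel_measurable lborel" unfolding X_def[abs_def] by measurable
  qed
  finally have "ennreal 4 * (\<integral>\<^sup>+x. X x \<partial>lborel) = ennreal (1 / (1/4 - (norm a * norm z / 2)\<^sup>2))"
    by (simp add: n\<zeta> power_divide)
  also have "1 / (1/4 - (norm a * norm z / 2)\<^sup>2) = 4 * (1 / (1 - (norm a * norm z)\<^sup>2))"
    by (simp add: power_divide field_simps)
  also have "ennreal (4 * (1 / (1 - (norm a * norm z)\<^sup>2))) = ennreal 4 * ennreal (1 / (1 - (norm a * norm z)\<^sup>2))"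
    using az by (intro ennreal_mult) (auto simp: power_le_one less_imp_le)
  finally have "ennreal (1/4) * (ennreal 4 * (\<integral>\<^sup>+x. X x \<partial>lborel)) = ennreal (1/4) * (ennreal 4 * ennreal (1 / (1 - (norm a * norm z)\<^sup>2)))"
    by simp
  then show ?thesis
    unfolding X_def mult.assoc[symmetric] by (simp add: ennreal_mult[symmetric] del: ennreal_numeral)
qed

text \<open>Write 1 - cnj a z = (1-|a|^2) + cnj a (a-z). The second term is at most s|1 - cnj a z|
  on the disc and is absorbed on the left.\<close>

lemma pseudo_hyp_disc_denominator_le:
  assumes z: "z \<in> pseudo_hyp_disc s a" and a: "norm a < 1" and s: "s < 1"
  shows "norm (1 - cnj a * z) * (1 - s) \<le> 1 - (norm a)\<^sup>2" "0 < norm (1 - cnj a * z)"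
proof -
  have z1: "norm z < 1" and d: "norm (a - z) / norm (1 - cnj a * z) < s"
    using z by (auto simp: pseudo_hyp_disc_def norm_divide)
  have "norm a * norm z < 1"
    using a z1 by (rule norm_mult_less_1)
  then show pos: "0 < norm (1 - cnj a * z)" using norm_one_minus_cnj_ge[OF a, of z] by linarith
  have d': "norm (a - z) \<le> s * norm (1 - cnj a * z)" using d pos by (simp add: field_simps)
  have aa: "cnj a * a = of_real ((norm a)\<^sup>2)"
    using complex_norm_square[of a] by (simp only: mult.commute)
  have "1 - cnj a * z = of_real (1 - (norm a)\<^sup>2) + cnj a * (a - z)"
    by (simp add: right_diff_distrib aa)
  then have "norm (1 - cnj a * z) \<le> norm (complex_of_real (1 - (norm a)\<^sup>2)) + norm (cnj a * (a - z))"
    by (metis norm_triangle_ineq)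
  also have "norm (complex_of_real (1 - (norm a)\<^sup>2)) = 1 - (norm a)\<^sup>2"
    using a by (subst norm_of_real) (simp add: power_le_one abs_of_nonneg)
  also have "norm (cnj a * (a - z)) \<le> 1 * norm (a - z)"
    unfolding norm_mult using a by (intro mult_right_mono) auto
  finally have "norm (1 - cnj a * z) \<le> 1 - (norm a)\<^sup>2 + s * norm (1 - cnj a * z)" using d' by simp
  then show "norm (1 - cnj a * z) * (1 - s) \<le> 1 - (norm a)\<^sup>2" by (simp add: algebra_simps)
qed

text \<open>Each differentiation contributes the current exponent and a factor cnj a; the exponents
  m, m+1, ... multiply to a rising factorial.\<close>

lemma higher_deriv_inverse_power:
  fixes a c :: complex
  assumes a: "norm a < 1" and z: "z \<in> ball 0 1"
  shows "(deriv ^^ n) (\<lambda>z. c * inverse (1 - cnj a * z) ^ m) z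
    = c * of_nat (pochhammer m n) * cnj a ^ n * inverse (1 - cnj a * z) ^ (m + n)"
  using z
proof (induction n arbitrary: z)
  case 0
  then show ?case by simp
next
  case (Suc n)
  have nz: "1 - cnj a * w \<noteq> 0" if "w \<in> ball 0 1" for w
  proof -
    have "norm a * norm w < 1"
      using a that by (intro norm_mult_less_1) auto
    then show ?thesis using norm_one_minus_cnj_ge[OF a, of w] by auto
  qed
  have "((\<lambda>z. c * of_nat (pochhammer m n) * cnj a ^ n * inverse (1 - cnj a * z) ^ (m + n)) has_field_derivative
      c * of_nat (pochhammer m (Suc n)) * cnj a ^ Suc n * inverse (1 - cnj a * z) ^ (m + Suc n)) (at z)"
  proof -
    have u: "((\<lambda>z. inverse (1 - cnj a * z)) has_field_derivative cnj a * (inverse (1 - cnj a * z))\<^sup>2) (at z)"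
      using nz[OF Suc.prems] by (auto intro!: derivative_eq_intros simp: power2_eq_square)
    have "((\<lambda>z. inverse (1 - cnj a * z) ^ k) has_field_derivative of_nat k * cnj a * inverse (1 - cnj a * z) ^ Suc k) (at z)" for k
      using DERIV_power[OF u, of k] by (cases k) (auto simp: power2_eq_square mult_ac)
    from DERIV_cmult[OF this[of "m + n"], of "c * of_nat (pochhammer m n) * cnj a ^ n"] show ?thesis
      by (simp add: pochhammer_Suc mult_ac)
  qed
  then have "((deriv ^^ n) (\<lambda>z. c * inverse (1 - cnj a * z) ^ m) has_field_derivative
      c * of_nat (pochhammer m (Suc n)) * cnj a ^ Suc n * inverse (1 - cnj a * z) ^ (m + Suc n)) (at z)"
    by (rule has_field_derivative_transform_within_open[OF _ open_ball Suc.prems]) (simp add: Suc.IH)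
  then show ?case by (simp add: DERIV_imp_deriv)
qed


section \<open>Weighted norms of the test functions\<close>

context D_weight
begin

text \<open>Decomposes the disc into the annuli 1-|z| \<le> 2^j h with h = 1-|a|. Doubling bounds
  the mass of the j-th by a multiple of B^j, while the kernel is of size 2^(-lj) where it is used,
  so the ratio B/2^l \<le> 1/2 gives a geometric series.\<close>

lemma nn_integral_radial_kernel_le:
  fixes a :: complex
  assumes a: "norm a < 1" and l: "0 \<le> l" "2 * B \<le> 2 powr l"
  shows "(\<integral>\<^sup>+z. ennreal ((1 - norm a * norm z) powr (- l)) \<partial>wA \<omega>)
     \<le> ennreal (4 * 2 powr l * (1 - norm a) powr (- l) * omega_hat \<omega> (norm a))"
proof -
  define h where "h = 1 - norm a"
  have h: "0 < h" using a by (simp add: h_def)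
  define A where "A j = {z \<in> ball (0::complex) 1. 1 - 2 ^ j * h \<le> norm z}" for j :: nat
  have A: "A j \<in> sets (wA \<omega>)" for j
    unfolding A_def by (intro sets_wAI) auto
  define c where "c j = (2 ^ j * h / 2) powr (- l)" for j :: nat
  have eA: "emeasure (wA \<omega>) (A j) \<le> ennreal (2 * (B ^ j * omega_hat \<omega> (norm a)))" for j
  proof -
    define \<rho> where "\<rho> = max 0 (1 - 2 ^ j * h)"
    have \<rho>: "0 \<le> \<rho>" "\<rho> < 1" "1 - \<rho> \<le> 2 ^ j * h" using h by (auto simp: \<rho>_def)
    have "emeasure (wA \<omega>) (A j) = emeasure (wA \<omega>) {z \<in> ball 0 1. \<rho> \<le> norm z}"
      by (intro arg_cong2[where f=emeasure]) (auto simp: A_def \<rho>_def)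
    also have "\<dots> \<le> ennreal (2 * omega_hat \<omega> \<rho>)" using \<rho> by (intro emeasure_annulus_le) auto
    also have "\<dots> \<le> ennreal (2 * (B ^ j * omega_hat \<omega> (norm a)))"
      using \<rho> a by (intro ennreal_leI mult_left_mono omega_hat_doubling_power) (auto simp: h_def)
    finally show ?thesis .
  qed
  have "(\<integral>\<^sup>+z. ennreal ((1 - norm a * norm z) powr (- l)) \<partial>wA \<omega>) \<le> (\<integral>\<^sup>+z. (\<Sum>j. ennreal (c j) * indicator (A j) z) \<partial>wA \<omega>)"
  proof (intro nn_integral_mono)
    fix z assume "z \<in> space (wA \<omega>)"
    then have z: "norm z < 1" by simp
    have ex: "\<exists>j. 1 - norm z \<le> 2 ^ j * h"
    proof -
      obtain j where "(1 - norm z) / h < 2 ^ j" using real_arch_pow[of 2] by auto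
      then show ?thesis using h by (intro exI[of _ j]) (simp add: field_simps)
    qed
    \<comment> \<open>The least such j: for j = 0 the bound comes from 1-|a||z| \<ge> h, otherwise
      minimality gives 1-|a||z| \<ge> 1-|z| > 2^(j-1) h.\<close>
    define j where "j = (LEAST j. 1 - norm z \<le> 2 ^ j * h)"
    have j: "1 - norm z \<le> 2 ^ j * h" unfolding j_def using ex by (rule LeastI_ex)
    have "2 ^ j * h / 2 \<le> 1 - norm a * norm z"
    proof (cases j)
      case 0
      have "norm a * norm z \<le> norm a * 1" using z by (intro mult_left_mono) auto
      then show ?thesis using 0 h by (simp add: h_def)
    next
      case (Suc i)
      then have "\<not> 1 - norm z \<le> 2 ^ i * h" using not_less_Least[of i "\<lambda>j. 1 - norm z \<le> 2 ^ j * h"] by (simp add: j_def)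
      moreover have "norm a * norm z \<le> 1 * norm z" using a by (intro mult_right_mono) auto
      ultimately show ?thesis using Suc by simp
    qed
    then have "(1 - norm a * norm z) powr (- l) \<le> c j"
      unfolding c_def using h l by (intro powr_mono2') auto
    then have "ennreal ((1 - norm a * norm z) powr (- l)) \<le> ennreal (c j) * indicator (A j) z"
      using j z by (simp add: A_def ennreal_leI)
    also have "\<dots> \<le> (\<Sum>j. ennreal (c j) * indicator (A j) z)"
    proof -
      define u where "u i = ennreal (c i) * indicator (A i) z" for i
      have "sum u {j} \<le> suminf u" by (intro sum_le_suminf) auto
      then have "u j \<le> suminf u" by simp
      then show ?thesis unfolding u_def[abs_def] .
    qed
    finally show "ennreal ((1 - norm a * norm z) powr (- l)) \<le> (\<Sum>j. ennreal (c j) * indicator (A j) z)" .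
  qed
  also have "\<dots> = (\<Sum>j. \<integral>\<^sup>+z. ennreal (c j) * indicator (A j) z \<partial>wA \<omega>)"
    using A by (intro nn_integral_suminf) auto
  also have "\<dots> = (\<Sum>j. ennreal (c j) * emeasure (wA \<omega>) (A j))"
    using A by (simp add: nn_integral_cmult_indicator)
  also have "\<dots> \<le> (\<Sum>j. ennreal (2 * 2 powr l * h powr (- l) * omega_hat \<omega> (norm a) * (1/2) ^ j))"
  proof (intro suminf_le)
    fix j
    define b where "b = 2 * (2 powr l * h powr (- l) * omega_hat \<omega> (norm a))"
    have b: "0 \<le> b" using omega_hat_nonneg[of "norm a"] by (simp add: b_def)
    have cj: "c j = 2 powr l * h powr (- l) * (1 / 2 powr l) ^ j"
    proof -
      have "(2 ^ j) powr (- l) = (2 powr (- l)) ^ j"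
        by (simp add: powr_realpow[symmetric] powr_powr mult.commute)
      then show ?thesis
        unfolding c_def using h by (simp add: powr_mult powr_divide powr_minus field_simps power_divide)
    qed
    have "ennreal (c j) * emeasure (wA \<omega>) (A j) \<le> ennreal (c j) * ennreal (2 * (B ^ j * omega_hat \<omega> (norm a)))"
      using eA by (intro mult_left_mono) auto
    also have "\<dots> = ennreal (c j * (2 * (B ^ j * omega_hat \<omega> (norm a))))"
      using B omega_hat_nonneg[of "norm a"] by (intro ennreal_mult[symmetric]) (auto simp: c_def)
    also have "c j * (2 * (B ^ j * omega_hat \<omega> (norm a))) = b * (B / 2 powr l) ^ j"
      by (simp add: cj b_def power_divide field_simps)
    also have "ennreal (b * (B / 2 powr l) ^ j) \<le> ennreal (b * (1/2) ^ j)"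
      using b B l by (intro ennreal_leI mult_left_mono power_mono) (auto simp: field_simps)
    finally show "ennreal (c j) * emeasure (wA \<omega>) (A j) \<le> ennreal (2 * 2 powr l * h powr (- l) * omega_hat \<omega> (norm a) * (1/2) ^ j)"
      by (simp add: b_def mult_ac)
  qed auto
  also have "\<dots> = ennreal (2 * 2 powr l * h powr (- l) * omega_hat \<omega> (norm a) * (1 / (1 - 1/2)))"
    using omega_hat_nonneg[of "norm a"] by (intro suminf_ennreal_eq sums_mult geometric_sums) auto
  finally show ?thesis by (simp add: h_def mult.assoc)
qed

end

context D_weight
begin

text \<open>With k = mp: 2^k comes from 1-|a|^2 \<le> 2(1-|a|), and 4 times 2^(k-1) is the constant
  of the radial kernel estimate with exponent k - 1.\<close>

definition test_const :: "nat \<Rightarrow> real \<Rightarrow> real" where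
  "test_const m p = 2 powr (real m * p) * 4 * 2 powr (real m * p - 1)"

lemma test_const_pos: "0 < test_const m p"
  by (simp add: test_const_def)

text \<open>The choice $m = b + 3$ makes the dyadic series below geometric with ratio at most $1/2$.\<close>

lemma nn_integral_test_kernel_le:
  assumes b: "B \<le> 2 ^ b" and m: "m = b + 3" and p: "1 < p" and a: "norm a < 1"
  shows "(\<integral>\<^sup>+z. ennreal (norm (complex_of_real ((1 - (norm a)\<^sup>2) ^ m) * inverse (1 - cnj a * z) ^ m) powr p) \<partial>wA \<omega>)
    \<le> ennreal (test_const m p * ((1 - norm a) * omega_hat \<omega> (norm a)))"
proof -
  define k where "k = real m * p"
  have "real m * 1 \<le> real m * p" using p by (intro mult_left_mono) auto
  then have k: "real b + 3 \<le> k" by (simp add: k_def m)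
  define h where "h = 1 - norm a"
  have h: "0 < h" using a by (simp add: h_def)
  have d: "0 \<le> 1 - (norm a)\<^sup>2" "1 - (norm a)\<^sup>2 \<le> 2 * h"
  proof -
    show "0 \<le> 1 - (norm a)\<^sup>2" using a by (simp add: power_le_one)
    have "1 - (norm a)\<^sup>2 = h * (1 + norm a)" by (simp add: h_def power2_eq_square algebra_simps)
    also have "\<dots> \<le> h * 2" using h a by (intro mult_left_mono) auto
    finally show "1 - (norm a)\<^sup>2 \<le> 2 * h" by simp
  qed
  \<comment> \<open>Of the k powers of 1/|1 - cnj a z| two are kept and the others are replaced by
    the radial bound. The circle mean of the two is at most 1/(1-|a||z|), so a radial integral with
    exponent k - 1 remains.\<close>
  define F where "F z = ennreal (1 / (norm (1 - cnj a * z))\<^sup>2) * ennreal ((1 - norm a * norm z) powr (- (k - 2)))" for z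
  have Fm: "F \<in> borel_measurable borel" unfolding F_def[abs_def] by measurable
  have pt: "ennreal (norm (complex_of_real ((1 - (norm a)\<^sup>2) ^ m) * inverse (1 - cnj a * z) ^ m) powr p) \<le> ennreal ((2 * h) powr k) * F z"
    if z: "norm z < 1" for z
  proof -
    define x where "x = norm (1 - cnj a * z)"
    define u where "u = 1 - norm a * norm z"
    have u: "0 < u" "u \<le> x"
      using norm_mult_less_1[OF a z] norm_one_minus_cnj_ge[OF a, of z] by (auto simp: u_def x_def)
    have "norm (complex_of_real ((1 - (norm a)\<^sup>2) ^ m) * inverse (1 - cnj a * z) ^ m) = (1 - (norm a)\<^sup>2) ^ m * inverse x ^ m"
      unfolding norm_mult norm_power norm_inverse norm_of_real x_def using d by (simp add: power_abs)
    also have "\<dots> \<le> (2 * h) ^ m * inverse x ^ m"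
      using d u by (intro mult_right_mono power_mono) auto
    finally have "norm (complex_of_real ((1 - (norm a)\<^sup>2) ^ m) * inverse (1 - cnj a * z) ^ m) powr p \<le> ((2 * h) ^ m * inverse x ^ m) powr p"
      using p by (intro powr_mono2) auto
    also have "\<dots> = (2 * h) powr k * x powr (- k)"
      using u h p by (simp add: powr_mult powr_realpow[symmetric] powr_powr k_def powr_minus inverse_powr)
    also have "x powr (- k) = x powr (- 2) * x powr (- (k - 2))"
      by (simp add: powr_add[symmetric])
    also have "x powr (- 2) = 1 / x\<^sup>2" using u by (simp add: powr_minus powr_numeral divide_inverse)
    finally have "norm (complex_of_real ((1 - (norm a)\<^sup>2) ^ m) * inverse (1 - cnj a * z) ^ m) powr p
        \<le> (2 * h) powr k * (1 / x\<^sup>2 * x powr (- (k - 2)))" .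
    also have "\<dots> \<le> (2 * h) powr k * (1 / x\<^sup>2 * u powr (- (k - 2)))"
      using u k by (intro mult_left_mono powr_mono2') auto
    finally show ?thesis
      unfolding F_def x_def u_def by (simp add: ennreal_mult'[symmetric] ennreal_leI)
  qed
  have "(\<integral>\<^sup>+z. F z \<partial>wA \<omega>) = (\<integral>\<^sup>+z. (\<integral>\<^sup>+x. F (z * cis (2 * pi * x)) * indicator {0..1} x \<partial>lborel) \<partial>wA \<omega>)"
    using nn_integral_wA_average[OF Fm, of 0 1] by simp
  also have "\<dots> \<le> (\<integral>\<^sup>+z. ennreal ((1 - norm a * norm z) powr (- (k - 1))) \<partial>wA \<omega>)"
  proof (intro nn_integral_mono)
    fix z assume "z \<in> space (wA \<omega>)"
    then have z: "norm z < 1" by simp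
    define u where "u = norm a * norm z"
    have u: "0 \<le> u" "u < 1" using norm_mult_less_1[OF a z] by (auto simp: u_def)
    have "(\<integral>\<^sup>+x. F (z * cis (2 * pi * x)) * indicator {0..1} x \<partial>lborel)
      = (\<integral>\<^sup>+x. ennreal ((1 - u) powr (- (k - 2))) * (ennreal (1 / (norm (1 - cnj a * (z * cis (2 * pi * x))))\<^sup>2) * indicator {0..1} x) \<partial>lborel)"
      by (intro nn_integral_cong) (simp add: F_def u_def norm_mult mult_ac)
    also have "\<dots> = ennreal ((1 - u) powr (- (k - 2))) * (\<integral>\<^sup>+x. ennreal (1 / (norm (1 - cnj a * (z * cis (2 * pi * x))))\<^sup>2) * indicator {0..1} x \<partial>lborel)"
    proof (rule nn_integral_cmult)
      have [measurable]: "(\<lambda>x. 1 - cnj a * (z * cis (2 * pi * x))) \<in> borel_measurable borel"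
        unfolding cis_conv_exp by (intro borel_measurable_continuous_onI continuous_intros)
      show "(\<lambda>x. ennreal (1 / (norm (1 - cnj a * (z * cis (2 * pi * x))))\<^sup>2) * indicator {0..1} x) \<in> borel_measurable lborel"
        by measurable
    qed
    also have "\<dots> = ennreal ((1 - u) powr (- (k - 2))) * ennreal (1 / (1 - u\<^sup>2))"
      by (simp only: nn_integral_inverse_square_one_minus[OF a z] u_def)
    also have "\<dots> = ennreal ((1 - u) powr (- (k - 2)) * (1 / (1 - u\<^sup>2)))"
      using u by (intro ennreal_mult[symmetric]) (auto simp: power_le_one)
    also have "\<dots> \<le> ennreal ((1 - u) powr (- (k - 2)) * (1 - u) powr (- 1))"
    proof (intro ennreal_leI mult_left_mono)
      have "u\<^sup>2 \<le> u" using u by (simp add: power2_eq_square mult_left_le)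
      then have "1 / (1 - u\<^sup>2) \<le> 1 / (1 - u)" using u by (intro divide_left_mono) (auto simp: zero_less_mult_iff)
      then show "1 / (1 - u\<^sup>2) \<le> (1 - u) powr (- 1)" using u by (simp add: powr_minus divide_inverse)
    qed auto
    also have "(1 - u) powr (- (k - 2)) * (1 - u) powr (- 1) = (1 - u) powr (- (k - 1))"
      unfolding powr_add[symmetric] by simp
    finally show "(\<integral>\<^sup>+x. F (z * cis (2 * pi * x)) * indicator {0..1} x \<partial>lborel) \<le> ennreal ((1 - norm a * norm z) powr (- (k - 1)))"
      by (simp add: u_def)
  qed
  also have "\<dots> \<le> ennreal (4 * 2 powr (k - 1) * h powr (- (k - 1)) * omega_hat \<omega> (norm a))"
  proof -
    have "2 * B \<le> 2 * 2 ^ b" using b by simp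
    also have "\<dots> = 2 powr (real b + 1)" by (simp add: powr_add powr_realpow)
    also have "\<dots> \<le> 2 powr (k - 1)" using k by (intro powr_mono) auto
    finally show ?thesis unfolding h_def using k a by (intro nn_integral_radial_kernel_le) auto
  qed
  finally have FI: "(\<integral>\<^sup>+z. F z \<partial>wA \<omega>) \<le> ennreal (4 * 2 powr (k - 1) * h powr (- (k - 1)) * omega_hat \<omega> (norm a))" .
  have "(\<integral>\<^sup>+z. ennreal (norm (complex_of_real ((1 - (norm a)\<^sup>2) ^ m) * inverse (1 - cnj a * z) ^ m) powr p) \<partial>wA \<omega>)
      \<le> (\<integral>\<^sup>+z. ennreal ((2 * h) powr k) * F z \<partial>wA \<omega>)"
    by (intro nn_integral_mono pt) simp
  also have "\<dots> = ennreal ((2 * h) powr k) * (\<integral>\<^sup>+z. F z \<partial>wA \<omega>)"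
    using borel_measurable_wA[OF Fm] by (rule nn_integral_cmult)
  also have "\<dots> \<le> ennreal ((2 * h) powr k) * ennreal (4 * 2 powr (k - 1) * h powr (- (k - 1)) * omega_hat \<omega> (norm a))"
    using FI by (intro mult_left_mono) auto
  also have "\<dots> = ennreal ((2 * h) powr k * (4 * 2 powr (k - 1) * h powr (- (k - 1)) * omega_hat \<omega> (norm a)))"
    using omega_hat_nonneg[of "norm a"] by (intro ennreal_mult[symmetric]) auto
  also have "(2 * h) powr k * (4 * 2 powr (k - 1) * h powr (- (k - 1)) * omega_hat \<omega> (norm a)) = test_const m p * (h * omega_hat \<omega> (norm a))"
  proof -
    have e1: "h powr k * h powr (- (k - 1)) = h" using h by (simp add: powr_add[symmetric])
    have e2: "(2 * h) powr k = 2 powr k * h powr k" by (rule powr_mult)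
    have "(2 * h) powr k * (4 * 2 powr (k - 1) * h powr (- (k - 1)) * omega_hat \<omega> (norm a))
        = (2 powr k * 4 * 2 powr (k - 1)) * ((h powr k * h powr (- (k - 1))) * omega_hat \<omega> (norm a))"
      unfolding e2 by (simp only: mult_ac)
    then show ?thesis unfolding e1 test_const_def k_def[symmetric] .
  qed
  finally show ?thesis by (simp add: h_def)
qed

definition test_fun :: "nat \<Rightarrow> real \<Rightarrow> complex \<Rightarrow> complex \<Rightarrow> complex" where
  "test_fun m p a z = complex_of_real ((1 - (norm a)\<^sup>2) ^ m / (test_const m p * ((1 - norm a) * omega_hat \<omega> (norm a))) powr (1 / p)) * inverse (1 - cnj a * z) ^ m"

lemma test_fun_bergman:
  assumes b: "B \<le> 2 ^ b" and m: "m = b + 3" and p: "1 < p" and a: "norm a < 1"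
  shows "test_fun m p a \<in> bergman_space p \<omega>" "(\<integral>z. norm (test_fun m p a z) powr p \<partial>wA \<omega>) \<le> 1"
proof -
  define W where "W = test_const m p * ((1 - norm a) * omega_hat \<omega> (norm a))"
  have W: "0 < W" unfolding W_def using test_const_pos[of m p] a omega_hat_pos[of "norm a"] by simp
  have nz: "1 - cnj a * z \<noteq> 0" if "z \<in> ball 0 1" for z
    using norm_mult_less_1[OF a, of z] norm_one_minus_cnj_ge[OF a, of z] that by auto
  have hol: "test_fun m p a holomorphic_on ball 0 1"
    unfolding test_fun_def using nz by (intro holomorphic_intros) auto
  have eq: "test_fun m p a z = complex_of_real (1 / W powr (1 / p)) * (complex_of_real ((1 - (norm a)\<^sup>2) ^ m) * inverse (1 - cnj a * z) ^ m)" for z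
    by (simp add: test_fun_def W_def)
  define k where "k z = norm (complex_of_real ((1 - (norm a)\<^sup>2) ^ m) * inverse (1 - cnj a * z) ^ m) powr p" for z
  have pw: "norm (test_fun m p a z) powr p = 1 / W * k z" for z
    unfolding eq norm_mult[of "complex_of_real (1 / W powr (1 / p))"] norm_of_real[of "1 / W powr (1 / p)"] k_def
    using W p by (simp add: powr_mult powr_divide powr_powr)
  have "(\<integral>\<^sup>+z. ennreal (norm (test_fun m p a z) powr p) \<partial>wA \<omega>) = (\<integral>\<^sup>+z. ennreal (1 / W) * ennreal (k z) \<partial>wA \<omega>)"
    unfolding pw using W by (intro nn_integral_cong ennreal_mult) (auto simp: k_def)
  also have "\<dots> = ennreal (1 / W) * (\<integral>\<^sup>+z. ennreal (k z) \<partial>wA \<omega>)"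
  proof (rule nn_integral_cmult)
    have "k \<in> borel_measurable borel" unfolding k_def[abs_def] by measurable
    then show "(\<lambda>z. ennreal (k z)) \<in> borel_measurable (wA \<omega>)" by (intro borel_measurable_wA) auto
  qed
  also have "\<dots> \<le> ennreal (1 / W) * ennreal W"
    unfolding k_def W_def by (intro mult_left_mono nn_integral_test_kernel_le[OF b m p a]) auto
  also have "\<dots> = 1" using W by (simp add: ennreal_mult[symmetric])
  finally have le: "(\<integral>\<^sup>+z. ennreal (norm (test_fun m p a z) powr p) \<partial>wA \<omega>) \<le> 1" .
  have mf: "test_fun m p a \<in> borel_measurable (wA \<omega>)" using hol by (rule holomorphic_measurable_wA)
  have int: "integrable (wA \<omega>) (\<lambda>z. norm (test_fun m p a z) powr p)"
    using mf le by (intro integrableI_bounded) (auto intro: order_le_less_trans)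
  then show "test_fun m p a \<in> bergman_space p \<omega>" using hol by (simp add: bergman_space_def)
  show "(\<integral>z. norm (test_fun m p a z) powr p \<partial>wA \<omega>) \<le> 1"
    using le nn_integral_eq_integral[OF int] by simp
qed

text \<open>Doubling permits at most polynomial decay of \<open>omega_hat\<close>: the least j with
  2^j(1-t) \<ge> 1 also satisfies 2^j(1-t) \<le> 2. This bounds from below the normalising factor of
  the test functions.\<close>

lemma omega_hat_lower:
  assumes b: "B \<le> 2 ^ b" and t: "0 \<le> t" "t < 1"
  shows "omega_hat \<omega> 0 * (1 - t) ^ b \<le> 2 ^ b * omega_hat \<omega> t"
proof -
  define h where "h = 1 - t"
  have h: "0 < h" "h \<le> 1" using t by (auto simp: h_def)
  have ex: "\<exists>j. 1 \<le> 2 ^ j * h"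
  proof -
    obtain j where "1 / h < 2 ^ j" using real_arch_pow[of 2] by auto
    then show ?thesis using h by (intro exI[of _ j]) (simp add: field_simps)
  qed
  define j where "j = (LEAST j. 1 \<le> 2 ^ j * h)"
  have j: "1 \<le> 2 ^ j * h" unfolding j_def using ex by (rule LeastI_ex)
  have j2: "2 ^ j * h \<le> 2"
  proof (cases j)
    case (Suc i)
    then have "\<not> 1 \<le> 2 ^ i * h" using not_less_Least[of i "\<lambda>j. 1 \<le> 2 ^ j * h"] by (simp add: j_def)
    then show ?thesis using Suc by simp
  qed (use h in simp)
  have "omega_hat \<omega> 0 \<le> B ^ j * omega_hat \<omega> t"
    using j t by (intro omega_hat_doubling_power) (auto simp: h_def)
  also have "\<dots> \<le> (2 ^ b) ^ j * omega_hat \<omega> t"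
    using b B t by (intro mult_right_mono power_mono) (auto simp: omega_hat_nonneg)
  finally have "omega_hat \<omega> 0 * h ^ b \<le> (2 ^ b) ^ j * omega_hat \<omega> t * h ^ b"
    using h by (intro mult_right_mono) auto
  also have "\<dots> = (2 ^ j * h) ^ b * omega_hat \<omega> t"
    by (simp add: power_mult_distrib power_mult[symmetric] mult_ac)
  also have "\<dots> \<le> 2 ^ b * omega_hat \<omega> t"
    using j2 h t by (intro mult_right_mono power_mono) (auto simp: omega_hat_nonneg)
  finally show ?thesis by (simp add: h_def)
qed

text \<open>With h = 1-|a| the numerator is of order h^(b+3), the normalising factor at least of
  order h^(b+1), and 1/|1 - cnj a z| is bounded for |z| \<le> \<rho>. A factor h^2 survives.\<close>

lemma test_fun_locally_null:
  assumes b: "B \<le> 2 ^ b" and m: "m = b + 3" and p: "1 < p" and a: "\<And>k. norm (a k) < 1"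
    and lim: "(\<lambda>k. norm (a k)) \<longlonglongrightarrow> 1"
  shows "locally_null (\<lambda>k. test_fun m p (a k))"
  unfolding locally_null_def
proof (intro allI impI)
  fix \<rho> e :: real assume \<rho>: "\<rho> < 1" and e: "0 < e"
  define c where "c = test_const m p * (omega_hat \<omega> 0 / 2 ^ b)"
  have c: "0 < c" using test_const_pos[of m p] omega_hat_pos[of 0] by (simp add: c_def)
  define A where "A = 2 ^ m / c powr (1 / p) * (1 / (1 - \<rho>)) ^ m"
  have bound: "norm (test_fun m p x z) \<le> A * (1 - norm x)" if x: "norm x < 1" and z: "norm z \<le> \<rho>" for x z
  proof -
    define h where "h = 1 - norm x"
    have h: "0 < h" "h \<le> 1" using x by (auto simp: h_def)
    have "c * h ^ (b + 1) \<le> test_const m p * (h * omega_hat \<omega> (norm x))"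
    proof -
      have "omega_hat \<omega> 0 / 2 ^ b * h ^ b \<le> omega_hat \<omega> (norm x)"
        using omega_hat_lower[OF b, of "norm x"] x by (simp add: h_def field_simps)
      then have "test_const m p * (h * (omega_hat \<omega> 0 / 2 ^ b * h ^ b)) \<le> test_const m p * (h * omega_hat \<omega> (norm x))"
        using h test_const_pos[of m p] by (intro mult_left_mono) auto
      then show ?thesis by (simp add: c_def mult_ac)
    qed
    then have c1: "(c * h ^ (b + 1)) powr (1 / p) \<le> (test_const m p * (h * omega_hat \<omega> (norm x))) powr (1 / p)"
      using p c h by (intro powr_mono2) auto
    \<comment> \<open>Base at most 1 and exponent 1/p < 1, so taking the root only enlarges.\<close>
    have "h ^ (b + 1) \<le> (h ^ (b + 1)) powr (1 / p)"
    proof -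
      have "h ^ (b + 1) \<le> 1" using h by (intro power_le_one) auto
      then have "(h ^ (b + 1)) powr 1 \<le> (h ^ (b + 1)) powr (1 / p)"
        using h p by (intro powr_mono') auto
      then show ?thesis using h by simp
    qed
    then have "c powr (1 / p) * h ^ (b + 1) \<le> c powr (1 / p) * (h ^ (b + 1)) powr (1 / p)"
      by (rule mult_left_mono) simp
    also have "\<dots> = (c * h ^ (b + 1)) powr (1 / p)"
      by (rule powr_mult[symmetric])
    finally have den: "c powr (1 / p) * h ^ (b + 1) \<le> (test_const m p * (h * omega_hat \<omega> (norm x))) powr (1 / p)"
      using c1 by simp
    have num: "(1 - (norm x)\<^sup>2) ^ m \<le> (2 * h) ^ m"
    proof (rule power_mono)
      have "1 - (norm x)\<^sup>2 = h * (1 + norm x)" by (simp add: h_def power2_eq_square algebra_simps)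
      also have "\<dots> \<le> h * 2" using h x by (intro mult_left_mono) auto
      finally show "1 - (norm x)\<^sup>2 \<le> 2 * h" by simp
      show "0 \<le> 1 - (norm x)\<^sup>2" using x by (simp add: power_le_one)
    qed
    have inv: "inverse (norm (1 - cnj x * z)) ^ m \<le> (1 / (1 - \<rho>)) ^ m"
    proof (rule power_mono)
      have "norm x * norm z \<le> 1 * \<rho>" using x z by (intro mult_mono) auto
      then have "1 - \<rho> \<le> norm (1 - cnj x * z)" using norm_one_minus_cnj_ge[OF x, of z] by linarith
      then show "inverse (norm (1 - cnj x * z)) \<le> 1 / (1 - \<rho>)"
        using \<rho> by (simp add: divide_inverse le_imp_inverse_le)
    qed simp
    have "norm (test_fun m p x z) = (1 - (norm x)\<^sup>2) ^ m / (test_const m p * (h * omega_hat \<omega> (norm x))) powr (1 / p) * inverse (norm (1 - cnj x * z)) ^ m"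
      using x unfolding test_fun_def norm_mult norm_of_real norm_power norm_inverse h_def
      by (simp add: power_le_one abs_of_nonneg)
    also have "\<dots> \<le> (2 * h) ^ m / (c powr (1 / p) * h ^ (b + 1)) * (1 / (1 - \<rho>)) ^ m"
      using num den inv c h by (intro mult_mono frac_le) auto
    also have "\<dots> = A * h\<^sup>2"
      using h c by (simp add: A_def m power_mult_distrib power_add field_simps power2_eq_square power3_eq_cube)
    also have "\<dots> \<le> A * h"
      using h c \<rho> by (intro mult_left_mono) (auto simp: A_def power2_eq_square mult_left_le)
    finally show ?thesis by (simp add: h_def)
  qed
  have "(\<lambda>k. A * (1 - norm (a k))) \<longlonglongrightarrow> A * (1 - 1)"
    using lim by (intro tendsto_intros)
  then have "eventually (\<lambda>k. A * (1 - norm (a k)) < e) sequentially"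
    using e by (intro order_tendstoD(2)[where y=0]) auto
  then obtain J where "\<And>k. k \<ge> J \<Longrightarrow> A * (1 - norm (a k)) < e" by (auto simp: eventually_sequentially)
  then show "\<exists>J. \<forall>j\<ge>J. \<forall>z. norm z \<le> \<rho> \<longrightarrow> norm (test_fun m p (a j) z) \<le> e"
    using bound[OF a] by (intro exI[of _ J]) (meson less_imp_le order_trans)
qed

text \<open>In (1/4)^n one factor 1/2 comes from |a| \<ge> 1/2, the other from 1-|a|^2 \<le>
  2(1-|a|); the power of 1 - s comes from the bound on |1 - cnj a z| in the pseudohyperbolic
  disc.\<close>

definition lower_const :: "nat \<Rightarrow> nat \<Rightarrow> real \<Rightarrow> real \<Rightarrow> real \<Rightarrow> real" where
  "lower_const m n p q s = ((1/4) ^ n * (1 - s) ^ (m + n)) powr q / test_const m p powr (q / p)"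

lemma lower_const_pos: "s < 1 \<Longrightarrow> 0 < lower_const m n p q s"
  using test_const_pos[of m p] by (simp add: lower_const_def)

text \<open>Throughout the disc |1 - cnj a z| is at most (1-|a|^2)/(1-s), so the explicit n-th
  derivative is large at every point of it; |a| \<ge> 1/2 protects the factor |a|^n, and the rising
  factorial is at least 1.\<close>

lemma test_fun_deriv_ge:
  assumes m: "0 < m" and p: "1 < p" "p \<le> q" and a: "1/2 \<le> norm a" "norm a < 1" and s: "0 < s" "s < 1"
    and z: "z \<in> pseudo_hyp_disc s a"
  shows "lower_const m n p q s \<le> norm ((deriv ^^ n) (test_fun m p a) z) powr q * size_gauge n p q a"
proof -
  define h where "h = 1 - norm a"
  have h: "0 < h" using a by (simp add: h_def)
  define W where "W = h * omega_hat \<omega> (norm a)"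
  have W: "0 < W" using h a omega_hat_pos[of "norm a"] by (simp add: W_def)
  define d where "d = 1 - (norm a)\<^sup>2"
  have d: "0 < d" "d \<le> 2 * h"
  proof -
    have e: "d = h * (1 + norm a)" by (simp add: d_def h_def power2_eq_square algebra_simps)
    show "0 < d" unfolding e using h a by (intro mult_pos_pos) auto
    have "h * (1 + norm a) \<le> h * 2" using h a by (intro mult_left_mono) auto
    then show "d \<le> 2 * h" by (simp add: e)
  qed
  define x where "x = norm (1 - cnj a * z)"
  have x: "0 < x" "x * (1 - s) \<le> d"
    using pseudo_hyp_disc_denominator_le[OF z a(2) s(2)] by (auto simp: x_def d_def)
  define t where "t = test_const m p"
  have t: "0 < t" unfolding t_def by (rule test_const_pos)
  have zb: "z \<in> ball 0 1" using z by (simp add: pseudo_hyp_disc_def)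
  have poch: "1 \<le> pochhammer m n" using m by (induction n) (auto simp: pochhammer_Suc)
  have "norm ((deriv ^^ n) (test_fun m p a) z) = d ^ m / (t * W) powr (1 / p) * pochhammer m n * norm a ^ n * inverse x ^ (m + n)"
    unfolding test_fun_def[abs_def] higher_deriv_inverse_power[OF a(2) zb]
    using d by (simp add: norm_mult norm_power norm_inverse norm_divide x_def d_def[symmetric] h_def[symmetric] W_def t_def)
  also have "\<dots> \<ge> d ^ m / (t * W) powr (1 / p) * 1 * (1/2) ^ n * ((1 - s) / d) ^ (m + n)"
  proof (intro mult_mono power_mono)
    show "(1 - s) / d \<le> inverse x" using x d by (simp add: field_simps)
  qed (use poch a d s x in auto)
  finally have D: "d ^ m / (t * W) powr (1 / p) * (1/2) ^ n * ((1 - s) / d) ^ (m + n) \<le> norm ((deriv ^^ n) (test_fun m p a) z)"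
    by simp
  have "d ^ m / (t * W) powr (1 / p) * (1/2) ^ n * ((1 - s) / d) ^ (m + n)
      = (1/2) ^ n * (1 - s) ^ (m + n) / d ^ n / (t * W) powr (1 / p)"
    using d by (simp add: power_divide power_add field_simps)
  also have "\<dots> \<ge> (1/2) ^ n * (1 - s) ^ (m + n) / (2 * h) ^ n / (t * W) powr (1 / p)"
    using d s t W by (intro divide_right_mono divide_left_mono power_mono) auto
  also have "(1/2) ^ n * (1 - s) ^ (m + n) / (2 * h) ^ n / (t * W) powr (1 / p) = (1/4) ^ n * (1 - s) ^ (m + n) / (h ^ n * (t * W) powr (1 / p))"
  proof -
    have "(1/4::real) ^ n = (1/2) ^ n / 2 ^ n" unfolding power_divide[symmetric] by simp
    then show ?thesis by (simp add: power_mult_distrib)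
  qed
  finally have "(1/4) ^ n * (1 - s) ^ (m + n) / (h ^ n * (t * W) powr (1 / p)) \<le> norm ((deriv ^^ n) (test_fun m p a) z)"
    using D by simp
  then have "((1/4) ^ n * (1 - s) ^ (m + n) / (h ^ n * (t * W) powr (1 / p))) powr q \<le> norm ((deriv ^^ n) (test_fun m p a) z) powr q"
    using p s h by (intro powr_mono2) auto
  also have "((1/4) ^ n * (1 - s) ^ (m + n) / (h ^ n * (t * W) powr (1 / p))) powr q = lower_const m n p q s / size_gauge n p q a"
  proof -
    have "(h ^ n) powr q = h powr (real n * q)" using h by (simp add: powr_realpow[symmetric] powr_powr)
    moreover have "((t * W) powr (1 / p)) powr q = t powr (q / p) * W powr (q / p)"
      using t W by (simp add: powr_powr powr_mult)
    ultimately have "(h ^ n * (t * W) powr (1 / p)) powr q = t powr (q / p) * size_gauge n p q a"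
      using h t W by (simp add: powr_mult size_gauge_def omega_hat0_def max_def h_def W_def)
    moreover have "((1/4) ^ n * (1 - s) ^ (m + n) / (h ^ n * (t * W) powr (1 / p))) powr q
        = ((1/4) ^ n * (1 - s) ^ (m + n)) powr q / (h ^ n * (t * W) powr (1 / p)) powr q"
      by (rule powr_divide)
    ultimately show ?thesis by (simp add: lower_const_def t_def)
  qed
  finally show ?thesis using size_gauge_pos[OF a(2), of n p q] by (simp add: field_simps)
qed

end

section \<open>The two-sided estimate\<close>

text \<open>Unfolds the filter that expresses |z| tending to 1 inside the disc.\<close>

lemma eventually_filtercomap_norm_at_left:
  "eventually P (filtercomap norm (at_left (1::real))) \<longleftrightarrow> (\<exists>b<1. \<forall>z::complex. b < norm z \<longrightarrow> norm z < 1 \<longrightarrow> P z)"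
proof
  assume "eventually P (filtercomap norm (at_left (1::real)))"
  then obtain Q where Q: "eventually Q (at_left (1::real))" "\<And>z. Q (norm z) \<Longrightarrow> P z"
    by (auto simp: eventually_filtercomap)
  then obtain b where "b < 1" "\<And>y. b < y \<Longrightarrow> y < 1 \<Longrightarrow> Q y"
    using eventually_at_left[of "0::real" 1 Q] by auto
  then show "\<exists>b<1. \<forall>z::complex. b < norm z \<longrightarrow> norm z < 1 \<longrightarrow> P z" using Q(2) by blast
next
  assume "\<exists>b<1. \<forall>z::complex. b < norm z \<longrightarrow> norm z < 1 \<longrightarrow> P z"
  then obtain b where b: "b < 1" "\<And>z::complex. b < norm z \<Longrightarrow> norm z < 1 \<Longrightarrow> P z" by blast
  have "eventually (\<lambda>y. b < y \<and> y < 1) (at_left (1::real))"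
    using eventually_at_left[of "0::real" 1 "\<lambda>y. b < y \<and> y < 1"] b(1) by (auto intro!: exI[of _ b])
  then show "eventually P (filtercomap norm (at_left (1::real)))"
    unfolding eventually_filtercomap using b(2) by blast
qed

context D_weight
begin

definition carleson_size :: "nat \<Rightarrow> real \<Rightarrow> real \<Rightarrow> complex \<Rightarrow> real" where
  "carleson_size n p q z = (1 - norm z) powr (real n * q) * (measure (wA \<omega>) (carleson_square z)) powr (q / p)"

lemma carleson_size_le:
  assumes "z \<noteq> 0" "norm z < 1" "1 < p" "p \<le> q"
  shows "carleson_size n p q z \<le> 10 powr (q / p) * size_gauge n p q z"
proof -
  have "measure (wA \<omega>) (carleson_square z) powr (q / p) \<le> (10 * ((1 - norm z) * omega_hat \<omega> (norm z))) powr (q / p)"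
    using measure_carleson_square_le[OF assms(1,2)] assms by (intro powr_mono2) auto
  also have "\<dots> = 10 powr (q / p) * ((1 - norm z) * omega_hat \<omega> (norm z)) powr (q / p)"
    by (rule powr_mult)
  finally have "carleson_size n p q z \<le> (1 - norm z) powr (real n * q) * (10 powr (q / p) * ((1 - norm z) * omega_hat \<omega> (norm z)) powr (q / p))"
    unfolding carleson_size_def by (intro mult_left_mono) auto
  then show ?thesis by (simp add: size_gauge_def omega_hat0_def max_def mult_ac)
qed

lemma size_gauge_le_carleson_size:
  assumes "1/2 \<le> norm z" "norm z < 1" "1 < p" "p \<le> q"
  shows "size_gauge n p q z \<le> 24 powr (q / p) * carleson_size n p q z"
proof -
  have "((1 - norm z) * omega_hat \<omega> (norm z)) powr (q / p) \<le> (24 * measure (wA \<omega>) (carleson_square z)) powr (q / p)"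
    using measure_carleson_square_ge[OF assms(1,2)] assms by (intro powr_mono2) (auto simp: omega_hat_nonneg)
  also have "\<dots> = 24 powr (q / p) * measure (wA \<omega>) (carleson_square z) powr (q / p)"
    by (rule powr_mult)
  finally have "size_gauge n p q z \<le> (1 - norm z) powr (real n * q) * (24 powr (q / p) * measure (wA \<omega>) (carleson_square z) powr (q / p))"
    unfolding size_gauge_def omega_hat0_def by (intro mult_left_mono) (auto simp: max_def)
  then show ?thesis by (simp add: carleson_size_def mult_ac)
qed

definition carleson_limsup :: "nat \<Rightarrow> real \<Rightarrow> real \<Rightarrow> real \<Rightarrow> complex measure \<Rightarrow> ennreal" where
  "carleson_limsup n p q s \<mu> = Limsup (filtercomap norm (at_left (1::real)))
     (\<lambda>z. emeasure \<mu> (pseudo_hyp_disc s z) / ennreal (carleson_size n p q z))"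

text \<open>Every property P that holds near the boundary gives a Carleson condition there whose
  constant is the supremum of the quotient over P. The infimum over all such P is the
  limsup.\<close>

lemma essential_norm_upper:
  assumes \<mu>: "borel_measure_on_disc \<mu>" and T: "bounded_op p \<omega> \<mu> q (diff_op n)" and pq: "1 < p" "p \<le> q"
    and s: "0 < s"
  defines "c \<equiv> deriv_const p n powr (q / p) * 4 powr (q / p - 1) * carleson_const n p q s * 10 powr (q / p)"
  shows "ennreal (essential_norm p \<omega> \<mu> q (diff_op n) powr q) \<le> ennreal c * carleson_limsup n p q s \<mu>"
proof -
  define c0 where "c0 = deriv_const p n powr (q / p) * 4 powr (q / p - 1) * carleson_const n p q s"
  have c0: "0 < c0" using deriv_const_pos[of p n] carleson_const_pos[OF s, of n p q] by (simp add: c0_def)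
  have cc: "c = c0 * 10 powr (q / p)" by (simp add: c_def c0_def)
  then have c: "0 < c" using c0 by simp
  define \<Phi> where "\<Phi> z = emeasure \<mu> (pseudo_hyp_disc s z) / ennreal (carleson_size n p q z)" for z
  define E where "E = ennreal (essential_norm p \<omega> \<mu> q (diff_op n) powr q)"
  have step: "E \<le> ennreal c * (SUP z\<in>{z. P z}. \<Phi> z)" if "eventually P (filtercomap norm (at_left (1::real)))" for P
  proof -
    obtain b where b: "b < 1" "\<And>z::complex. b < norm z \<Longrightarrow> norm z < 1 \<Longrightarrow> P z"
      using \<open>eventually P _\<close> unfolding eventually_filtercomap_norm_at_left by blast
    define b' where "b' = max b (1/2)"
    have b': "b' < 1" "1/2 \<le> b'" "b \<le> b'" using b by (auto simp: b'_def)
    \<comment> \<open>Then 2(1-r) = (1-b')/2, so the points \<zeta> at which the Carleson condition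
      is required satisfy |\<zeta>| > b'.\<close>
    define r where "r = (3 + b') / 4"
    have r: "0 \<le> r" "r < 1" using b' by (auto simp: r_def)
    define \<Lambda> where "\<Lambda> = ennreal (10 powr (q / p)) * (SUP z\<in>{z. P z}. \<Phi> z)"
    have "emeasure \<mu> (pseudo_hyp_disc s \<zeta>) \<le> \<Lambda> * ennreal (size_gauge n p q \<zeta>)"
      if \<zeta>: "norm \<zeta> < 1" "1 - norm \<zeta> \<le> 2 * (1 - r)" for \<zeta>
    proof -
      have "2 * (1 - r) = (1 - b') / 2" by (simp add: r_def field_simps)
      then have "b' < norm \<zeta>" using \<zeta>(2) b'(1) by simp
      then have P: "P \<zeta>" and n: "1/2 \<le> norm \<zeta>" using b(2)[of \<zeta>] b' \<zeta>(1) by auto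
      have v: "0 < carleson_size n p q \<zeta>"
      proof -
        have "0 < 24 powr (q / p) * carleson_size n p q \<zeta>"
          using size_gauge_pos[OF \<zeta>(1), of n p q] size_gauge_le_carleson_size[OF n \<zeta>(1) pq, of n] by linarith
        then show ?thesis by (simp add: zero_less_mult_iff)
      qed
      have "emeasure \<mu> (pseudo_hyp_disc s \<zeta>) = \<Phi> \<zeta> * ennreal (carleson_size n p q \<zeta>)"
        unfolding \<Phi>_def using v by (simp add: ennreal_divide_times mult_divide_eq_ennreal)
      also have "\<dots> \<le> (SUP z\<in>{z. P z}. \<Phi> z) * ennreal (10 powr (q / p) * size_gauge n p q \<zeta>)"
        using P n \<zeta>(1) pq by (intro mult_mono SUP_upper ennreal_leI carleson_size_le) auto
      also have "\<dots> = \<Lambda> * ennreal (size_gauge n p q \<zeta>)"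
        using size_gauge_pos[OF \<zeta>(1), of n p q] by (simp add: \<Lambda>_def ennreal_mult mult_ac)
      finally show ?thesis .
    qed
    from essential_norm_le_carleson[OF \<mu> T pq r s this]
    have "E \<le> ennreal c0 * \<Lambda>" by (simp add: E_def c0_def)
    also have "\<dots> = ennreal c * (SUP z\<in>{z. P z}. \<Phi> z)"
      using c0 by (simp add: \<Lambda>_def cc ennreal_mult mult.assoc)
    finally show ?thesis .
  qed
  \<comment> \<open>Dividing by c moves the constant to the other side, so that the infimum over P
    can be taken directly.\<close>
  have "E / ennreal c \<le> carleson_limsup n p q s \<mu>"
    unfolding carleson_limsup_def Limsup_def \<Phi>_def[symmetric]
  proof (rule INF_greatest)
    fix P :: "complex \<Rightarrow> bool" assume "P \<in> {P. eventually P (filtercomap norm (at_left (1::real)))}"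
    then have "E \<le> ennreal c * (SUP z\<in>{z. P z}. \<Phi> z)" using step by simp
    then show "E / ennreal c \<le> (SUP z\<in>Collect P. \<Phi> z)"
      using c by (intro divide_le_posI_ennreal) (auto simp: mult.commute)
  qed
  then have "E / ennreal c * ennreal c \<le> carleson_limsup n p q s \<mu> * ennreal c"
    by (rule mult_right_mono) simp
  moreover have "E / ennreal c * ennreal c = E"
    using c by (simp add: ennreal_divide_times mult_divide_eq_ennreal)
  ultimately show ?thesis by (simp add: E_def mult.commute)
qed

text \<open>The derivative of the test function at a is bounded below on E_s(a), so integrating its
  q-th power over that disc alone already controls \<mu>(E_s(a)).\<close>

lemma carleson_quotient_le:
  assumes \<mu>: "borel_measure_on_disc \<mu>" and T: "bounded_op p \<omega> \<mu> q (diff_op n)" and pq: "1 < p" "p \<le> q"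
    and s: "0 < s" "s < 1" and b: "B \<le> 2 ^ b" and m: "m = b + 3" and a: "1/2 \<le> norm a" "norm a < 1"
  shows "emeasure \<mu> (pseudo_hyp_disc s a) / ennreal (carleson_size n p q a)
    \<le> ennreal (24 powr (q / p) / lower_const m n p q s * (\<integral>z. norm (diff_op n (test_fun m p a) z) powr q \<partial>\<mu>))"
proof -
  define I where "I = (\<integral>z. norm (diff_op n (test_fun m p a) z) powr q \<partial>\<mu>)"
  have I0: "0 \<le> I" unfolding I_def by (rule integral_nonneg_AE) simp
  define G where "G = size_gauge n p q a"
  have G: "0 < G" unfolding G_def by (rule size_gauge_pos) fact
  define c where "c = lower_const m n p q s"
  have c: "0 < c" unfolding c_def by (rule lower_const_pos) fact
  define v where "v = carleson_size n p q a"
  have Gv: "G \<le> 24 powr (q / p) * v" unfolding G_def v_def by (rule size_gauge_le_carleson_size[OF a pq])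
  then have v: "0 < v" using G by (smt (verit) mult_nonneg_nonpos powr_ge_zero)
  have Lq: "diff_op n (test_fun m p a) \<in> Lq_space \<mu> q"
    using T test_fun_bergman(1)[OF b m pq(1) a(2)] by (auto simp: bounded_op_def)
  have sets: "pseudo_hyp_disc s a \<in> sets \<mu>"
    using \<mu> pseudo_hyp_disc_borel[of s a]
    by (auto simp: borel_measure_on_disc_def sets_restrict_space_iff pseudo_hyp_disc_def)
  have "ennreal (c / G) * emeasure \<mu> (pseudo_hyp_disc s a) = (\<integral>\<^sup>+z. ennreal (c / G) * indicator (pseudo_hyp_disc s a) z \<partial>\<mu>)"
    using sets by (simp add: nn_integral_cmult_indicator)
  also have "\<dots> \<le> (\<integral>\<^sup>+z. ennreal (norm (diff_op n (test_fun m p a) z) powr q) \<partial>\<mu>)"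
  proof (intro nn_integral_mono)
    fix z
    have "c / G \<le> norm (diff_op n (test_fun m p a) z) powr q" if "z \<in> pseudo_hyp_disc s a"
      using test_fun_deriv_ge[OF _ pq a s that, of m n] m G by (simp add: c_def G_def diff_op_def field_simps)
    then show "ennreal (c / G) * indicator (pseudo_hyp_disc s a) z \<le> ennreal (norm (diff_op n (test_fun m p a) z) powr q)"
      by (auto split: split_indicator intro!: ennreal_leI)
  qed
  also have "\<dots> = ennreal I"
    unfolding I_def using Lq by (intro nn_integral_eq_integral) (auto simp: Lq_space_def)
  finally have le: "ennreal (c / G) * emeasure \<mu> (pseudo_hyp_disc s a) \<le> ennreal I" .
  have "emeasure \<mu> (pseudo_hyp_disc s a) = ennreal (G / c) * (ennreal (c / G) * emeasure \<mu> (pseudo_hyp_disc s a))"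
    using c G by (simp add: mult.assoc[symmetric] ennreal_mult[symmetric])
  also have "\<dots> \<le> ennreal (G / c) * ennreal I" using le by (rule mult_left_mono) simp
  also have "\<dots> = ennreal (G / c * I)" using G c I0 by (intro ennreal_mult[symmetric]) auto
  also have "\<dots> \<le> ennreal (24 powr (q / p) / c * I * v)"
  proof (intro ennreal_leI)
    have "G * (I / c) \<le> 24 powr (q / p) * v * (I / c)" using Gv I0 c by (intro mult_right_mono) auto
    then show "G / c * I \<le> 24 powr (q / p) / c * I * v" by (simp add: mult_ac)
  qed
  also have "\<dots> = ennreal (24 powr (q / p) / c * I) * ennreal v"
    using c I0 v by (intro ennreal_mult) auto
  finally have "emeasure \<mu> (pseudo_hyp_disc s a) \<le> ennreal (24 powr (q / p) / c * I) * ennreal v" .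
  then show ?thesis
    unfolding I_def c_def v_def[symmetric] using v by (intro divide_le_posI_ennreal) (auto simp: mult.commute)
qed

text \<open>If the bound failed, it would fail along points approaching the boundary. Their test
  functions are locally null, so Q nearly kills some of them, and for these the norm of the
  derivative is governed by the difference operator alone.\<close>

lemma carleson_limsup_le_op_norm:
  assumes \<mu>: "borel_measure_on_disc \<mu>" and T: "bounded_op p \<omega> \<mu> q (diff_op n)" and pq: "1 < p" "p \<le> q"
    and s: "0 < s" "s < 1" and b: "B \<le> 2 ^ b" and m: "m = b + 3" and K: "compact_op p \<omega> \<mu> q Q"
  defines "c \<equiv> 24 powr (q / p) / lower_const m n p q s * 2 powr q"
  shows "carleson_limsup n p q s \<mu> \<le> ennreal (c * op_norm p \<omega> \<mu> q (\<lambda>f z. diff_op n f z - Q f z) powr q)"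
proof (rule ennreal_le_epsilon)
  fix e :: real assume e: "0 < e"
  define N where "N = op_norm p \<omega> \<mu> q (\<lambda>f z. diff_op n f z - Q f z)"
  define \<Phi> where "\<Phi> z = emeasure \<mu> (pseudo_hyp_disc s z) / ennreal (carleson_size n p q z)" for z
  have c: "0 < c" using lower_const_pos[OF s(2), of m n p q] by (simp add: c_def)
  have q0: "0 < q" and p0: "0 < p" using pq by auto
  have "eventually (\<lambda>z. \<Phi> z \<le> ennreal (c * N powr q) + ennreal e) (filtercomap norm (at_left (1::real)))"
  proof (rule ccontr)
    assume not: "\<not> eventually (\<lambda>z. \<Phi> z \<le> ennreal (c * N powr q) + ennreal e) (filtercomap norm (at_left (1::real)))"
    \<comment> \<open>The shift by 2 places every chosen point in |a| > 1/2, where the test function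
      estimates apply, and still forces |a| to tend to 1.\<close>
    have "\<exists>a. 1 - 1 / real (k + 2) < norm a \<and> norm a < 1 \<and> \<not> \<Phi> a \<le> ennreal (c * N powr q) + ennreal e" for k
    proof -
      have "1 - 1 / real (k + 2) < (1::real)" by simp
      with not show ?thesis unfolding eventually_filtercomap_norm_at_left by blast
    qed
    then obtain a where a: "\<And>k. 1 - 1 / real (k + 2) < norm (a k)" "\<And>k. norm (a k) < 1"
      "\<And>k. \<not> \<Phi> (a k) \<le> ennreal (c * N powr q) + ennreal e" by metis
    have half: "1/2 \<le> norm (a k)" for k
    proof -
      have "1 / real (k + 2) \<le> 1 / 2" by (intro divide_left_mono) auto
      then show ?thesis using a(1)[of k] by linarith
    qed
    have lim: "(\<lambda>k. norm (a k)) \<longlonglongrightarrow> 1"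
    proof (rule tendsto_sandwich)
      have "(\<lambda>k. 1 / real (k + 2)) \<longlonglongrightarrow> 0"
        using LIMSEQ_ignore_initial_segment[OF lim_1_over_n, of 2] by simp
      then show "(\<lambda>k. 1 - 1 / real (k + 2)) \<longlonglongrightarrow> 1"
        using tendsto_diff[OF tendsto_const[of "1::real"]] by fastforce
    qed (use a in \<open>auto intro!: always_eventually less_imp_le\<close>)
    define F where "F k = test_fun m p (a k)" for k
    note F = test_fun_bergman[OF b m pq(1) a(2), folded F_def]
    have null: "locally_null F" unfolding F_def[abs_def] by (rule test_fun_locally_null[OF b m pq(1) a(2) lim])
    obtain r where r: "strict_mono r" "(\<lambda>k. \<integral>z. norm (Q (F (r k)) z) powr q \<partial>\<mu>) \<longlonglongrightarrow> 0"
      using compact_op_locally_null[OF pq K F null] by blast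
    \<comment> \<open>The threshold e/c is chosen so that, after multiplication by c, the error is
      exactly e.\<close>
    have "eventually (\<lambda>k. (\<integral>z. norm (Q (F (r k)) z) powr q \<partial>\<mu>) < e / c) sequentially"
      using e c by (intro order_tendstoD(2)[OF r(2)]) auto
    then obtain k where k: "(\<integral>z. norm (Q (F (r k)) z) powr q \<partial>\<mu>) < e / c"
      by (auto simp: eventually_sequentially)
    define f where "f = F (r k)"
    have f: "f \<in> bergman_space p \<omega>" "bergman_norm p \<omega> f \<le> 1"
      using F[of "r k"] bergman_norm_le_1_iff[OF p0] by (auto simp: f_def)
    have Kf: "Q f \<in> Lq_space \<mu> q" and Tf: "diff_op n f \<in> Lq_space \<mu> q"
      using compact_op_bounded[OF K] T f(1) by (auto simp: bounded_op_def)
    have mKf: "(\<lambda>z. - Q f z) \<in> Lq_space \<mu> q" using Kf by (auto simp: Lq_space_def)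
    have D: "(\<lambda>z. diff_op n f z - Q f z) \<in> Lq_space \<mu> q" using Lq_space_diff(1)[OF Tf Kf] q0 by simp
    have "(\<integral>z. norm (diff_op n f z - Q f z) powr q \<partial>\<mu>) = Lq_norm \<mu> q (\<lambda>z. diff_op n f z - Q f z) powr q"
      using q0 by (simp add: Lq_norm_powr)
    also have "\<dots> \<le> N powr q"
      unfolding N_def using q0 by (intro powr_mono2 Lq_norm_nonneg Lq_norm_diff_le_op_norm[OF T compact_op_bounded[OF K] q0 f]) auto
    finally have D1: "(\<integral>z. norm (diff_op n f z - Q f z) powr q \<partial>\<mu>) \<le> N powr q" .
    have "(\<integral>z. norm (diff_op n f z) powr q \<partial>\<mu>) \<le> 2 powr q * (N powr q + e / c)"
      using Lq_space_diff(2)[OF D mKf] q0 D1 k unfolding f_def[symmetric]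
      by (intro order_trans[OF _ mult_left_mono[of _ "N powr q + e / c"]]) auto
    then have "24 powr (q / p) / lower_const m n p q s * (\<integral>z. norm (diff_op n f z) powr q \<partial>\<mu>)
        \<le> 24 powr (q / p) / lower_const m n p q s * (2 powr q * (N powr q + e / c))"
      using lower_const_pos[OF s(2), of m n p q] by (intro mult_left_mono) auto
    also have "\<dots> = c * (N powr q + e / c)" by (simp only: c_def mult.assoc)
    also have "\<dots> = c * N powr q + e" using c by (simp add: distrib_left)
    finally have "\<Phi> (a (r k)) \<le> ennreal (c * N powr q + e)"
      using carleson_quotient_le[OF \<mu> T pq s b m half a(2), of "r k"]
      unfolding \<Phi>_def f_def F_def by (meson ennreal_leI order_trans)
    then show False using a(3)[of "r k"] c e by (simp add: ennreal_plus)
  qed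
  then show "carleson_limsup n p q s \<mu> \<le> ennreal (c * op_norm p \<omega> \<mu> q (\<lambda>f z. diff_op n f z - Q f z) powr q) + ennreal e"
    unfolding carleson_limsup_def \<Phi>_def N_def by (rule Limsup_bounded)
qed

text \<open>The infimum runs over norms, not over their q-th powers, so the previous bound is turned
  into a lower bound for each norm by a q-th root. The compact operator
  \<open>truncated_diff n 0\<close> shows that the set is nonempty and the limsup finite.\<close>

lemma carleson_limsup_le_essential_norm:
  assumes \<mu>: "borel_measure_on_disc \<mu>" and T: "bounded_op p \<omega> \<mu> q (diff_op n)" and pq: "1 < p" "p \<le> q"
    and s: "0 < s" "s < 1" and b: "B \<le> 2 ^ b" and m: "m = b + 3"
  defines "c \<equiv> 24 powr (q / p) / lower_const m n p q s * 2 powr q"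
  shows "carleson_limsup n p q s \<mu> \<le> ennreal c * ennreal (essential_norm p \<omega> \<mu> q (diff_op n) powr q)"
proof -
  have c: "0 < c" using lower_const_pos[OF s(2), of m n p q] by (simp add: c_def)
  have q0: "0 < q" and p0: "0 < p" using pq by auto
  have K0: "compact_op p \<omega> \<mu> q (truncated_diff n 0)" by (rule compact_op_truncated_diff[OF \<mu> T pq]) auto
  note le = carleson_limsup_le_op_norm[OF \<mu> T pq s b m, folded c_def]
  obtain l where l: "0 \<le> l" "carleson_limsup n p q s \<mu> = ennreal l"
    using le[OF K0] by (cases "carleson_limsup n p q s \<mu>") (auto simp: top_unique)
  have "(l / c) powr (1 / q) \<le> essential_norm p \<omega> \<mu> q (diff_op n)"
    unfolding essential_norm_def
  proof (rule cInf_greatest)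
    show "{op_norm p \<omega> \<mu> q (\<lambda>f z. diff_op n f z - Q f z) |Q. compact_op p \<omega> \<mu> q Q} \<noteq> {}" using K0 by blast
    fix x assume "x \<in> {op_norm p \<omega> \<mu> q (\<lambda>f z. diff_op n f z - Q f z) |Q. compact_op p \<omega> \<mu> q Q}"
    then obtain Q where K: "compact_op p \<omega> \<mu> q Q" and x: "x = op_norm p \<omega> \<mu> q (\<lambda>f z. diff_op n f z - Q f z)" by blast
    have x0: "0 \<le> x" unfolding x by (rule op_norm_diff_nonneg[OF T compact_op_bounded[OF K] q0 p0])
    have "ennreal l \<le> ennreal (c * x powr q)" using le[OF K] by (simp add: l x)
    then have "l \<le> c * x powr q" using c by (simp add: ennreal_le_iff)
    then have "l / c \<le> x powr q" using c by (simp add: field_simps)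
    then have "(l / c) powr (1 / q) \<le> (x powr q) powr (1 / q)"
      using l c q0 by (intro powr_mono2) auto
    then show "(l / c) powr (1 / q) \<le> x" using x0 q0 by (simp add: powr_powr)
  qed
  then have "((l / c) powr (1 / q)) powr q \<le> essential_norm p \<omega> \<mu> q (diff_op n) powr q"
    using q0 by (intro powr_mono2) auto
  then have "l \<le> c * essential_norm p \<omega> \<mu> q (diff_op n) powr q"
    using l c q0 by (simp add: powr_powr field_simps)
  then have "ennreal l \<le> ennreal (c * essential_norm p \<omega> \<mu> q (diff_op n) powr q)" by (rule ennreal_leI)
  then show ?thesis using c by (simp add: l ennreal_mult)
qed

end

theorem theorem2p2:
  fixes p q s :: real and n :: nat and \<omega> :: "real \<Rightarrow> real"
  assumes "1 < p" and "p \<le> q" and "\<omega> \<in> D_class" and "0 < s" and "s < 1"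
  shows "\<exists>C>0. \<forall>\<mu>. borel_measure_on_disc \<mu> \<and> bounded_op p \<omega> \<mu> q (diff_op n) \<longrightarrow>
     (let L = Limsup (filtercomap norm (at_left (1::real)))
                (\<lambda>z. emeasure \<mu> (pseudo_hyp_disc s z) /
                      ennreal ((1 - norm z) powr (real n * q) *
                               (measure (wA \<omega>) (carleson_square z)) powr (q / p)));
          E = essential_norm p \<omega> \<mu> q (diff_op n) powr q
      in ennreal E \<le> ennreal C * L \<and> L \<le> ennreal C * ennreal E)"
proof -
  obtain B K R where "1 \<le> B" "1 < K" "1 < R" "radial_weight \<omega>"
    "\<forall>r\<in>{0..<1}. omega_hat \<omega> r \<le> B * omega_hat \<omega> ((1 + r) / 2)"
    "\<forall>r\<in>{0..<1}. omega_hat \<omega> r \<ge> R * omega_hat \<omega> (1 - (1 - r) / K)"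
    using assms(3) unfolding D_class_def D_hat_class_def by blast
  then interpret D_weight \<omega> B K R by unfold_locales auto
  \<comment> \<open>b depends on the doubling constant only, so the exponent b + 3 of the test
    functions is the same for all \<mu>.\<close>
  obtain b where "B < 2 ^ b" using real_arch_pow[of 2 B] by auto
  then have b: "B \<le> 2 ^ b" by simp
  define c1 where "c1 = deriv_const p n powr (q / p) * 4 powr (q / p - 1) * carleson_const n p q s * 10 powr (q / p)"
  define c2 where "c2 = 24 powr (q / p) / lower_const (b + 3) n p q s * 2 powr q"
  define C where "C = max 1 (max c1 c2)"
  have C: "0 < C" "c1 \<le> C" "c2 \<le> C" by (auto simp: C_def)
  have "ennreal (essential_norm p \<omega> \<mu> q (diff_op n) powr q) \<le> ennreal C * carleson_limsup n p q s \<mu>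
      \<and> carleson_limsup n p q s \<mu> \<le> ennreal C * ennreal (essential_norm p \<omega> \<mu> q (diff_op n) powr q)"
    if \<mu>: "borel_measure_on_disc \<mu>" "bounded_op p \<omega> \<mu> q (diff_op n)" for \<mu>
  proof
    show "ennreal (essential_norm p \<omega> \<mu> q (diff_op n) powr q) \<le> ennreal C * carleson_limsup n p q s \<mu>"
      using essential_norm_upper[OF \<mu> assms(1,2,4), folded c1_def] C(2)
      by (meson ennreal_leI mult_right_mono order_trans zero_le)
    show "carleson_limsup n p q s \<mu> \<le> ennreal C * ennreal (essential_norm p \<omega> \<mu> q (diff_op n) powr q)"
      using carleson_limsup_le_essential_norm[OF \<mu> assms(1,2,4,5) b refl, folded c2_def] C(3)
      by (meson ennreal_leI mult_right_mono order_trans zero_le)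
  qed
  then show ?thesis
    unfolding carleson_limsup_def carleson_size_def Let_def using C(1) by blast
qed

end
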